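(* For every fixed $x>0$, $$\lim_{\tau\to\infty}\ln\left\{\frac{\Gamma\left(\left[\frac{x}{1-c}\tau\right]^1\right)}{\Gamma\left(\frac{x}{1-c}\tau\right)}\right\}^{\frac1\tau}=x,$$ where $\left[\frac{x}{1-c}\tau\right]^1=\varphi_1^{-1}\left(\frac{x}{1-c}\tau\right)$.
   Context: $\Gamma$ is Euler's Gamma-function, $c$ is Euler's constant ($c=0.5772\ldots$), $\zeta$ is the Riemann zeta-function. The expression $\ln\{A\}^{1/\tau}$ means $\ln(A^{1/\tau})=\frac1\tau\ln A$. Jacob's ladder: fix a smooth, increasing, unbounded function $\mu$ on a half-line $[y_0,\infty)$ with $\mu(y)\ge 7y\ln y$. For all sufficiently large $T$ let $\varphi(T)$ be the solution $X=\varphi(T)$ of $\int_0^{\mu(X)}|\zeta(\frac12+it)|^2e^{-2t/X}\,dt=\int_0^T|\zeta(\frac12+it)|^2\,dt$, and put $\varphi_1(T)=\frac12\varphi(T)$ (a Jacob's ladder). The function $\varphi_1$ is continuous, strictly increasing and unbounded for large $T$; for large $T$, $[T]^1=\varphi_1^{-1}(T)$ denotes the value of its inverse function. *)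

theory Defs
  imports "HOL-Complex_Analysis.Complex_Analysis"
begin

text \<open>
  The Riemann zeta function at \<open>s \<noteq> 1\<close> is the value at \<open>s\<close> of the analytic continuation of the
  Dirichlet series from \<open>Re z > 1\<close> to some punctured half-plane \<open>{z. a < Re z} - {1}\<close> containing
  \<open>s\<close>. The value does not depend on the half-plane, by the identity theorem (see
  \<open>riemann_zeta_eqI\<close> below). The value at the pole \<open>s = 1\<close> is unspecified.
\<close>

definition is_zeta_continuation :: "real \<Rightarrow> (complex \<Rightarrow> complex) \<Rightarrow> bool" where
  "is_zeta_continuation a f \<longleftrightarrow>
     f holomorphic_on ({z. a < Re z} - {1}) \<and>
     (\<forall>z. 1 < Re z \<longrightarrow> f z = (\<Sum>n. 1 / of_nat (Suc n) powr z))"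

definition riemann_zeta :: "complex \<Rightarrow> complex" where
  "riemann_zeta s = (THE w. \<exists>a f. a < Re s \<and> is_zeta_continuation a f \<and> f s = w)"

lemma is_zeta_continuation_unique_aux:
  assumes "is_zeta_continuation a f" "is_zeta_continuation b g" "a \<le> b" "b < Re s" "s \<noteq> 1"
  shows "f s = g s"
proof (cases "Re s > 1")
  case True
  then show ?thesis using assms by (simp add: is_zeta_continuation_def)
next
  case False
  define U where "U = {z. b < Re z} - {1 :: complex}"
  have "open U"
    unfolding U_def by (intro open_delete open_halfspace_Re_gt)
  have "connected U"
    unfolding U_def
    by (intro connected_open_delete open_halfspace_Re_gt convex_connected convex_halfspace_Re_gt) simp
  have f: "f holomorphic_on U" and g: "g holomorphic_on U"
    using assms by (auto simp: is_zeta_continuation_def U_def elim!: holomorphic_on_subset)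
  show ?thesis
  proof (rule analytic_continuation_open[of "{z. Re z > 1}" U f g])
    show "{z. Re z > 1} \<subseteq> U"
      using assms False by (auto simp: U_def)
    have "2 \<in> {z. Re z > 1}" by simp
    then show "{z. Re z > 1} \<noteq> {}" by blast
  qed (use assms f g \<open>open U\<close> \<open>connected U\<close> in
        \<open>auto simp: is_zeta_continuation_def U_def open_halfspace_Re_gt\<close>)
qed

lemma riemann_zeta_eqI:
  assumes "is_zeta_continuation a f" "a < Re s" "s \<noteq> 1"
  shows "riemann_zeta s = f s"
  unfolding riemann_zeta_def
proof (rule the_equality)
  show "\<exists>a' f'. a' < Re s \<and> is_zeta_continuation a' f' \<and> f' s = f s"
    using assms by blast
next
  fix w assume "\<exists>a' f'. a' < Re s \<and> is_zeta_continuation a' f' \<and> f' s = w"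
  then obtain b g where "b < Re s" "is_zeta_continuation b g" "g s = w" by blast
  then show "w = f s"
    using is_zeta_continuation_unique_aux[of a f b g s]
      is_zeta_continuation_unique_aux[of b g a f s] assms
    by (cases "a \<le> b") auto
qed

text \<open>\<open>C\<^sup>\<infinity>\<close> on \<open>[a, \<infinity>)\<close>, with one-sided derivatives at \<open>a\<close>.\<close>

definition smooth_on_halfline :: "(real \<Rightarrow> real) \<Rightarrow> real \<Rightarrow> bool" where
  "smooth_on_halfline f a \<longleftrightarrow>
     (\<exists>D :: nat \<Rightarrow> real \<Rightarrow> real. D 0 = f \<and>
        (\<forall>k. \<forall>y\<in>{a..}. (D k has_real_derivative D (Suc k) y) (at y within {a..})))"

definition zeta_mean_square :: "real \<Rightarrow> real" where
  "zeta_mean_square T = integral {0..T} (\<lambda>t. (cmod (riemann_zeta (Complex (1/2) t)))\<^sup>2)"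

definition ladder_solution :: "(real \<Rightarrow> real) \<Rightarrow> real \<Rightarrow> real \<Rightarrow> real \<Rightarrow> bool" where
  "ladder_solution \<mu> y\<^sub>0 T X \<longleftrightarrow>
     X \<ge> y\<^sub>0 \<and>
     integral {0..\<mu> X} (\<lambda>t. (cmod (riemann_zeta (Complex (1/2) t)))\<^sup>2 * exp (- 2 * t / X))
       = zeta_mean_square T"

definition jacob_phi :: "(real \<Rightarrow> real) \<Rightarrow> real \<Rightarrow> real \<Rightarrow> real" where
  "jacob_phi \<mu> y\<^sub>0 T = (THE X. ladder_solution \<mu> y\<^sub>0 T X)"

definition jacob_ladder :: "(real \<Rightarrow> real) \<Rightarrow> real \<Rightarrow> real \<Rightarrow> real" where
  "jacob_ladder \<mu> y\<^sub>0 T = jacob_phi \<mu> y\<^sub>0 T / 2"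

text \<open>
  For small \<open>T\<close> the equation need not have a solution \<open>X \<ge> y\<^sub>0\<close>, so that \<open>jacob_phi\<close> is unspecified
  there. The ladder is therefore inverted only on the set of those \<open>T\<close> for which it is well defined;
  this set contains all sufficiently large \<open>T\<close>.
\<close>

definition ladder_domain :: "(real \<Rightarrow> real) \<Rightarrow> real \<Rightarrow> real set" where
  "ladder_domain \<mu> y\<^sub>0 = {T. 0 \<le> T \<and> (\<exists>!X. ladder_solution \<mu> y\<^sub>0 T X)}"

definition ladder_inverse :: "(real \<Rightarrow> real) \<Rightarrow> real \<Rightarrow> real \<Rightarrow> real" where
  "ladder_inverse \<mu> y\<^sub>0 = inv_into (ladder_domain \<mu> y\<^sub>0) (jacob_ladder \<mu> y\<^sub>0)"

end

theory Submission
  imports Defs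
begin

text \<open>
  Write \<open>Z t = |zeta (1/2 + i t)|\<^sup>2\<close>, \<open>I T = \<integral>\<^sub>0\<^sup>T Z\<close>, \<open>c\<close> for Euler's constant and \<open>T = [y]\<^sup>1\<close>. The ladder equation
  reads \<open>I T = F y\<close>, where \<open>F y = \<integral> Z t e\<^bsup>-t/y\<^esup> dt\<close>, up to a negligible tail, is a Laplace mean. If
  \<open>I T = T ln T + A T + o T\<close> for some constant \<open>A\<close>, then \<open>F y = y ln y + (A + 1 - c) y + o y\<close>, because
  \<open>\<integral> u ln u e\<^bsup>-u\<^esup> du = 1 - c\<close>; so \<open>A\<close> cancels and \<open>T - y\<close> is asymptotic to \<open>(1 - c) y / ln y\<close>. As
  \<open>ln Gamma\<close> has slope about \<open>ln y\<close> there, \<open>ln Gamma T - ln Gamma y\<close> is asymptotic to \<open>(1 - c) y\<close>.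

  The expansion of \<open>I\<close> needs neither the functional equation nor the approximate one. From
  \<open>zeta s = - s \<integral> frac y y\<^bsup>-s-1\<^esup> dy\<close> for \<open>0 < Re s < 1\<close>, \<open>Z t / |s|\<^sup>2\<close> is the Fourier transform of the multiplicative
  autocorrelation of \<open>frac\<close>, which near the origin equals \<open>const + |u| ln |u| / 2 + B |u| + O(|u|\<^bsup>4/3\<^esup>)\<close>
  by an elementary computation. By scaling, the second Cesaro mean of \<open>Z\<close> is
  \<open>ln T / 3 + b + O(T\<^bsup>-1/3\<^esup>)\<close>; as \<open>I\<close> and its integral are monotone, differencing twice gives \<open>I\<close>.
\<close>

section \<open>The zeta function on the critical line as a Mellin integral\<close>

text \<open>An error \<open>o T\<close> in \<open>I\<close> is all that the comparison with the
  Laplace mean asks for, so crude estimates are affordable as long as the last term of the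
  autocorrelation expansion has an exponent strictly between 1 and 2. The obstacle is the sharp
  cut-off at \<open>T\<close>: its kernel decays only like \<open>1 / v\<close>, and neither
  \<open>|v|\<close> nor \<open>|v| powr (4/3)\<close> is integrable against that. The weight
  \<open>(1 - t)\<^sup>2\<close> repairs this at the price of two differencings, each of which costs
  at least half of the power saved. The relative errors are \<open>T powr (-1/3)\<close> for the
  second mean, \<open>T powr (-0.1)\<close> for the first and \<open>T powr (-0.04)\<close> for
  \<open>I\<close> itself; the last two are rounded so that logarithms disappear in them. The
  exponent \<open>4/3\<close> is what remains after the best choice of the point up to which the
  autocorrelation is computed exactly.\<close>

definition zeta_block :: "nat \<Rightarrow> complex \<Rightarrow> complex" where
  "zeta_block n s = s / (1 - s) * (of_nat (Suc n) powr (1 - s) - of_nat n powr (1 - s))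
     + of_nat n * (of_nat (Suc n) powr (-s) - of_nat n powr (-s))"

lemma of_nat_powr_eq_exp: "0 < n \<Longrightarrow> of_nat n powr z = exp (z * of_real (ln (real n)))" for z :: complex
  by (simp add: powr_def Ln_of_nat)

text \<open>With \<open>y = exp x\<close> the integral is that of
  \<open>frac y * y powr (-s-1)\<close> over \<open>[n, n + 1]\<close>, so
  \<open>zeta_block n s\<close> is \<open>s\<close> times this piece of the Mellin integral. The
  closed form serves as definition because its holomorphy in \<open>s\<close> is evident; the
  integral form gives its size.\<close>

lemma has_integral_zeta_block:
  assumes "0 < n" "s \<noteq> 0" "s \<noteq> 1"
  shows "((\<lambda>x. of_real (frac (exp x)) * exp (- s * of_real x)) has_integral zeta_block n s / s)
           {ln (real n)..ln (real (Suc n))}"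
proof -
  define F where "F = (\<lambda>x::real. exp ((1 - s) * of_real x) / (1 - s) + of_nat n * exp (- s * of_real x) / s)"
  have d: "(F has_vector_derivative (of_real (exp x - n) * exp (- s * of_real x))) (at x within X)" for x X
    unfolding F_def
    apply (rule derivative_eq_intros has_vector_derivative_real_field | simp)+
    using assms by (auto simp: field_simps exp_of_real[symmetric] mult_exp_exp simp flip: exp_add)
  have "((\<lambda>x. of_real (exp x - n) * exp (- s * of_real x)) has_integral (F (ln (real (Suc n))) - F (ln (real n))))
           {ln (real n)..ln (real (Suc n))}"
    by (rule fundamental_theorem_of_calculus) (use d assms in auto)
  moreover have "F (ln (real (Suc n))) - F (ln (real n)) = zeta_block n s / s"
  proof -
    have *: "p / d + m * p' / s - (q / d + m * q' / s) = (s / d * (p - q) + m * (p' - q')) / s"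
      if "d \<noteq> 0" for p q p' q' d m :: complex
      using assms that by (simp add: field_simps)
    have "1 - s \<noteq> 0" using assms by simp
    show ?thesis
      unfolding F_def zeta_block_def *[OF \<open>1 - s \<noteq> 0\<close>] using assms by (simp add: of_nat_powr_eq_exp del: of_nat_Suc)
  qed
  ultimately have i: "((\<lambda>x. of_real (exp x - n) * exp (- s * of_real x)) has_integral zeta_block n s / s)
           {ln (real n)..ln (real (Suc n))}" by simp
  \<comment> \<open>At the right endpoint \<open>frac (exp x)\<close> drops to 0 while
    \<open>exp x - n\<close> is 1, so this point is excepted.\<close>
  show ?thesis
  proof (rule has_integral_spike_finite[OF _ _ i, of "{ln (real (Suc n))}"])
    fix x assume x: "x \<in> {ln (real n)..ln (real (Suc n))} - {ln (real (Suc n))}"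
    then have "real n \<le> exp x" "exp x < real (Suc n)"
    proof -
      have "exp (ln (real n)) \<le> exp x" using x by (simp only: exp_le_cancel_iff atLeastAtMost_iff Diff_iff)
      then show "real n \<le> exp x" using assms by simp
      have "x < ln (real (Suc n))" using x by auto
      then have "exp x < exp (ln (real (Suc n)))" by (simp only: exp_less_cancel_iff)
      then show "exp x < real (Suc n)" by simp
    qed
    then have "frac (exp x) = exp x - n"
      by (simp add: frac_unique_iff)
    then show "of_real (frac (exp x)) * exp (- s * of_real x) = of_real (exp x - n) * exp (- s * of_real x)"
      by simp
  qed auto
qed

text \<open>Estimating the integral instead of the closed form captures the cancellation between the
  powers: the interval has length \<open>ln (1 + 1 / n)\<close>, at most \<open>1 / n\<close>, and
  the integrand is at most \<open>n powr (- Re s)\<close>. The extra factor \<open>1 / n\<close>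
  makes the series of blocks converge for all \<open>Re s > 0\<close>.\<close>

lemma norm_zeta_block_le:
  assumes "0 < n" "0 < Re s" "s \<noteq> 1"
  shows "norm (zeta_block n s) \<le> norm s * real n powr (- Re s - 1)"
proof -
  have s0: "s \<noteq> 0" using assms by auto
  have "norm (zeta_block n s / s)
      \<le> exp (- Re s * ln (real n)) * measure lborel (cbox (ln (real n)) (ln (real (Suc n))))"
  proof (rule has_integral_bound)
    show "((\<lambda>x. of_real (frac (exp x)) * exp (- s * of_real x)) has_integral zeta_block n s / s)
       (cbox (ln (real n)) (ln (real (Suc n))))"
      using has_integral_zeta_block[OF assms(1) s0 assms(3)] by simp
    fix x assume x: "x \<in> cbox (ln (real n)) (ln (real (Suc n)))"
    have "norm (complex_of_real (frac (exp x)) * exp (- s * of_real x)) = \<bar>frac (exp x)\<bar> * exp (- Re s * x)"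
      by (simp add: norm_mult)
    also have "\<dots> \<le> 1 * exp (- Re s * ln (real n))"
      using x assms frac_lt_1[of "exp x"] by (intro mult_mono) (auto simp: frac_lt_1 less_imp_le)
    finally show "norm (complex_of_real (frac (exp x)) * exp (- s * of_real x)) \<le> exp (- Re s * ln (real n))"
      by simp
  qed simp
  also have "measure lborel (cbox (ln (real n)) (ln (real (Suc n)))) = ln (1 + 1 / real n)"
  proof -
    have "1 + 1 / real n = real (Suc n) / real n" using assms by (simp add: field_simps)
    then show ?thesis using assms by (simp add: ln_div del: of_nat_Suc)
  qed
  also have "\<dots> \<le> 1 / real n"
    using assms by (intro ln_add_one_self_le_self) auto
  also have "exp (- Re s * ln (real n)) * (1 / real n) = real n powr (- Re s - 1)"
    using assms by (simp add: powr_def exp_diff algebra_simps)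
  finally show ?thesis using s0 by (simp add: norm_divide field_simps mult_left_mono)
qed

text \<open>Abel summation: the differences of the powers \<open>1 - s\<close> telescope, and the
  differences of the powers \<open>-s\<close>, weighted by \<open>n\<close>, leave a boundary term
  minus the partial Dirichlet sum.\<close>

lemma sum_zeta_block:
  "(\<Sum>n<N. zeta_block (Suc n) s) =
     s / (1 - s) * (of_nat (Suc N) powr (1 - s) - 1) + of_nat (Suc N) * of_nat (Suc N) powr (-s)
     - (\<Sum>n\<le>N. of_nat (Suc n) powr (-s))"
proof (induction N)
  case 0
  then show ?case by simp
next
  case (Suc N)
  have "of_nat (Suc (Suc N)) = (of_nat (Suc N) :: complex) + 1" by simp
  then show ?case
    unfolding sum.lessThan_Suc Suc.IH sum.atMost_Suc zeta_block_def[of "Suc N"]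
    by (simp add: algebra_simps del: of_nat_Suc)
qed

lemma of_nat_mult_powr_minus:
  "of_nat (Suc N) * of_nat (Suc N) powr (-s) = of_nat (Suc N) powr (1 - s)" for s :: complex
proof -
  have "of_nat (Suc N) powr (1 - s) = of_nat (Suc N) powr 1 * of_nat (Suc N) powr (-s)"
    by (subst powr_add [symmetric]) simp
  then show ?thesis by simp
qed

lemma summable_zeta_block:
  assumes "0 < Re s" "s \<noteq> 1"
  shows "summable (\<lambda>n. zeta_block (Suc n) s)"
proof (rule summable_comparison_test)
  show "\<exists>N. \<forall>n\<ge>N. norm (zeta_block (Suc n) s) \<le> norm s * real (Suc n) powr (- Re s - 1)"
    using norm_zeta_block_le[OF _ assms] by blast
  show "summable (\<lambda>n. norm s * real (Suc n) powr (- Re s - 1))"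
    using assms by (intro summable_mult) (subst summable_Suc_iff, simp add: summable_real_powr_iff)
qed

text \<open>The classical continuation: \<open>s / (s - 1)\<close> minus \<open>s\<close> times the
  integral of \<open>frac y * y powr (-s-1)\<close> over \<open>[1, \<infinity>)\<close>, cut at the
  integers.\<close>

definition zeta_ext :: "complex \<Rightarrow> complex" where
  "zeta_ext s = s / (s - 1) - (\<Sum>n. zeta_block (Suc n) s)"

lemma holomorphic_zeta_ext: "zeta_ext holomorphic_on ({s. 0 < Re s} - {1})"
proof -
  define S where "S = {s. 0 < Re s} - {1 :: complex}"
  have op: "open S" unfolding S_def by (intro open_delete open_halfspace_Re_gt)
  have "(\<lambda>s. \<Sum>n. zeta_block (Suc n) s) holomorphic_on S"
  proof (rule holomorphic_uniform_sequence[OF op])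
    show "(\<lambda>s. \<Sum>n<N. zeta_block (Suc n) s) holomorphic_on S" for N
      unfolding zeta_block_def S_def by (intro holomorphic_intros) (auto simp del: of_nat_Suc)
    fix x assume "x \<in> S"
    then obtain d where d: "d > 0" "cball x d \<subseteq> S" using op open_contains_cball by blast
    \<comment> \<open>The leftmost point of the disc lies in \<open>S\<close>, so
      \<open>Re x - d > 0\<close> bounds \<open>Re s\<close> from below on the whole disc; this
      yields a summable majorant independent of \<open>s\<close>.\<close>
    have "x - of_real d \<in> cball x d" using d by (simp add: dist_norm)
    then have "x - of_real d \<in> S" using d by blast
    then have xd: "0 < Re x - d" by (simp add: S_def)
    have "uniform_limit (cball x d) (\<lambda>N s. \<Sum>n<N. zeta_block (Suc n) s)
        (\<lambda>s. \<Sum>n. zeta_block (Suc n) s) sequentially"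
    proof (rule Weierstrass_m_test)
      show "summable (\<lambda>n. (norm x + d) * real (Suc n) powr (- (Re x - d) - 1))"
        using xd by (intro summable_mult) (subst summable_Suc_iff, simp add: summable_real_powr_iff)
      fix n s assume s: "s \<in> cball x d"
      then have sS: "s \<in> S" using d by auto
      have n: "norm (s - x) \<le> d" using s by (simp add: dist_norm norm_minus_commute)
      have "norm (zeta_block (Suc n) s) \<le> norm s * real (Suc n) powr (- Re s - 1)"
        using sS by (intro norm_zeta_block_le) (auto simp: S_def)
      also have "\<dots> \<le> (norm x + d) * real (Suc n) powr (- (Re x - d) - 1)"
      proof (intro mult_mono powr_mono)
        show "norm s \<le> norm x + d" using n norm_triangle_sub[of s x] by linarith
        have "\<bar>Re (s - x)\<bar> \<le> d" using abs_Re_le_cmod[of "s - x"] n by linarith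
        then show "- Re s - 1 \<le> - (Re x - d) - 1" by simp
      qed (use d in auto)
      finally show "norm (zeta_block (Suc n) s) \<le> (norm x + d) * real (Suc n) powr (- (Re x - d) - 1)" .
    qed
    then show "\<exists>d>0. cball x d \<subseteq> S \<and> uniform_limit (cball x d) (\<lambda>N s. \<Sum>n<N. zeta_block (Suc n) s)
        (\<lambda>s. \<Sum>n. zeta_block (Suc n) s) sequentially" using d by blast
  qed
  then show ?thesis
    unfolding zeta_ext_def S_def by (intro holomorphic_intros) auto
qed

lemma zeta_ext_eq_Dirichlet_series:
  assumes "1 < Re s"
  shows "zeta_ext s = (\<Sum>n. 1 / of_nat (Suc n) powr s)"
proof -
  have s1: "s \<noteq> 1" using assms by auto
  have "(\<lambda>N. \<Sum>n<N. zeta_block (Suc n) s) \<longlonglongrightarrow> (\<Sum>n. zeta_block (Suc n) s)"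
    using summable_zeta_block[of s] assms s1 by (intro summable_LIMSEQ) auto
  moreover have "(\<lambda>N. of_nat (Suc N) powr (1 - s)) \<longlonglongrightarrow> 0"
    by (rule tendsto_neg_powr_complex_of_nat[OF filterlim_Suc]) (use assms in auto)
  ultimately have "(\<lambda>N. s / (s - 1) - (\<Sum>n<N. zeta_block (Suc n) s) - of_nat (Suc N) powr (1 - s) / (s - 1))
      \<longlonglongrightarrow> s / (s - 1) - (\<Sum>n. zeta_block (Suc n) s) - 0 / (s - 1)"
    using s1 by (intro tendsto_intros) auto
  moreover have "s / (s - 1) - (\<Sum>n<N. zeta_block (Suc n) s) - of_nat (Suc N) powr (1 - s) / (s - 1)
      = (\<Sum>n\<le>N. 1 / of_nat (Suc n) powr s)" for N
  proof -
    have *: "s / (s - 1) - (s / (1 - s) * (p - 1) + p - q) - p / (s - 1) = q" for p q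
      using s1 by (simp add: divide_simps) (simp add: algebra_simps)
    show ?thesis
      unfolding sum_zeta_block of_nat_mult_powr_minus * by (simp add: powr_minus_divide)
  qed
  ultimately have "(\<lambda>N. \<Sum>n\<le>N. 1 / of_nat (Suc n) powr s) \<longlonglongrightarrow> zeta_ext s"
    by (simp add: zeta_ext_def)
  then have "(\<lambda>n. 1 / of_nat (Suc n) powr s) sums zeta_ext s"
    by (simp add: sums_def_le)
  then show ?thesis by (simp add: sums_iff)
qed

lemma riemann_zeta_eq_zeta_ext:
  assumes "0 < Re s" "s \<noteq> 1"
  shows "riemann_zeta s = zeta_ext s"
  by (rule riemann_zeta_eqI[of 0])
     (use assms holomorphic_zeta_ext zeta_ext_eq_Dirichlet_series in \<open>auto simp: is_zeta_continuation_def\<close>)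

lemma continuous_on_riemann_zeta_critical:
  "continuous_on A (\<lambda>t. riemann_zeta (Complex (1/2) t))"
proof -
  have "continuous_on A (\<lambda>t. zeta_ext (Complex (1/2) t))"
  proof (rule continuous_on_compose2[OF holomorphic_on_imp_continuous_on[OF holomorphic_zeta_ext]])
    have "continuous_on A (\<lambda>t. of_real (1/2) + \<i> * of_real t :: complex)"
      by (intro continuous_intros)
    then show "continuous_on A (\<lambda>t. Complex (1/2) t)" by (simp add: Complex_eq)
  qed (auto simp: complex_eq_iff)
  then show ?thesis by (simp add: riemann_zeta_eq_zeta_ext complex_eq_iff)
qed

section \<open>The Mellin integral on the critical line as a Fourier integral\<close>

lemma integrable_exp_neg_abs:
  assumes "0 < c"
  shows "integrable lborel (\<lambda>x::real. exp (- c * \<bar>x\<bar>))"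
proof -
  have p: "set_integrable lborel {0..} (\<lambda>x::real. exp (- c * x))"
  proof -
    have "(\<lambda>x::real. exp (- c * x)) absolutely_integrable_on {0..}"
      by (rule nonnegative_absolutely_integrable_1)
         (use has_integral_exp_minus_to_infinity[OF assms, of 0] in \<open>auto simp: integrable_on_def\<close>)
    then show ?thesis
      unfolding set_integrable_def by (subst (asm) integrable_completion) auto
  qed
  then have p': "integrable lborel (\<lambda>x::real. indicator {0..} x *\<^sub>R exp (- c * x))"
    by (simp add: set_integrable_def)
  then have "integrable lborel (\<lambda>x::real. indicator {0..} (0 + (-1) * x) *\<^sub>R exp (- c * (0 + (-1) * x)))"
    by (rule lborel_integrable_real_affine) simp
  with p' have "integrable lborel (\<lambda>x::real. indicator {0..} x *\<^sub>R exp (- c * x)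
      + indicator {0..} (0 + (-1) * x) *\<^sub>R exp (- c * (0 + (-1) * x)))"
    by (rule Bochner_Integration.integrable_add)
  then show ?thesis
    by (rule Bochner_Integration.integrable_bound) (auto simp: indicator_def abs_if)
qed

text \<open>\<open>frac y / sqrt y\<close> in the variable \<open>y = exp x\<close>. On the line
  \<open>Re s = 1/2\<close> the Mellin transform thereby becomes a Fourier transform, and dilations
  of \<open>y\<close> become translations of \<open>x\<close>.\<close>

definition frac_wave :: "real \<Rightarrow> real" where
  "frac_wave x = frac (exp x) * exp (- x / 2)"

lemma measurable_frac [measurable]: "(\<lambda>x. frac (f x :: real)) \<in> borel_measurable M"
  if [measurable]: "f \<in> borel_measurable M" for f
  unfolding frac_def by measurable

lemma frac_wave_measurable [measurable]: "frac_wave \<in> borel_measurable borel"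
  unfolding frac_wave_def by measurable

lemma frac_wave_nonneg: "0 \<le> frac_wave x"
  by (simp add: frac_wave_def)

lemma frac_wave_le: "frac_wave x \<le> exp (- (1/2) * \<bar>x\<bar>)"
proof (cases "x < 0")
  case True
  then have "frac (exp x) = exp x" by (simp add: frac_eq)
  then show ?thesis using True by (simp add: frac_wave_def flip: exp_add)
next
  case False
  then show ?thesis using frac_lt_1[of "exp x"] by (simp add: frac_wave_def mult_left_le_one_le less_imp_le)
qed

lemma integrable_frac_wave: "integrable lborel frac_wave"
  by (rule Bochner_Integration.integrable_bound[OF integrable_exp_neg_abs[of "1/2"]])
     (use frac_wave_le frac_wave_nonneg in auto)

text \<open>Over \<open>x < 0\<close>, where \<open>frac (exp x) = exp x\<close>, the integral is
  \<open>1 / (1 - s)\<close>; times \<open>- s\<close> this is the term \<open>s / (s - 1)\<close>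
  of \<open>zeta_ext\<close>, and the half-line \<open>x > 0\<close> supplies the blocks. The polar
  term is thus absorbed into a single transform over the whole line.\<close>

lemma riemann_zeta_critical:
  "riemann_zeta (Complex (1/2) t) =
     - Complex (1/2) t * (LINT x|lborel. of_real (frac_wave x) * cis (- t * x))"
proof -
  define s where "s = Complex (1/2) t"
  have s: "s \<noteq> 0" "s \<noteq> 1" "0 < Re s" "Re (1 - s) > 0" by (auto simp: s_def complex_eq_iff)
  define g where "g = (\<lambda>x. of_real (frac (exp x)) * exp (- s * of_real x))"
  have g_eq: "g x = of_real (frac_wave x) * cis (- t * x)" for x
  proof -
    have "- s * of_real x = of_real (- x / 2) + \<i> * of_real (- t * x)"
      by (simp add: s_def complex_eq_iff)
    then have "exp (- s * of_real x) = of_real (exp (- x / 2)) * cis (- t * x)"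
      by (simp only: exp_add cis_conv_exp exp_of_real)
    then show ?thesis
      unfolding g_def frac_wave_def by simp
  qed
  have norm_g: "norm (g x) = frac_wave x" for x
    unfolding g_eq by (simp add: norm_mult frac_wave_nonneg)
  have g_meas [measurable]: "g \<in> borel_measurable borel"
    unfolding g_def by measurable
  have g_int: "integrable lborel g"
    by (rule Bochner_Integration.integrable_bound[OF integrable_frac_wave])
       (auto simp: norm_g frac_wave_nonneg)
  have neg: "(g has_integral (1 - exp (- (1 - s) * of_nat N)) / (1 - s)) {- real N..0}" for N
  proof -
    have "((\<lambda>x. exp ((1 - s) * of_real x)) has_integral
        (exp ((1 - s) * of_real 0) / (1 - s) - exp ((1 - s) * of_real (- real N)) / (1 - s))) {- real N..0}"
    proof (rule fundamental_theorem_of_calculus)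
      show "((\<lambda>x. exp ((1 - s) * of_real x) / (1 - s)) has_vector_derivative exp ((1 - s) * of_real x))
          (at x within {- real N..0})" for x :: real
        by (rule derivative_eq_intros has_vector_derivative_real_field | simp)+ (use s in auto)
    qed simp
    then have "(g has_integral
        (exp ((1 - s) * of_real 0) / (1 - s) - exp ((1 - s) * of_real (- real N)) / (1 - s))) {- real N..0}"
    proof (rule has_integral_spike_finite[of "{0}", rotated 2])
      fix x assume "x \<in> {- real N..0} - {0}"
      then have "frac (exp x) = exp x" by (simp add: frac_eq)
      then show "g x = exp ((1 - s) * of_real x)"
        by (simp add: g_def algebra_simps exp_diff exp_minus field_simps exp_of_real)
    qed simp
    then show ?thesis by (simp add: diff_divide_distrib algebra_simps)
  qed
  have pos: "(g has_integral (\<Sum>n<N. zeta_block (Suc n) s) / s) {0..ln (real (Suc N))}" for N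
  proof (induction N)
    case 0
    then show ?case by (simp add: has_integral_refl)
  next
    case (Suc N)
    have "(g has_integral (\<Sum>n<N. zeta_block (Suc n) s) / s + zeta_block (Suc N) s / s) {0..ln (real (Suc (Suc N)))}"
      by (rule has_integral_combine[OF _ _ Suc.IH])
         (use has_integral_zeta_block[of "Suc N" s] s in \<open>auto simp: g_def\<close>)
    then show ?case by (simp add: add_divide_distrib)
  qed
  have "(\<lambda>N. LINT x|lborel. indicator {- real N..ln (real (Suc N))} x *\<^sub>R g x) \<longlonglongrightarrow> (LINT x|lborel. g x)"
  proof (rule integral_dominated_convergence[OF _ _ integrable_frac_wave])
    show "AE x in lborel. (\<lambda>N. indicator {- real N..ln (real (Suc N))} x *\<^sub>R g x) \<longlonglongrightarrow> g x"
    proof (rule AE_I2)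
      fix x
      have "eventually (\<lambda>N. x \<ge> - real N) sequentially" "eventually (\<lambda>N. x \<le> ln (real (Suc N))) sequentially"
        by real_asymp+
      then have "eventually (\<lambda>N. indicator {- real N..ln (real (Suc N))} x *\<^sub>R g x = g x) sequentially"
        by eventually_elim auto
      then show "(\<lambda>N. indicator {- real N..ln (real (Suc N))} x *\<^sub>R g x) \<longlonglongrightarrow> g x"
        by (rule tendsto_eventually)
    qed
  qed (auto simp: norm_g frac_wave_nonneg indicator_def)
  moreover have "(LINT x|lborel. indicator {- real N..ln (real (Suc N))} x *\<^sub>R g x)
      = (1 - exp (- (1 - s) * of_nat N)) / (1 - s) + (\<Sum>n<N. zeta_block (Suc n) s) / s" for N
  proof -
    have "set_integrable lborel {- real N..ln (real (Suc N))} g"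
      unfolding set_integrable_def by (rule integrable_mult_indicator) (use g_int in auto)
    then have "(LINT x|lborel. indicator {- real N..ln (real (Suc N))} x *\<^sub>R g x)
        = integral {- real N..ln (real (Suc N))} g"
      using set_borel_integral_eq_integral(2) by (simp add: set_lebesgue_integral_def)
    also have "\<dots> = (1 - exp (- (1 - s) * of_nat N)) / (1 - s) + (\<Sum>n<N. zeta_block (Suc n) s) / s"
      by (rule integral_unique, rule has_integral_combine[OF _ _ neg pos]) auto
    finally show ?thesis .
  qed
  moreover have "(\<lambda>N. (1 - exp (- (1 - s) * of_nat N)) / (1 - s) + (\<Sum>n<N. zeta_block (Suc n) s) / s)
      \<longlonglongrightarrow> (1 - 0) / (1 - s) + (\<Sum>n. zeta_block (Suc n) s) / s"
  proof (intro tendsto_intros summable_LIMSEQ summable_zeta_block)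
    have "(\<lambda>N. exp (- (1/2) * real N)) \<longlonglongrightarrow> 0" by real_asymp
    moreover have "norm (exp (- (1 - s) * of_nat N)) = exp (- (1/2) * real N)" for N
      by (simp add: s_def)
    ultimately show "(\<lambda>N. exp (- (1 - s) * of_nat N)) \<longlonglongrightarrow> 0"
      by (subst tendsto_norm_zero_iff [symmetric]) simp
  qed (use s in auto)
  ultimately have "(LINT x|lborel. g x) = 1 / (1 - s) + (\<Sum>n. zeta_block (Suc n) s) / s"
    using LIMSEQ_unique by simp
  then have "- s * (LINT x|lborel. g x) = zeta_ext s"
    unfolding zeta_ext_def using s by (simp add: field_simps)
  then show ?thesis
    using riemann_zeta_eq_zeta_ext[of s] s unfolding g_eq s_def by simp
qed

section \<open>The mean square as a Fourier integral of an autocorrelation\<close>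

lemma has_integral_FTC_real:
  fixes F :: "real \<Rightarrow> real"
  assumes "a \<le> b" "\<And>x. (F has_real_derivative f x) (at x)"
  shows "(f has_integral F b - F a) {a..b}"
  by (rule fundamental_theorem_of_calculus[OF assms(1)])
     (use assms(2) in \<open>auto simp: has_real_derivative_iff_has_vector_derivative[symmetric] intro: DERIV_subset\<close>)

lemma integral_symmetric_limit:
  fixes f :: "real \<Rightarrow> real"
  assumes "integrable lborel f"
  shows "(\<lambda>N. integral {- real N..real N} f) \<longlonglongrightarrow> (LINT x|lborel. f x)"
proof -
  have [measurable]: "f \<in> borel_measurable borel" using borel_measurable_integrable[OF assms] by simp
  have "(\<lambda>N. LINT x|lborel. indicator {- real N..real N} x *\<^sub>R f x) \<longlonglongrightarrow> (LINT x|lborel. f x)"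
  proof (rule integral_dominated_convergence[where w = "\<lambda>x. norm (f x)"])
    show "AE x in lborel. (\<lambda>N. indicator {- real N..real N} x *\<^sub>R f x) \<longlonglongrightarrow> f x"
    proof (rule AE_I2)
      fix x
      have "eventually (\<lambda>N. x \<ge> - real N) sequentially" "eventually (\<lambda>N. x \<le> real N) sequentially"
        by real_asymp+
      then have "eventually (\<lambda>N. indicator {- real N..real N} x *\<^sub>R f x = f x) sequentially"
        by eventually_elim auto
      then show "(\<lambda>N. indicator {- real N..real N} x *\<^sub>R f x) \<longlonglongrightarrow> f x"
        by (rule tendsto_eventually)
    qed
  qed (use assms in \<open>auto simp: indicator_def\<close>)
  moreover have "(LINT x|lborel. indicator {- real N..real N} x *\<^sub>R f x) = integral {- real N..real N} f" for N
  proof -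
    have "set_integrable lborel {- real N..real N} f"
      unfolding set_integrable_def by (rule integrable_mult_indicator) (use assms in auto)
    from set_borel_integral_eq_integral(2)[OF this] show ?thesis
      by (simp add: set_lebesgue_integral_def)
  qed
  ultimately show ?thesis by simp
qed

lemma integrable_one_plus_abs_powr:
  assumes "p < -1"
  shows "integrable lborel (\<lambda>x::real. (1 + \<bar>x\<bar>) powr p)"
proof -
  have "((\<lambda>x::real. x powr p) has_integral - (1 powr (p + 1)) / (p + 1)) {1..}"
    by (rule has_integral_powr_to_inf) (use assms in auto)
  then have "(\<lambda>x::real. x powr p) absolutely_integrable_on {1..}"
    by (intro nonnegative_absolutely_integrable_1) (auto simp: integrable_on_def)
  then have "set_integrable lborel {1..} (\<lambda>x::real. x powr p)"
    unfolding set_integrable_def by (subst (asm) integrable_completion) auto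
  then have i: "integrable lborel (\<lambda>x::real. indicator {1..} x *\<^sub>R x powr p)"
    by (simp add: set_integrable_def)
  have "integrable lborel (\<lambda>x::real. indicator {1..} (1 + 1 * x) *\<^sub>R (1 + 1 * x) powr p)"
       "integrable lborel (\<lambda>x::real. indicator {1..} (1 + (-1) * x) *\<^sub>R (1 + (-1) * x) powr p)"
    by (rule lborel_integrable_real_affine[OF i]; simp)+
  then have "integrable lborel (\<lambda>x::real. indicator {1..} (1 + 1 * x) *\<^sub>R (1 + 1 * x) powr p
     + indicator {1..} (1 + (-1) * x) *\<^sub>R (1 + (-1) * x) powr p)"
    by (rule Bochner_Integration.integrable_add)
  then show ?thesis
    by (rule Bochner_Integration.integrable_bound) (auto simp: indicator_def abs_if)
qed

lemma integrable_powr_boundI: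
  assumes [measurable]: "f \<in> borel_measurable borel" and "p < -1"
    and "\<And>x::real. \<bar>f x\<bar> \<le> C * (1 + \<bar>x\<bar>) powr p"
  shows "integrable lborel f"
proof (rule Bochner_Integration.integrable_bound)
  show "integrable lborel (\<lambda>x::real. C * (1 + \<bar>x\<bar>) powr p)"
    using integrable_one_plus_abs_powr[OF assms(2)] by simp
  show "AE x in lborel. norm (f x) \<le> norm (C * (1 + \<bar>x\<bar>) powr p)"
    using order_trans[OF assms(3) abs_ge_self] by simp
qed simp

definition zeta_norm2 :: "real \<Rightarrow> real" where
  "zeta_norm2 t = (cmod (riemann_zeta (Complex (1/2) t)))\<^sup>2"

lemma continuous_on_zeta_norm2: "continuous_on A zeta_norm2"
  unfolding zeta_norm2_def by (intro continuous_intros continuous_on_riemann_zeta_critical)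

lemma zeta_norm2_nonneg: "0 \<le> zeta_norm2 t"
  by (simp add: zeta_norm2_def)

definition autocorr :: "real \<Rightarrow> real" where
  "autocorr u = (LINT x|lborel. frac_wave x * frac_wave (x + u))"

lemma integrable_frac_wave_pair:
  "integrable (lborel \<Otimes>\<^sub>M lborel) (\<lambda>(x, u). frac_wave x * frac_wave (x + u))"
proof (rule lborel_pair.Fubini_integrable)
  have i: "integrable lborel (\<lambda>u. frac_wave (x + u))" for x
    using lborel_integrable_real_affine[OF integrable_frac_wave, of 1 x] by simp
  have e: "(LINT u|lborel. frac_wave (x + u)) = (LINT u|lborel. frac_wave u)" for x
    using lborel_integral_real_affine[of 1 frac_wave x] by simp
  have "(LINT u|lborel. norm (case (x, u) of (x, u) \<Rightarrow> frac_wave x * frac_wave (x + u)))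
      = frac_wave x * (LINT u|lborel. frac_wave u)" for x
    by (simp add: abs_mult frac_wave_nonneg e)
  then show "integrable lborel (\<lambda>x. LINT u|lborel. norm (case (x, u) of (x, u) \<Rightarrow> frac_wave x * frac_wave (x + u)))"
    using integrable_frac_wave by simp
  show "AE x in lborel. integrable lborel (\<lambda>u. case (x, u) of (x, u) \<Rightarrow> frac_wave x * frac_wave (x + u))"
    using i by simp
qed simp

lemma integrable_autocorr: "integrable lborel autocorr"
  unfolding autocorr_def by (rule lborel_pair.integrable_snd[OF integrable_frac_wave_pair])

lemma autocorr_measurable [measurable]: "autocorr \<in> borel_measurable borel"
  using borel_measurable_integrable[OF integrable_autocorr] by simp

lemma autocorr_nonneg: "0 \<le> autocorr u"
  unfolding autocorr_def by (intro integral_nonneg_AE) (simp add: frac_wave_nonneg)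

lemma frac_wave_le_1: "frac_wave x \<le> 1"
  using frac_wave_le[of x] order_trans by fastforce

lemma integrable_frac_wave_mult:
  "integrable lborel (\<lambda>x. frac_wave (x + u) * frac_wave (x + v))"
proof (rule Bochner_Integration.integrable_bound)
  show "integrable lborel (\<lambda>x. frac_wave (x + u))"
    using lborel_integrable_real_affine[OF integrable_frac_wave, of 1 u] by (simp add: add.commute)
qed (auto simp: abs_mult frac_wave_nonneg mult_left_le frac_wave_le_1)

lemma autocorr_le: "autocorr u \<le> (LINT x|lborel. frac_wave x)"
  unfolding autocorr_def
  by (rule integral_mono[OF integrable_frac_wave_mult[of 0, simplified] integrable_frac_wave])
     (simp add: frac_wave_nonneg mult_left_le frac_wave_le_1)

lemma autocorr_minus: "autocorr (- u) = autocorr u"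
  using lborel_integral_real_affine[of 1 "\<lambda>x. frac_wave x * frac_wave (x - u)" u]
  by (simp add: autocorr_def algebra_simps)

text \<open>Wiener-Khinchin: in \<open>J * cnj J\<close> the variable of the second factor is
  shifted to \<open>x + u\<close>. The phases then combine to \<open>cis (t * u)\<close>, free of
  \<open>x\<close>, and Fubini leaves the autocorrelation. The factor \<open>1/4 + t\<^sup>2\<close>
  is the squared modulus of \<open>s\<close>.\<close>

lemma zeta_norm2_eq_autocorr:
  "zeta_norm2 t = (1/4 + t\<^sup>2) * (LINT u|lborel. autocorr u * cos (t * u))"
proof -
  define h where "h = (\<lambda>x. complex_of_real (frac_wave x) * cis (- t * x))"
  define J where "J = (LINT x|lborel. h x)"
  define P where "P = (\<lambda>x u. complex_of_real (frac_wave x * frac_wave (x + u)) * cis (t * u))"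
  have [measurable]: "(\<lambda>x. cis (f x)) \<in> borel_measurable M" if [measurable]: "f \<in> borel_measurable M"
    for f :: "'z \<Rightarrow> real" and M
    unfolding cis_conv_exp by measurable
  have P_int: "integrable (lborel \<Otimes>\<^sub>M lborel) (case_prod P)"
    by (rule Bochner_Integration.integrable_bound[OF integrable_frac_wave_pair])
       (auto simp: P_def norm_mult frac_wave_nonneg split_beta)
  have tr: "(LINT u|lborel. cnj (h (x + u))) = cnj J" for x
    using lborel_integral_real_affine[of 1 "\<lambda>u. cnj (h u)" x] by (simp add: J_def)
  have hP: "h x * cnj (h (x + u)) = P x u" for x u
  proof -
    have "cis (- (t * x)) * cis (t * (x + u)) = cis (t * u)"
      unfolding cis_mult by (simp add: algebra_simps)
    then show ?thesis by (simp add: h_def P_def cis_cnj)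
  qed
  have "J * cnj J = (LINT x|lborel. h x * (LINT u|lborel. cnj (h (x + u))))"
    unfolding tr by (simp add: J_def)
  also have "\<dots> = (LINT x|lborel. LINT u|lborel. P x u)"
    unfolding hP[symmetric] by simp
  also have "\<dots> = (LINT u|lborel. LINT x|lborel. P x u)"
    by (rule lborel_pair.Fubini_integral[OF P_int, symmetric])
  also have "\<dots> = (LINT u|lborel. complex_of_real (autocorr u) * cis (t * u))"
    unfolding P_def autocorr_def by (simp del: of_real_mult)
  finally have "Re (J * cnj J) = Re (LINT u|lborel. complex_of_real (autocorr u) * cis (t * u))" by simp
  also have "\<dots> = (LINT u|lborel. Re (complex_of_real (autocorr u) * cis (t * u)))"
  proof (rule integral_Re[symmetric])
    show "integrable lborel (\<lambda>u. complex_of_real (autocorr u) * cis (t * u))"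
      by (rule Bochner_Integration.integrable_bound[OF integrable_autocorr])
         (auto simp: norm_mult autocorr_nonneg)
  qed
  also have "\<dots> = (LINT u|lborel. autocorr u * cos (t * u))" by simp
  finally have J2: "(cmod J)\<^sup>2 = (LINT u|lborel. autocorr u * cos (t * u))"
    by (simp add: complex_norm_square[symmetric] flip: of_real_power)
  have "zeta_norm2 t = (cmod (Complex (1/2) t))\<^sup>2 * (cmod J)\<^sup>2"
    unfolding zeta_norm2_def riemann_zeta_critical J_def h_def by (simp add: norm_mult power_mult_distrib)
  moreover have "(cmod (Complex (1/2) t))\<^sup>2 = 1/4 + t\<^sup>2"
    by (simp add: cmod_power2 power_divide)
  ultimately show ?thesis unfolding J2 by simp
qed

text \<open>
  At height \<open>T t\<close> the Mellin factor is \<open>|s|\<^sup>2 = 1/4 + T\<^sup>2 t\<^sup>2\<close>; its two terms, weighted by \<open>(1 - t)\<^sup>2\<close>, give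
  two kernels. The square makes \<open>kernel2\<close> decay like \<open>v\<^bsup>-3\<^esup>\<close>, enough to integrate it against \<open>|v|\<^bsup>4/3\<^esup>\<close>.
\<close>

definition kernel0 :: "real \<Rightarrow> real" where
  "kernel0 v = integral {0..1} (\<lambda>t. (1 - t)\<^sup>2 * cos (t * v))"

definition kernel2 :: "real \<Rightarrow> real" where
  "kernel2 v = integral {0..1} (\<lambda>t. t\<^sup>2 * (1 - t)\<^sup>2 * cos (t * v))"

lemma integral_zeta_norm2_eq_kernels:
  "integral {0..1} (\<lambda>t. (1 - t)\<^sup>2 * zeta_norm2 (T * t))
     = (LINT u|lborel. autocorr u * (1/4 * kernel0 (T * u) + T\<^sup>2 * kernel2 (T * u)))"
proof -
  define w where "w = (\<lambda>t. indicator {0..1} t * ((1 - t)\<^sup>2 * (1/4 + T\<^sup>2 * t\<^sup>2)))"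
  define P where "P = (\<lambda>t u. w t * (autocorr u * cos (T * t * u)))"
  have [measurable]: "w \<in> borel_measurable borel" unfolding w_def by measurable
  have w_bound: "\<bar>w t\<bar> \<le> (1/4 + T\<^sup>2) * indicator {0..1} t" for t
  proof (cases "t \<in> {0..1}")
    case True
    have "(1 - t)\<^sup>2 * (1/4 + T\<^sup>2 * t\<^sup>2) \<le> 1 * (1/4 + T\<^sup>2 * 1)"
      using True by (intro mult_mono add_mono power_le_one) auto
    then show ?thesis using True by (simp add: w_def)
  qed (simp add: w_def)
  have "integrable (lborel \<Otimes>\<^sub>M lborel) (\<lambda>(t, u). ((1/4 + T\<^sup>2) * indicator {0..1::real} t) * autocorr u)"
    by (rule lborel_pair.Fubini_integrable) (auto simp: abs_mult autocorr_nonneg intro!: integrable_autocorr)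
  then have P_int: "integrable (lborel \<Otimes>\<^sub>M lborel) (case_prod P)"
  proof (rule Bochner_Integration.integrable_bound)
    have "\<bar>P t u\<bar> \<le> ((1/4 + T\<^sup>2) * indicator {0..1} t) * (autocorr u * 1)" for t u
      unfolding P_def abs_mult using w_bound autocorr_nonneg by (intro mult_mono) auto
    then show "AE p in lborel \<Otimes>\<^sub>M lborel. norm (case_prod P p)
        \<le> norm (case p of (t, u) \<Rightarrow> ((1/4 + T\<^sup>2) * indicator {0..1::real} t) * autocorr u)"
      by (auto simp: abs_mult autocorr_nonneg)
  qed (simp add: P_def split_beta)
  have set_int: "integral {0..1} f = (LINT t|lborel. indicator {0..1} t * f t)"
    if "continuous_on {0..1} f" for f :: "real \<Rightarrow> real"
  proof -
    have "set_integrable lborel {0..1} f"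
      using borel_integrable_compact[OF _ that] by (simp add: set_integrable_def)
    then show ?thesis
      by (simp add: set_borel_integral_eq_integral(2) [symmetric] set_lebesgue_integral_def)
  qed
  have inner: "(LINT t|lborel. P t u) = autocorr u * (1/4 * kernel0 (T * u) + T\<^sup>2 * kernel2 (T * u))" for u
  proof -
    have "(LINT t|lborel. P t u) = autocorr u *
        (LINT t|lborel. indicator {0..1} t * ((1 - t)\<^sup>2 * (1/4 + T\<^sup>2 * t\<^sup>2) * cos (t * (T * u))))"
      by (subst integral_mult_right_zero [symmetric]) (simp add: P_def w_def mult_ac)
    also have "(LINT t|lborel. indicator {0..1} t * ((1 - t)\<^sup>2 * (1/4 + T\<^sup>2 * t\<^sup>2) * cos (t * (T * u))))
        = integral {0..1} (\<lambda>t. 1/4 * ((1 - t)\<^sup>2 * cos (t * (T * u))) + T\<^sup>2 * (t\<^sup>2 * (1 - t)\<^sup>2 * cos (t * (T * u))))"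
      by (subst set_int) (auto intro!: continuous_intros Bochner_Integration.integral_cong simp: algebra_simps)
    also have "\<dots> = 1/4 * kernel0 (T * u) + T\<^sup>2 * kernel2 (T * u)"
      unfolding kernel0_def kernel2_def integral_mult_right [symmetric]
      by (rule integral_add) (auto intro!: integrable_continuous_interval continuous_intros)
    finally show ?thesis .
  qed
  have "integral {0..1} (\<lambda>t. (1 - t)\<^sup>2 * zeta_norm2 (T * t))
      = (LINT t|lborel. indicator {0..1} t * ((1 - t)\<^sup>2 * zeta_norm2 (T * t)))"
    by (intro set_int continuous_intros continuous_on_compose2[OF continuous_on_zeta_norm2[of UNIV]]) auto
  also have "\<dots> = (LINT t|lborel. LINT u|lborel. P t u)"
    by (simp add: zeta_norm2_eq_autocorr P_def w_def power_mult_distrib mult.assoc)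
  also have "\<dots> = (LINT u|lborel. LINT t|lborel. P t u)"
    by (rule lborel_pair.Fubini_integral[OF P_int, symmetric])
  also have "\<dots> = (LINT u|lborel. autocorr u * (1/4 * kernel0 (T * u) + T\<^sup>2 * kernel2 (T * u)))"
    by (simp only: inner)
  finally show ?thesis .
qed

section \<open>Expansion of the autocorrelation at the origin\<close>

lemma bounded_borel_integrable_on:
  fixes f :: "real \<Rightarrow> real"
  assumes [measurable]: "f \<in> borel_measurable borel" and "\<And>x. x \<in> {a..b} \<Longrightarrow> \<bar>f x\<bar> \<le> B"
  shows "f integrable_on {a..b}"
proof -
  have "set_integrable lborel {a..b} f"
    unfolding set_integrable_def
  proof (rule Bochner_Integration.integrable_bound)
    show "integrable lborel (\<lambda>x. B * indicator {a..b} x :: real)"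
      by (intro integrable_mult_right integrable_real_indicator) (auto simp: emeasure_lborel_Icc_eq)
    have "norm (indicator {a..b} x *\<^sub>R f x) \<le> norm (B * indicator {a..b} x)" for x
      using assms(2)[of x] by (auto simp: indicator_def)
    then show "AE x in lborel. norm (indicator {a..b} x *\<^sub>R f x) \<le> norm (B * indicator {a..b} x)" by simp
  qed simp
  then show ?thesis by (rule set_borel_integral_eq_integral(1))
qed

section \<open>Mean square of \<open>frac (y + s) - frac y\<close> over a unit interval\<close>

definition parabola :: "real \<Rightarrow> real" where
  "parabola x = frac x * (1 - frac x)"

lemma parabola_measurable [measurable]: "parabola \<in> borel_measurable borel"
  unfolding parabola_def by measurable

lemma parabola_bounds: "0 \<le> parabola x" "parabola x \<le> 1"
  unfolding parabola_def using frac_lt_1[of x] by (auto simp: less_imp_le intro!: mult_le_one)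

text \<open>Only points less than 1 apart matter. Within one unit cell the slope of
  \<open>p * (1 - p)\<close> is at most 1 in absolute value; across an integer,
  \<open>parabola\<close> vanishes there and each of the two values is bounded by the distance to
  that integer.\<close>

lemma parabola_lipschitz_aux:
  assumes "x \<le> y"
  shows "\<bar>parabola y - parabola x\<bar> \<le> y - x"
proof (cases "y - x \<ge> 1")
  case True
  then show ?thesis using parabola_bounds[of x] parabola_bounds[of y] by linarith
next
  case False
  define p q where "p = frac x" and "q = frac y"
  have pq: "0 \<le> p" "p < 1" "0 \<le> q" "q < 1" by (auto simp: p_def q_def frac_lt_1)
  have x: "x = of_int \<lfloor>x\<rfloor> + p" and y: "y = of_int \<lfloor>y\<rfloor> + q" by (auto simp: p_def q_def frac_def)
  have "\<lfloor>x\<rfloor> \<le> \<lfloor>y\<rfloor>" using assms by (rule floor_mono)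
  moreover have "\<lfloor>y\<rfloor> \<le> \<lfloor>x\<rfloor> + 1" using False by linarith
  ultimately consider "\<lfloor>y\<rfloor> = \<lfloor>x\<rfloor>" | "\<lfloor>y\<rfloor> = \<lfloor>x\<rfloor> + 1" by linarith
  then show ?thesis
  proof cases
    case 1
    then have d: "y - x = q - p" using x y by simp
    have "parabola y - parabola x = (q - p) * (1 - p - q)"
      unfolding parabola_def p_def[symmetric] q_def[symmetric] by (simp add: algebra_simps)
    moreover have "\<bar>1 - p - q\<bar> \<le> 1" using pq by auto
    ultimately show ?thesis using d assms by (simp add: abs_mult mult_left_le)
  next
    case 2
    then have "of_int \<lfloor>y\<rfloor> = of_int \<lfloor>x\<rfloor> + (1::real)" by simp
    then have d: "y - x = 1 - p + q" using x y by linarith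
    have "parabola x \<le> 1 - p" "parabola y \<le> q"
      unfolding parabola_def p_def[symmetric] q_def[symmetric] using pq
      by (auto intro: mult_left_le mult_left_le_one_le)
    then show ?thesis using d parabola_bounds[of x] parabola_bounds[of y] pq by linarith
  qed
qed

lemma frac_unit_interval: "frac y = y - real n" if "real n \<le> y" "y < real n + 1"
  using that by (simp add: frac_unique_iff)

lemma abs_frac_diff_le_1: "\<bar>frac x - frac y\<bar> \<le> 1" for x y :: real
  using frac_lt_1[of x] frac_lt_1[of y] frac_ge_0[of x] frac_ge_0[of y] by linarith

lemma frac_diff_sq_le_1: "(frac x - frac y)\<^sup>2 \<le> 1" for x y :: real
  using abs_frac_diff_le_1[of x y] by (simp add: abs_square_le_1)

text \<open>With \<open>l = frac s\<close>, the difference of the fractional parts is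
  \<open>l\<close> until \<open>y + s\<close> passes an integer and \<open>l - 1\<close> afterwards,
  on lengths \<open>1 - l\<close> and \<open>l\<close>.\<close>

lemma has_integral_frac_shift:
  "((\<lambda>y. (frac (y + s) - frac y)\<^sup>2) has_integral parabola s) {real n..real n + 1}"
proof -
  define l where "l = frac s"
  have l: "0 \<le> l" "l < 1" by (auto simp: l_def frac_lt_1)
  have s: "s = of_int \<lfloor>s\<rfloor> + l" by (simp add: l_def frac_def)
  have "((\<lambda>y. l\<^sup>2) has_integral l\<^sup>2 * (1 - l)) {real n..real n + 1 - l}"
    using has_integral_const_real[of "l\<^sup>2" "real n" "real n + 1 - l"] l by (simp add: mult.commute)
  then have 1: "((\<lambda>y. (frac (y + s) - frac y)\<^sup>2) has_integral l\<^sup>2 * (1 - l)) {real n..real n + 1 - l}"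
  proof (rule has_integral_spike_finite[of "{real n + 1 - l, real n + 1}", rotated 2])
    fix y assume y: "y \<in> {real n..real n + 1 - l} - {real n + 1 - l, real n + 1}"
    have "y + s - (y - real n + l) = of_int (\<lfloor>s\<rfloor> + int n)" using s by simp
    then have "y + s - (y - real n + l) \<in> \<int>" by (simp only: Ints_of_int)
    then have "frac (y + s) = y - real n + l"
      using y l by (simp add: frac_unique_iff)
    then show "(frac (y + s) - frac y)\<^sup>2 = l\<^sup>2"
      using frac_unit_interval[of n y] y l by auto
  qed simp
  have "((\<lambda>y. (1 - l)\<^sup>2) has_integral (1 - l)\<^sup>2 * l) {real n + 1 - l..real n + 1}"
    using has_integral_const_real[of "(1 - l)\<^sup>2" "real n + 1 - l" "real n + 1"] l by (simp add: mult.commute)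
  then have 2: "((\<lambda>y. (frac (y + s) - frac y)\<^sup>2) has_integral (1 - l)\<^sup>2 * l) {real n + 1 - l..real n + 1}"
  proof (rule has_integral_spike_finite[of "{real n + 1 - l, real n + 1}", rotated 2])
    fix y assume y: "y \<in> {real n + 1 - l..real n + 1} - {real n + 1 - l, real n + 1}"
    have "y + s - (y - real n + l - 1) = of_int (\<lfloor>s\<rfloor> + int n + 1)" using s by simp
    then have "y + s - (y - real n + l - 1) \<in> \<int>" by (simp only: Ints_of_int)
    then have "frac (y + s) = y - real n + l - 1"
      using y l by (simp add: frac_unique_iff)
    then have "frac (y + s) - frac y = - (1 - l)"
      using frac_unit_interval[of n y] y l by auto
    then show "(frac (y + s) - frac y)\<^sup>2 = (1 - l)\<^sup>2"
      by (simp only: power2_minus)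
  qed simp
  have "((\<lambda>y. (frac (y + s) - frac y)\<^sup>2) has_integral l\<^sup>2 * (1 - l) + (1 - l)\<^sup>2 * l) {real n..real n + 1}"
    by (rule has_integral_combine[OF _ _ 1 2]) (use l in auto)
  moreover have "l\<^sup>2 * (1 - l) + (1 - l)\<^sup>2 * l = parabola s"
    unfolding parabola_def l_def[symmetric] by (simp add: power2_eq_square algebra_simps)
  ultimately show ?thesis by simp
qed

text \<open>
  As \<open>y\<close> runs through \<open>[n, n + 1]\<close>, the only integers that \<open>y + s + d\<close> can have passed without
  \<open>y + s\<close> passing them are \<open>p + 1\<close> and \<open>p + 2\<close>.
\<close>

lemma frac_perturb:
  fixes y s e :: real
  assumes "real n \<le> y" "y \<le> real n + 1" "0 \<le> d" "d \<le> e" "e \<le> 1"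
  defines "p \<equiv> of_int \<lfloor>real n + s\<rfloor> :: real"
  shows "\<bar>(frac (y + s + d) - frac y)\<^sup>2 - (frac (y + s) - frac y)\<^sup>2\<bar>
     \<le> 2 * e + indicator {p + 1 - s - e..p + 1 - s} y + indicator {p + 2 - s - e..p + 2 - s} y"
proof (cases "\<lfloor>y + s + d\<rfloor> = \<lfloor>y + s\<rfloor>")
  case True
  define A B where "A = frac (y + s + d) - frac y" and "B = frac (y + s) - frac y"
  have "A - B = d" using True by (simp add: A_def B_def frac_def)
  moreover have "\<bar>A + B\<bar> \<le> 2" using abs_frac_diff_le_1[of "y + s + d" y] abs_frac_diff_le_1[of "y + s" y]
    unfolding A_def B_def by linarith
  moreover have "A\<^sup>2 - B\<^sup>2 = (A - B) * (A + B)" by (simp add: power2_eq_square algebra_simps)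
  ultimately have "\<bar>A\<^sup>2 - B\<^sup>2\<bar> \<le> d * 2" using assms by (simp add: abs_mult mult_left_mono)
  also have "\<dots> \<le> 2 * e" using assms by simp
  finally show ?thesis unfolding A_def B_def by (rule order_trans) simp
next
  case False
  have "\<lfloor>y + s\<rfloor> \<le> \<lfloor>y + s + d\<rfloor>" using assms by (intro floor_mono) simp
  with False have "\<lfloor>y + s\<rfloor> + 1 \<le> \<lfloor>y + s + d\<rfloor>" by simp
  then have m2: "of_int (\<lfloor>y + s\<rfloor> + 1) \<le> y + s + d" by linarith
  have m1: "y + s < of_int (\<lfloor>y + s\<rfloor> + 1)" by linarith
  define m where "m = \<lfloor>y + s\<rfloor> + 1"
  have y: "of_int m - s - e \<le> y" "y \<le> of_int m - s"
    using m1 m2 assms unfolding m_def by linarith+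
  have "\<lfloor>real n + s\<rfloor> \<le> \<lfloor>y + s\<rfloor>" using assms by (intro floor_mono) simp
  moreover have "\<lfloor>y + s\<rfloor> \<le> \<lfloor>real n + s\<rfloor> + 1" using assms by linarith
  ultimately have "m = \<lfloor>real n + s\<rfloor> + 1 \<or> m = \<lfloor>real n + s\<rfloor> + 2" unfolding m_def by linarith
  then have "of_int m = p + 1 \<or> of_int m = p + 2" unfolding p_def by auto
  then have "1 \<le> indicator {p + 1 - s - e..p + 1 - s} y + (indicator {p + 2 - s - e..p + 2 - s} y :: real)"
    using y by (auto simp: indicator_def)
  moreover have "\<bar>(frac (y + s + d) - frac y)\<^sup>2 - (frac (y + s) - frac y)\<^sup>2\<bar> \<le> 1"
    using frac_diff_sq_le_1[of "y + s + d" y] frac_diff_sq_le_1[of "y + s" y]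
      zero_le_power2[of "frac (y + s + d) - frac y"] zero_le_power2[of "frac (y + s) - frac y"] by linarith
  ultimately show ?thesis using assms by linarith
qed

lemma integral_indicator_Icc_le:
  assumes "0 \<le> e"
  shows "integral {a..b} (indicator {c - e..c} :: real \<Rightarrow> real) \<le> e"
proof -
  have "((\<lambda>x. 1) has_integral e) {c - e..c}"
    using has_integral_const_real[of "1::real" "c - e" c] assms by simp
  then have i: "((indicator {c - e..c} :: real \<Rightarrow> real) has_integral e) UNIV"
    using has_integral_restrict_UNIV[of "{c - e..c}" "\<lambda>x. 1::real" e] by (simp add: indicator_def[abs_def] of_bool_def)
  have "integral {a..b} (indicator {c - e..c} :: real \<Rightarrow> real) \<le> integral UNIV (indicator {c - e..c})"
    by (rule integral_subset_le)
       (use i in \<open>auto simp: integrable_on_def intro!: bounded_borel_integrable_on[where B=1, unfolded integrable_on_def]\<close>)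
  then show ?thesis using i by (simp add: integral_unique)
qed

text \<open>On the unit interval \<open>(1 + e) * y = y + s + e * (y - n)\<close> with
  \<open>s = e * n\<close>: the shift is frozen at \<open>s\<close> and the rest is a perturbation
  of size at most \<open>e\<close>. Dropping the perturbation costs \<open>2 * e\<close> where no
  integer is crossed and \<open>e\<close> for each of the two possible crossings; replacing
  \<open>parabola s\<close> by \<open>parabola (e * y)\<close> costs one more
  \<open>e\<close>.\<close>

lemma integral_frac_dilation_approx:
  assumes "0 < e" "e \<le> 1"
  shows "\<bar>integral {real n..real n + 1} (\<lambda>y. (frac ((1 + e) * y) - frac y)\<^sup>2 - parabola (e * y))\<bar> \<le> 5 * e"
proof -
  let ?I = "{real n..real n + 1}"
  define s where "s = e * real n"
  define h1 h2 where "h1 = (\<lambda>y. (frac ((1 + e) * y) - frac y)\<^sup>2)" and "h2 = (\<lambda>y. (frac (y + s) - frac y)\<^sup>2)"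
  define p where "p = (of_int \<lfloor>real n + s\<rfloor> :: real)"
  define B where "B = (\<lambda>y. 2 * e + indicator {p + 1 - s - e..p + 1 - s} y + indicator {p + 2 - s - e..p + 2 - s} y)"
  have [measurable]: "h1 \<in> borel_measurable borel" "h2 \<in> borel_measurable borel" "B \<in> borel_measurable borel"
    unfolding h1_def h2_def B_def by measurable
  have h1_int: "h1 integrable_on ?I" and h2_int: "h2 integrable_on ?I"
    unfolding h1_def h2_def using frac_diff_sq_le_1 by (auto intro!: bounded_borel_integrable_on[where B = 1])
  have g_int: "(\<lambda>y. parabola (e * y)) integrable_on ?I"
    using parabola_bounds by (auto intro!: bounded_borel_integrable_on[where B = 1])
  have ind_int: "(indicator {a..b} :: real \<Rightarrow> real) integrable_on ?I" for a b
    by (rule bounded_borel_integrable_on[where B = 1]) auto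
  have B_int: "B integrable_on ?I"
    unfolding B_def by (intro integrable_add ind_int integrable_const_ivl)
  have "norm (integral ?I (\<lambda>y. h1 y - h2 y)) \<le> integral ?I B"
  proof (rule integral_norm_bound_integral)
    fix y assume y: "y \<in> ?I"
    show "norm (h1 y - h2 y) \<le> B y"
    proof -
      have "\<bar>(frac (y + s + e * (y - real n)) - frac y)\<^sup>2 - (frac (y + s) - frac y)\<^sup>2\<bar> \<le> B y"
        unfolding B_def p_def
        by (rule frac_perturb) (use y assms in \<open>auto intro: mult_left_le\<close>)
      moreover have "y + s + e * (y - real n) = (1 + e) * y" by (simp add: s_def algebra_simps)
      ultimately show ?thesis unfolding h1_def h2_def by simp
    qed
  qed (use h1_int h2_int B_int in \<open>auto intro: integrable_diff\<close>)
  also have "integral ?I B = 2 * e + integral ?I (indicator {p + 1 - s - e..p + 1 - s})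
     + integral ?I (indicator {p + 2 - s - e..p + 2 - s})"
    unfolding B_def
      integral_add[OF integrable_add[OF integrable_const_ivl ind_int] ind_int]
      integral_add[OF integrable_const_ivl ind_int] by simp
  also have "\<dots> \<le> 4 * e"
    using integral_indicator_Icc_le[of e "real n" "real n + 1" "p + 1 - s"]
      integral_indicator_Icc_le[of e "real n" "real n + 1" "p + 2 - s"] assms by linarith
  finally have 1: "\<bar>integral ?I h1 - integral ?I h2\<bar> \<le> 4 * e"
    using h1_int h2_int by (simp add: integral_diff)
  have 2: "integral ?I h2 = parabola s"
    unfolding h2_def by (rule integral_unique[OF has_integral_frac_shift])
  have "norm (integral ?I (\<lambda>y. parabola s - parabola (e * y))) \<le> integral ?I (\<lambda>y. e)"
  proof (rule integral_norm_bound_integral)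
    fix y assume y: "y \<in> ?I"
    have "\<bar>parabola (e * y) - parabola s\<bar> \<le> e * y - s"
      by (rule parabola_lipschitz_aux) (use y assms in \<open>auto simp: s_def\<close>)
    also have "\<dots> = e * (y - real n)" by (simp add: s_def algebra_simps)
    also have "\<dots> \<le> e * 1" using y assms by (intro mult_left_mono) auto
    finally show "norm (parabola s - parabola (e * y)) \<le> e" by simp
  qed (use g_int in \<open>auto intro: integrable_diff\<close>)
  moreover have "integral ?I (\<lambda>y. parabola s - parabola (e * y))
      = integral ?I (\<lambda>y. parabola s) - integral ?I (\<lambda>y. parabola (e * y))"
    by (rule integral_diff[OF integrable_const_ivl g_int])
  ultimately have 3: "\<bar>parabola s - integral ?I (\<lambda>y. parabola (e * y))\<bar> \<le> e"
    by simp
  have "integral ?I (\<lambda>y. h1 y - parabola (e * y)) = integral ?I h1 - integral ?I (\<lambda>y. parabola (e * y))"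
    using h1_int g_int by (rule integral_diff)
  then show ?thesis using 1 2 3 unfolding h1_def by linarith
qed

section \<open>The dilation integral for small dilations\<close>

definition dilation_density :: "real \<Rightarrow> real \<Rightarrow> real" where
  "dilation_density e y = (frac ((1 + e) * y) - frac y)\<^sup>2 / y\<^sup>2"

lemma dilation_density_measurable [measurable]: "dilation_density e \<in> borel_measurable borel"
  unfolding dilation_density_def by measurable

lemma inverse_sq_diff_le:
  fixes n y :: real
  assumes "1 \<le> n" "n \<le> y" "y \<le> n + 1"
  shows "0 \<le> 1 / n\<^sup>2 - 1 / y\<^sup>2" "1 / n\<^sup>2 - 1 / y\<^sup>2 \<le> 2 / n ^ 3"
proof -
  show "0 \<le> 1 / n\<^sup>2 - 1 / y\<^sup>2"
    using assms by (simp add: frac_le power_mono)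
  have "1 / (n + 1)\<^sup>2 \<le> 1 / y\<^sup>2"
    using assms by (simp add: frac_le power_mono)
  moreover have "1 / n\<^sup>2 - 1 / (n + 1)\<^sup>2 \<le> 2 / n ^ 3"
  proof -
    have "1 / n\<^sup>2 - 1 / (n + 1)\<^sup>2 = (2 * n + 1) / (n\<^sup>2 * (n + 1)\<^sup>2)"
      using assms by (simp add: divide_simps) (simp add: power2_eq_square algebra_simps)
    also have "\<dots> \<le> 2 / n ^ 3"
    proof -
      have "(2 * n + 1) * n ^ 3 \<le> 2 * (n\<^sup>2 * (n + 1)\<^sup>2)"
        using assms by (simp add: power2_eq_square power3_eq_cube algebra_simps)
      then show ?thesis using assms by (simp add: divide_simps)
    qed
    finally show ?thesis .
  qed
  ultimately show "1 / n\<^sup>2 - 1 / y\<^sup>2 \<le> 2 / n ^ 3" by linarith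
qed

text \<open>With the weight \<open>1 / y\<^sup>2\<close> frozen at \<open>1 / n\<^sup>2\<close> the
  mean value estimate on the unit interval applies. The change of weight is at most
  \<open>2 / n ^ 3\<close> and multiplies a quantity bounded by 1.\<close>

lemma integral_dilation_density_approx:
  assumes "0 < e" "e \<le> 1" "1 \<le> n"
  shows "\<bar>integral {real n..real n + 1} (\<lambda>y. dilation_density e y - parabola (e * y) / y\<^sup>2)\<bar>
     \<le> 5 * e / (real n)\<^sup>2 + 2 / real n ^ 3"
proof -
  let ?I = "{real n..real n + 1}"
  define h where "h = (\<lambda>y. (frac ((1 + e) * y) - frac y)\<^sup>2 - parabola (e * y))"
  have [measurable]: "h \<in> borel_measurable borel" unfolding h_def by measurable
  have h_le: "\<bar>h y\<bar> \<le> 1" for y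
    using frac_diff_sq_le_1[of "(1 + e) * y" y] parabola_bounds[of "e * y"]
      zero_le_power2[of "frac ((1 + e) * y) - frac y"] unfolding h_def by linarith
  have h_int: "h integrable_on ?I"
    using h_le by (auto intro!: bounded_borel_integrable_on[where B = 1])
  have le: "\<bar>h y * (1 / (real n)\<^sup>2 - 1 / y\<^sup>2)\<bar> \<le> 2 / real n ^ 3" if "y \<in> ?I" for y
  proof -
    have "\<bar>h y\<bar> * \<bar>1 / (real n)\<^sup>2 - 1 / y\<^sup>2\<bar> \<le> 1 * (2 / real n ^ 3)"
      using inverse_sq_diff_le[of "real n" y] that assms h_le[of y] by (intro mult_mono) auto
    then show ?thesis by (simp add: abs_mult)
  qed
  have hd_int: "(\<lambda>y. h y * (1 / (real n)\<^sup>2 - 1 / y\<^sup>2)) integrable_on ?I"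
    by (rule bounded_borel_integrable_on[where B = "2 / real n ^ 3"]) (use le in auto)
  have "norm (integral ?I (\<lambda>y. h y * (1 / (real n)\<^sup>2 - 1 / y\<^sup>2))) \<le> integral ?I (\<lambda>y. 2 / real n ^ 3)"
    by (rule integral_norm_bound_integral) (use hd_int le in auto)
  then have 1: "\<bar>integral ?I (\<lambda>y. h y * (1 / (real n)\<^sup>2 - 1 / y\<^sup>2))\<bar> \<le> 2 / real n ^ 3" by simp
  have 2: "\<bar>1 / (real n)\<^sup>2 * integral ?I h\<bar> \<le> 5 * e / (real n)\<^sup>2"
    using integral_frac_dilation_approx[OF assms(1,2), of n] unfolding h_def
    by (simp add: abs_mult divide_right_mono)
  have "integral ?I (\<lambda>y. dilation_density e y - parabola (e * y) / y\<^sup>2)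
      = integral ?I (\<lambda>y. 1 / (real n)\<^sup>2 * h y - h y * (1 / (real n)\<^sup>2 - 1 / y\<^sup>2))"
    by (simp add: dilation_density_def h_def algebra_simps diff_divide_distrib)
  also have "\<dots> = 1 / (real n)\<^sup>2 * integral ?I h - integral ?I (\<lambda>y. h y * (1 / (real n)\<^sup>2 - 1 / y\<^sup>2))"
    using h_int hd_int by (subst integral_diff) (auto intro: integrable_on_mult_right simp del: times_divide_eq_left)
  finally show ?thesis using 1 2 by linarith
qed

text \<open>Since \<open>(n + 1) * e \<le> 1\<close>, the only integer that
  \<open>(1 + e) * y\<close> passes while \<open>y\<close> stays below \<open>n + 1\<close> is
  \<open>n + 1\<close> itself, exactly at \<open>y = c\<close>. The difference of fractional parts
  is therefore \<open>e * y\<close> before \<open>c\<close> and \<open>e * y - 1\<close> after it,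
  and both pieces have elementary antiderivatives.\<close>

lemma has_integral_dilation_density_unit:
  assumes "0 < e" "(real n + 1) * e \<le> 1"
  shows "(dilation_density e has_integral e\<^sup>2 - 2 * e * ln (1 + e) + e / (real n + 1)) {real n..real n + 1}"
proof -
  define c where "c = (real n + 1) / (1 + e)"
  have ac: "(1 + e) * c = real n + 1" using assms by (simp add: c_def)
  have c: "real n \<le> c" "c \<le> real n + 1" "0 < c"
  proof -
    have "real n * (1 + e) \<le> real n + 1" using assms by (simp add: algebra_simps)
    then show "real n \<le> c" using assms by (simp add: c_def pos_le_divide_eq)
    have "(real n + 1) * 1 \<le> (real n + 1) * (1 + e)" using assms by (intro mult_left_mono) auto
    then show "c \<le> real n + 1" using assms by (simp add: c_def pos_divide_le_eq)
    show "0 < c" using assms by (simp add: c_def)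
  qed
  have "((\<lambda>y. e\<^sup>2) has_integral (c - real n) * e\<^sup>2) {real n..c}"
    using has_integral_const_real[of "e\<^sup>2" "real n" c] c by simp
  then have 1: "(dilation_density e has_integral (c - real n) * e\<^sup>2) {real n..c}"
  proof (rule has_integral_spike_finite[of "{real n, c}", rotated 2])
    fix y assume y: "y \<in> {real n..c} - {real n, c}"
    have "(1 + e) * y < (1 + e) * c" using y assms by (intro mult_strict_left_mono) auto
    moreover have "y \<le> (1 + e) * y" using y assms by (simp add: algebra_simps)
    ultimately have "real n \<le> (1 + e) * y" "(1 + e) * y < real n + 1"
      using y ac unfolding atLeastAtMost_iff Diff_iff by linarith+
    then have "frac ((1 + e) * y) = (1 + e) * y - real n"
      by (rule frac_unit_interval)
    moreover have "frac y = y - real n" using y c by (intro frac_unit_interval) auto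
    ultimately have "frac ((1 + e) * y) - frac y = e * y" by (simp add: algebra_simps)
    then show "dilation_density e y = e\<^sup>2"
      using y by (simp add: dilation_density_def power_mult_distrib)
  qed simp
  define F where "F = (\<lambda>y. e\<^sup>2 * y - 2 * e * ln y - 1 / y)"
  have "((\<lambda>y. (e * y - 1)\<^sup>2 / y\<^sup>2) has_integral F (real n + 1) - F c) {c..real n + 1}"
  proof (rule fundamental_theorem_of_calculus[OF c(2)])
    fix y assume "y \<in> {c..real n + 1}"
    then have y: "y > 0" using c by auto
    then have "(F has_real_derivative (e * y - 1)\<^sup>2 / y\<^sup>2) (at y)"
      unfolding F_def by (auto intro!: derivative_eq_intros simp: field_simps power2_eq_square)
    then show "(F has_vector_derivative (e * y - 1)\<^sup>2 / y\<^sup>2) (at y within {c..real n + 1})"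
      by (simp add: has_real_derivative_iff_has_vector_derivative has_vector_derivative_at_within)
  qed
  then have 2: "(dilation_density e has_integral F (real n + 1) - F c) {c..real n + 1}"
  proof (rule has_integral_spike_finite[of "{c, real n + 1}", rotated 2])
    fix y assume y: "y \<in> {c..real n + 1} - {c, real n + 1}"
    have "(1 + e) * c < (1 + e) * y" using y assms by (intro mult_strict_left_mono) auto
    moreover have "e * y < 1"
    proof -
      have "e * y < e * (real n + 1)" using y assms by (intro mult_strict_left_mono) auto
      also have "\<dots> \<le> 1" using assms(2) by (simp add: mult.commute)
      finally show ?thesis .
    qed
    ultimately have "frac ((1 + e) * y) = (1 + e) * y - real (Suc n)"
      using y ac by (intro frac_unit_interval) (auto simp: algebra_simps)
    moreover have "frac y = y - real n" using y c by (intro frac_unit_interval) auto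
    ultimately have "frac ((1 + e) * y) - frac y = e * y - 1" by (simp add: algebra_simps)
    then show "dilation_density e y = (e * y - 1)\<^sup>2 / y\<^sup>2"
      by (simp add: dilation_density_def)
  qed simp
  have "(dilation_density e has_integral (c - real n) * e\<^sup>2 + (F (real n + 1) - F c)) {real n..real n + 1}"
    by (rule has_integral_combine[OF c(1,2) 1 2])
  moreover have "(c - real n) * e\<^sup>2 + (F (real n + 1) - F c) = e\<^sup>2 - 2 * e * ln (1 + e) + e / (real n + 1)"
  proof -
    have lnc: "ln c = ln (real n + 1) - ln (1 + e)" unfolding c_def using assms by (simp add: ln_div)
    have "1 / c = (1 + e) / (real n + 1)" by (simp add: c_def)
    then have invc: "1 / c = 1 / (real n + 1) + e / (real n + 1)" by (simp only: add_divide_distrib)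
    show ?thesis unfolding F_def lnc invc by (simp add: algebra_simps)
  qed
  ultimately show ?thesis by simp
qed

lemma has_integral_dilation_density_initial:
  assumes "0 < e" "real m * e \<le> 1"
  shows "(dilation_density e has_integral real m * (e\<^sup>2 - 2 * e * ln (1 + e)) + e * harm m) {0..real m}"
  using assms(2)
proof (induction m)
  case 0
  then show ?case by (simp add: harm_def has_integral_refl)
next
  case (Suc m)
  have "real m * e \<le> real (Suc m) * e" using assms by (intro mult_right_mono) auto
  then have 1: "(dilation_density e has_integral real m * (e\<^sup>2 - 2 * e * ln (1 + e)) + e * harm m) {0..real m}"
    using Suc by auto
  have 2: "(dilation_density e has_integral e\<^sup>2 - 2 * e * ln (1 + e) + e / (real m + 1)) {real m..real m + 1}"
    using assms Suc.prems by (intro has_integral_dilation_density_unit) (auto simp: add.commute)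
  have "(dilation_density e has_integral
      (real m * (e\<^sup>2 - 2 * e * ln (1 + e)) + e * harm m) + (e\<^sup>2 - 2 * e * ln (1 + e) + e / (real m + 1))) {0..real m + 1}"
    by (rule has_integral_combine[OF _ _ 1 2]) auto
  then show ?case by (simp add: harm_Suc algebra_simps divide_inverse)
qed

lemma harm_approx:
  assumes "1 \<le> m"
  shows "\<bar>harm m - ln (real m) - euler_mascheroni\<bar> \<le> 1 / real m"
proof -
  have "euler_mascheroni \<in> {harm m - ln (real (Suc m)) + inverse (real (2 * (m + 1)))..
      harm m - ln (real (Suc m)) + inverse (real (2 * m))}"
    using euler_mascheroni_bounds[OF assms] by simp
  moreover have "ln (real (Suc m)) - ln (real m) \<le> 1 / real m" "0 \<le> ln (real (Suc m)) - ln (real m)"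
  proof -
    have "1 + 1 / real m = real (Suc m) / real m" using assms by (simp add: field_simps)
    then have "ln (real (Suc m)) - ln (real m) = ln (1 + 1 / real m)"
      using assms by (simp add: ln_div del: of_nat_Suc)
    also have "\<dots> \<le> 1 / real m" using assms by (intro ln_add_one_self_le_self) auto
    finally show "ln (real (Suc m)) - ln (real m) \<le> 1 / real m" .
    show "0 \<le> ln (real (Suc m)) - ln (real m)" using assms by simp
  qed
  moreover have "0 \<le> inverse (real (2 * (m + 1)))" "inverse (real (2 * m)) \<le> 1 / real m"
    using assms by (auto simp: field_simps)
  ultimately show ?thesis unfolding atLeastAtMost_iff abs_le_iff by linarith
qed

lemma dilation_density_integrable_on:
  assumes "1 \<le> m"
  shows "dilation_density e integrable_on {real m..b}"
    and "(\<lambda>y. parabola (e * y) / y\<^sup>2) integrable_on {real m..b}"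
proof -
  have "\<bar>q / y\<^sup>2\<bar> \<le> 1" if "0 \<le> q" "q \<le> 1" "real m \<le> y" for q y :: real
  proof -
    have "1 \<le> y\<^sup>2" using that assms by (intro one_le_power) auto
    then show ?thesis using that by (simp add: divide_le_eq)
  qed
  then show "dilation_density e integrable_on {real m..b}" "(\<lambda>y. parabola (e * y) / y\<^sup>2) integrable_on {real m..b}"
    unfolding dilation_density_def
    by (auto intro!: bounded_borel_integrable_on[where B = 1] simp: frac_diff_sq_le_1 parabola_bounds)
qed

text \<open>The bound on \<open>[N, N + 1]\<close> is of order \<open>1 / N\<^sup>2\<close> and is
  majorised by a multiple of \<open>2 / N - 2 / (N + 1)\<close>, so the estimates telescope and stay
  uniform in \<open>N\<close>.\<close>

lemma integral_dilation_density_tail_approx: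
  assumes "0 < e" "e \<le> 1" "1 \<le> m" "m \<le> N"
  shows "\<bar>integral {real m..real N} (\<lambda>y. dilation_density e y - parabola (e * y) / y\<^sup>2)\<bar>
     \<le> (5 * e + 2 / real m) * (2 / real m - 2 / real N)"
  using assms(4)
proof (induction N rule: dec_induct)
  case base
  then show ?case by simp
next
  case (step N)
  define h where "h = (\<lambda>y. dilation_density e y - parabola (e * y) / y\<^sup>2)"
  have N: "1 \<le> N" "0 < real N" "real m \<le> real N" "1 \<le> real m" using assms step by auto
  have "integral {real m..real N} h + integral {real N..real (Suc N)} h = integral {real m..real (Suc N)} h"
    unfolding h_def using step assms
    by (intro Henstock_Kurzweil_Integration.integral_combine integrable_diff dilation_density_integrable_on) auto
  moreover have "\<bar>integral {real N..real (Suc N)} h\<bar> \<le> (5 * e + 2 / real m) * (2 / real N - 2 / real (Suc N))"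
  proof -
    have "\<bar>integral {real N..real (Suc N)} h\<bar> \<le> 5 * e / (real N)\<^sup>2 + 2 / real N ^ 3"
      using integral_dilation_density_approx[OF assms(1,2) N(1)] unfolding h_def by (simp add: add.commute)
    also have "\<dots> = (5 * e + 2 / real N) * (1 / (real N)\<^sup>2)"
      using N by (simp add: field_simps power2_eq_square power3_eq_cube)
    also have "\<dots> \<le> (5 * e + 2 / real m) * (2 / real N - 2 / real (Suc N))"
    proof (rule mult_mono)
      show "5 * e + 2 / real N \<le> 5 * e + 2 / real m" using N by (auto intro!: divide_left_mono)
      have "2 / real N - 2 / real (Suc N) = 2 / (real N * (real N + 1))" using N by (simp add: field_simps)
      also have "\<dots> \<ge> 2 / (2 * (real N)\<^sup>2)"
      proof (rule divide_left_mono)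
        show "real N * (real N + 1) \<le> 2 * (real N)\<^sup>2" using N by (simp add: power2_eq_square algebra_simps)
      qed (use N in \<open>auto intro!: mult_pos_pos\<close>)
      finally show "1 / (real N)\<^sup>2 \<le> 2 / real N - 2 / real (Suc N)" by simp
    qed (use assms in auto)
    finally show ?thesis .
  qed
  ultimately show ?case using step.IH unfolding h_def by (simp add: algebra_simps)
qed


definition dilation_integral :: "real \<Rightarrow> real" where
  "dilation_integral e = (LINT y|lborel. indicator {0<..} y * dilation_density e y)"

text \<open>
  Since \<open>2ab = a\<^sup>2 + b\<^sup>2 - (a - b)\<^sup>2\<close>, the autocorrelation is governed by the mean square of
  \<open>frac (e\<^sup>u y) - frac y\<close>.
\<close>

lemma
  assumes "0 \<le> u"
  shows autocorr_eq_dilation_integral: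
      "autocorr u = exp (- u / 2) * ((exp u + 1) * autocorr 0 - dilation_integral (exp u - 1)) / 2"
    and integrable_dilation_density:
      "integrable lborel (\<lambda>y. indicator {0<..} y * dilation_density (exp u - 1) y)"
proof -
  define k where "k = dilation_density (exp u - 1)"
  define g where "g = (\<lambda>x. (frac_wave (x + u) * exp (u / 2) - frac_wave x)\<^sup>2)"
  have [measurable]: "k \<in> borel_measurable borel" "g \<in> borel_measurable borel"
    unfolding k_def g_def by measurable
  have g_k: "g x = \<bar>exp x\<bar> * k (exp x)" for x
  proof -
    have "frac_wave (x + u) * exp (u / 2) = frac (exp (x + u)) * (exp (- (x + u) / 2) * exp (u / 2))"
      by (simp add: frac_wave_def)
    also have "exp (- (x + u) / 2) * exp (u / 2) = exp (- x / 2)"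
      unfolding exp_add [symmetric] by (rule arg_cong[of _ _ exp]) (simp add: field_simps)
    finally have E: "frac_wave (x + u) * exp (u / 2) = frac (exp (x + u)) * exp (- x / 2)" .
    have "g x = (frac (exp (x + u)) - frac (exp x))\<^sup>2 * (exp (- x / 2))\<^sup>2"
      unfolding g_def E unfolding frac_wave_def by (simp add: left_diff_distrib flip: power_mult_distrib)
    also have "(exp (- x / 2))\<^sup>2 = exp x / (exp x)\<^sup>2"
      by (simp add: power2_eq_square exp_minus field_simps flip: exp_add)
    finally show ?thesis
      by (simp add: k_def dilation_density_def exp_add mult.commute)
  qed
  define P Q R where "P = (\<lambda>x. frac_wave (x + u) * frac_wave (x + u))"
    and "Q = (\<lambda>x. frac_wave x * frac_wave x)" and "R = (\<lambda>x. frac_wave x * frac_wave (x + u))"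
  have PQR: "integrable lborel P" "integrable lborel Q" "integrable lborel R"
    using integrable_frac_wave_mult[of u u] integrable_frac_wave_mult[of 0 0] integrable_frac_wave_mult[of 0 u]
    by (simp_all add: P_def Q_def R_def)
  have A: "g = (\<lambda>x. exp u * P x + Q x - 2 * exp (u / 2) * R x)"
  proof
    fix x
    have "exp u = exp (u / 2) * exp (u / 2)" by (simp flip: exp_add)
    then show "g x = exp u * P x + Q x - 2 * exp (u / 2) * R x"
      by (simp add: g_def P_def Q_def R_def power2_eq_square algebra_simps)
  qed
  have g_int: "integrable lborel g"
    unfolding A using PQR
    by (intro Bochner_Integration.integrable_add Bochner_Integration.integrable_diff integrable_mult_right) auto
  have "(LINT x|lborel. P x) = autocorr 0"
    using lborel_integral_real_affine[of 1 "\<lambda>x. frac_wave x * frac_wave x" u]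
    by (simp add: P_def autocorr_def add.commute)
  then have g_val: "(LINT x|lborel. g x) = exp u * autocorr 0 + autocorr 0 - 2 * exp (u / 2) * autocorr u"
    unfolding A using PQR by (simp add: autocorr_def Q_def[symmetric] R_def[symmetric])
  have "g absolutely_integrable_on UNIV" "integral UNIV g = (LINT x|lborel. g x)"
    using g_int has_integral_integral_lborel[OF g_int]
    by (auto simp: set_integrable_def integrable_completion integral_unique)
  then have "k absolutely_integrable_on (exp ` UNIV) \<and> integral (exp ` UNIV) k = (LINT x|lborel. g x)"
    using has_absolute_integral_change_of_variables_1'[of UNIV exp exp k "LINT x|lborel. g x"]
    unfolding g_k by (auto intro: derivative_intros simp: inj_on_def)
  moreover have "exp ` UNIV = {0::real<..}"
    by (auto simp: image_iff intro: exI[of _ "ln _"] exp_ln[symmetric])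
  ultimately have k: "k absolutely_integrable_on {0<..}" "integral {0<..} k = (LINT x|lborel. g x)" by auto
  then have k_int: "set_integrable lborel {0<..} k"
    unfolding set_integrable_def by (subst (asm) integrable_completion) auto
  then show "integrable lborel (\<lambda>y. indicator {0<..} y * dilation_density (exp u - 1) y)"
    by (simp add: set_integrable_def k_def)
  have "dilation_integral (exp u - 1) = exp u * autocorr 0 + autocorr 0 - 2 * exp (u / 2) * autocorr u"
    using set_borel_integral_eq_integral(2)[OF k_int] k(2) g_val
    by (simp add: dilation_integral_def set_lebesgue_integral_def k_def)
  then have D: "(exp u + 1) * autocorr 0 - dilation_integral (exp u - 1) = 2 * (exp (u / 2) * autocorr u)"
    by (simp add: algebra_simps)
  have "exp (- u / 2) * exp (u / 2) = 1" by (simp flip: exp_add)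
  then show "autocorr u = exp (- u / 2) * ((exp u + 1) * autocorr 0 - dilation_integral (exp u - 1)) / 2"
    unfolding D by (simp add: mult.assoc[symmetric])
qed

definition parabola_tail :: real where
  "parabola_tail = (LINT x:{1..}|lborel. parabola x / x\<^sup>2)"

lemma parabola_tail_limit: "((\<lambda>b. integral {1..b} (\<lambda>x. parabola x / x\<^sup>2)) \<longlongrightarrow> parabola_tail) at_top"
proof -
  have "integrable lborel (\<lambda>x. indicator {1..} x *\<^sub>R (parabola x / x\<^sup>2))"
  proof (rule integrable_powr_boundI[where p = "-2" and C = 4])
    fix x :: real
    show "\<bar>indicator {1..} x *\<^sub>R (parabola x / x\<^sup>2)\<bar> \<le> 4 * (1 + \<bar>x\<bar>) powr (-2)"
    proof (cases "1 \<le> x")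
      case True
      have "parabola x / x\<^sup>2 \<le> 1 / x\<^sup>2" using parabola_bounds[of x] by (intro divide_right_mono) auto
      also have "\<dots> \<le> 4 / (1 + x)\<^sup>2"
      proof -
        have "(1 + x)\<^sup>2 \<le> (2 * x)\<^sup>2" using True by (intro power_mono) auto
        then show ?thesis using True by (simp add: field_simps power_mult_distrib)
      qed
      finally show ?thesis using True parabola_bounds[of x] by (simp add: powr_minus powr_numeral divide_inverse)
    qed (simp add: indicator_def)
  qed auto
  then have i: "set_integrable lborel {1..} (\<lambda>x. parabola x / x\<^sup>2)" by (simp add: set_integrable_def)
  have "((\<lambda>b. LINT x:{1..b}|lborel. parabola x / x\<^sup>2) \<longlongrightarrow> parabola_tail) at_top"
    unfolding parabola_tail_def by (rule tendsto_set_lebesgue_integral_at_top[OF _ i]) simp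
  moreover have "(LINT x:{1..b}|lborel. parabola x / x\<^sup>2) = integral {1..b} (\<lambda>x. parabola x / x\<^sup>2)" for b
    by (rule set_borel_integral_eq_integral(2)[OF set_integrable_subset[OF i]]) auto
  ultimately show ?thesis by simp
qed

text \<open>The substitution \<open>x = e * y\<close> leads to
  \<open>parabola x / x\<^sup>2\<close>. On \<open>[e * m, 1]\<close> this is
  \<open>1 / x - 1\<close>, with antiderivative \<open>ln x - x\<close>, which is where
  \<open>- ln (e * m)\<close> comes from; beyond 1 the integral converges to
  \<open>parabola_tail\<close> as \<open>b\<close> grows.\<close>

lemma integral_parabola_scaled:
  assumes "0 < e" "1 \<le> m" "real m * e \<le> 1" "1 \<le> e * b"
  shows "integral {real m..b} (\<lambda>y. parabola (e * y) / y\<^sup>2)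
     = e * (e * real m - 1 - ln (e * real m) + integral {1..e * b} (\<lambda>x. parabola x / x\<^sup>2))"
proof -
  define q where "q = (\<lambda>x. parabola x / x\<^sup>2)"
  define v where "v = e * real m"
  have v: "0 < v" "v \<le> 1" using assms by (auto simp: v_def mult.commute)
  define F where "F = (\<lambda>x::real. ln x - x)"
  have "((\<lambda>x. (x * (1 - x)) / x\<^sup>2) has_integral F 1 - F v) {v..1}"
  proof (rule fundamental_theorem_of_calculus[OF v(2)])
    fix x assume "x \<in> {v..1}"
    then have x: "x > 0" using v by auto
    then have "(F has_real_derivative (x * (1 - x)) / x\<^sup>2) (at x)"
      unfolding F_def by (auto intro!: derivative_eq_intros simp: field_simps power2_eq_square)
    then show "(F has_vector_derivative (x * (1 - x)) / x\<^sup>2) (at x within {v..1})"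
      by (simp add: has_real_derivative_iff_has_vector_derivative has_vector_derivative_at_within)
  qed
  then have 1: "(q has_integral F 1 - F v) {v..1}"
  proof (rule has_integral_spike_finite[of "{1}", rotated 2])
    fix x assume "x \<in> {v..1} - {1}"
    then have "frac x = x" using v by (simp add: frac_eq)
    then show "q x = (x * (1 - x)) / x\<^sup>2" by (simp add: q_def parabola_def)
  qed simp
  have "q integrable_on {1..e * b}"
    using dilation_density_integrable_on(2)[of 1 1 "e * b"] by (simp add: q_def)
  then have 2: "(q has_integral integral {1..e * b} q) {1..e * b}" by (rule integrable_integral)
  have "(q has_integral F 1 - F v + integral {1..e * b} q) {v..e * b}"
    by (rule has_integral_combine[OF v(2) assms(4) 1 2])
  then have "((\<lambda>y. q (e *\<^sub>R y + 0)) has_integral ((F 1 - F v + integral {1..e * b} q) /\<^sub>R e ^ DIM(real)))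
      (cbox ((v - 0) /\<^sub>R e) ((e * b - 0) /\<^sub>R e))"
    using assms by (intro has_integral_affinity') auto
  then have "((\<lambda>y. q (e * y)) has_integral ((F 1 - F v + integral {1..e * b} q) / e)) {real m..b}"
    using assms by (simp add: v_def field_simps)
  then have "((\<lambda>y. e\<^sup>2 * q (e * y)) has_integral (e\<^sup>2 * ((F 1 - F v + integral {1..e * b} q) / e))) {real m..b}"
    by (rule has_integral_mult_right)
  then have "((\<lambda>y. parabola (e * y) / y\<^sup>2) has_integral (e\<^sup>2 * ((F 1 - F v + integral {1..e * b} q) / e))) {real m..b}"
    using assms by (simp add: q_def power_mult_distrib)
  then have "integral {real m..b} (\<lambda>y. parabola (e * y) / y\<^sup>2) = e\<^sup>2 * ((F 1 - F v + integral {1..e * b} q) / e)"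
    by (rule integral_unique)
  also have "\<dots> = e * (v - 1 - ln v + integral {1..e * b} q)"
    using assms by (simp add: F_def power2_eq_square)
  finally show ?thesis unfolding v_def q_def .
qed

text \<open>
  Below \<open>m\<close> the integral is evaluated exactly; beyond \<open>m\<close> the phase \<open>frac y\<close> is equidistributed on each
  unit interval, which turns \<open>(frac (y + e y) - frac y)\<^sup>2\<close> into its mean \<open>parabola (e y)\<close>.
\<close>

lemma dilation_integral_approx:
  assumes "0 < e" "e \<le> 1" "1 \<le> m" "real m * e \<le> 1"
  shows "\<bar>dilation_integral e - (real m * (e\<^sup>2 - 2 * e * ln (1 + e)) + e * harm m
       + e * (e * real m - 1 - ln (e * real m) + parabola_tail))\<bar> \<le> (5 * e + 2 / real m) * (2 / real m)"
proof -
  define K where "K = (\<lambda>y. indicator {0<..} y * dilation_density e y)"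
  define low where "low = real m * (e\<^sup>2 - 2 * e * ln (1 + e)) + e * harm m"
  define G where "G = (\<lambda>b. e * (e * real m - 1 - ln (e * real m) + integral {1..e * b} (\<lambda>x. parabola x / x\<^sup>2)))"
  have "integrable lborel K"
    using integrable_dilation_density[of "ln (1 + e)"] assms by (simp add: K_def)
  then have "(\<lambda>N. integral {- real N..real N} K) \<longlonglongrightarrow> dilation_integral e"
    unfolding dilation_integral_def K_def[symmetric] by (rule integral_symmetric_limit)
  moreover have "(\<lambda>N. G (real N)) \<longlonglongrightarrow> e * (e * real m - 1 - ln (e * real m) + parabola_tail)"
  proof -
    have "filterlim (\<lambda>N. e * real N) at_top sequentially" using assms by real_asymp
    then show ?thesis
      unfolding G_def by (intro tendsto_intros filterlim_compose[OF parabola_tail_limit])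
  qed
  ultimately have lim: "(\<lambda>N. \<bar>integral {- real N..real N} K - (low + G (real N))\<bar>)
      \<longlonglongrightarrow> \<bar>dilation_integral e - (low + e * (e * real m - 1 - ln (e * real m) + parabola_tail))\<bar>"
    by (intro tendsto_intros)
  have "eventually (\<lambda>N. \<bar>integral {- real N..real N} K - (low + G (real N))\<bar> \<le> (5 * e + 2 / real m) * (2 / real m)) sequentially"
  proof -
    have "eventually (\<lambda>N. 1 \<le> e * real N) sequentially" using assms by real_asymp
    then show ?thesis
      using eventually_ge_at_top[of m]
    proof eventually_elim
      case (elim N)
      have neg: "(K has_integral 0) {- real N..0}"
        by (rule has_integral_is_0) (auto simp: K_def)
      have lo: "(dilation_density e has_integral low) {0..real m}"
        unfolding low_def by (rule has_integral_dilation_density_initial[OF assms(1,4)])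
      have hi: "(dilation_density e has_integral integral {real m..real N} (dilation_density e)) {real m..real N}"
        by (intro integrable_integral dilation_density_integrable_on assms)
      have "(dilation_density e has_integral low + integral {real m..real N} (dilation_density e)) {0..real N}"
        by (rule has_integral_combine[OF _ _ lo hi]) (use elim in auto)
      then have pos: "(K has_integral low + integral {real m..real N} (dilation_density e)) {0..real N}"
        by (rule has_integral_eq[rotated]) (auto simp: K_def indicator_def dilation_density_def)
      have "integral {- real N..real N} K = low + integral {real m..real N} (dilation_density e)"
        using has_integral_combine[OF _ _ neg pos] by (simp add: integral_unique)
      moreover have "integral {real m..real N} (\<lambda>y. dilation_density e y - parabola (e * y) / y\<^sup>2)
          = integral {real m..real N} (dilation_density e) - G (real N)"
        unfolding G_def integral_parabola_scaled[OF assms(1,3,4) elim(1), symmetric]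
        by (intro integral_diff dilation_density_integrable_on assms)
      ultimately have "\<bar>integral {- real N..real N} K - (low + G (real N))\<bar>
          \<le> (5 * e + 2 / real m) * (2 / real m - 2 / real N)"
        using integral_dilation_density_tail_approx[OF assms(1-3) elim(2)] by simp
      also have "\<dots> \<le> (5 * e + 2 / real m) * (2 / real m)"
        using assms by (intro mult_left_mono) auto
      finally show ?case .
    qed
  qed
  from tendsto_upperbound[OF lim this] show ?thesis unfolding low_def by simp
qed

text \<open>In \<open>e * harm m - e * ln (e * m)\<close> the terms \<open>e * ln m\<close> cancel,
  and \<open>e * (euler_mascheroni - ln e)\<close> remains up to \<open>e / m\<close>. The cut
  \<open>m\<close> thus affects only the error, and \<open>C\<close> is
  \<open>euler_mascheroni - 1 + parabola_tail\<close>.\<close>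

lemma dilation_integral_asymp:
  obtains C K where "\<And>e. 0 < e \<Longrightarrow> e \<le> 1 \<Longrightarrow> \<bar>dilation_integral e - e * (C - ln e)\<bar> \<le> K * e powr (4/3)"
proof
  fix e :: real assume e: "0 < e" "e \<le> 1"
  \<comment> \<open>This choice balances the two errors \<open>m e\<^sup>2\<close> and \<open>1 / m\<^sup>2\<close>.\<close>
  define X where "X = e powr (- 2 / 3)"
  define m where "m = nat \<lfloor>X\<rfloor>"
  have X1: "1 \<le> X" using e powr_mono'[of "- 2 / 3" 0 e] by (simp add: X_def)
  have X1': "1 \<le> \<lfloor>X\<rfloor>" using X1 by simp
  then have mX: "real m = of_int \<lfloor>X\<rfloor>" by (simp add: m_def)
  have m: "1 \<le> m" "real m \<le> X" "X \<le> 2 * real m" "0 < real m"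
    unfolding mX using X1' by (simp add: m_def, linarith+)
  have eX: "e * X = e powr (1/3)"
    using powr_add[of e 1 "- 2 / 3"] e by (simp add: X_def)
  have e2X: "e\<^sup>2 * X = e powr (4/3)"
    using powr_add[of e 2 "- 2 / 3"] e by (simp add: X_def powr_numeral)
  have eX': "e / X = e powr (5/3)"
    using powr_diff[of e 1 "- 2 / 3"] e by (simp add: X_def)
  have X2: "1 / X\<^sup>2 = e powr (4/3)"
    using powr_add[of e "- 2 / 3" "- 2 / 3"] powr_minus_divide[of e "- 4 / 3"] e by (simp add: X_def power2_eq_square)
  have me: "real m * e \<le> 1"
  proof -
    have "real m * e \<le> X * e" using m e by (intro mult_right_mono) auto
    also have "\<dots> \<le> 1" using eX e by (simp add: mult.commute powr_le1)
    finally show ?thesis .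
  qed
  have p43: "0 \<le> e powr (4/3)" "e powr (5/3) \<le> e powr (4/3)" using e by (auto intro: powr_mono')
  have me2: "real m * e\<^sup>2 \<le> e powr (4/3)"
    using mult_right_mono[OF m(2), of "e\<^sup>2"] e2X by (simp add: mult.commute)
  have em: "e / real m \<le> 2 * e powr (4/3)"
  proof -
    have "e / real m \<le> 2 * (e / X)" using m X1 e by (simp add: field_simps)
    then show ?thesis using eX' p43 by simp
  qed
  have m2: "1 / (real m)\<^sup>2 \<le> 4 * e powr (4/3)"
  proof -
    have "X\<^sup>2 \<le> (2 * real m)\<^sup>2" using m X1 by (intro power_mono) auto
    then have "1 / (real m)\<^sup>2 \<le> 4 * (1 / X\<^sup>2)" using m X1 by (simp add: field_simps power_mult_distrib)
    then show ?thesis using X2 by simp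
  qed
  have a: "\<bar>real m * (e\<^sup>2 - 2 * e * ln (1 + e))\<bar> \<le> real m * e\<^sup>2"
  proof -
    have "0 \<le> e * ln (1 + e)" using e by simp
    moreover have "e * ln (1 + e) \<le> e\<^sup>2"
      using mult_left_mono[OF ln_add_one_self_le_self[of e], of e] e by (simp add: power2_eq_square)
    ultimately have "\<bar>e\<^sup>2 - 2 * e * ln (1 + e)\<bar> \<le> e\<^sup>2" by (simp add: abs_le_iff)
    then show ?thesis by (simp add: abs_mult mult_left_mono)
  qed
  have b: "\<bar>e * (harm m - ln (real m) - euler_mascheroni)\<bar> \<le> e / real m"
    using mult_left_mono[OF harm_approx[OF m(1)], of e] e by (simp add: abs_mult)
  have "\<bar>dilation_integral e - e * ((euler_mascheroni - 1 + parabola_tail) - ln e)\<bar>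
      \<le> (5 * e + 2 / real m) * (2 / real m) + (real m * e\<^sup>2 + e / real m + real m * e\<^sup>2)"
  proof -
    have "ln (e * real m) = ln e + ln (real m)" using e m by (simp add: ln_mult)
    then have *: "real m * (e\<^sup>2 - 2 * e * ln (1 + e)) + e * harm m + e * (e * real m - 1 - ln (e * real m) + parabola_tail)
       - e * ((euler_mascheroni - 1 + parabola_tail) - ln e)
       = real m * (e\<^sup>2 - 2 * e * ln (1 + e)) + e * (harm m - ln (real m) - euler_mascheroni) + real m * e\<^sup>2"
      by (simp add: algebra_simps power2_eq_square)
    have "0 \<le> real m * e\<^sup>2" by simp
    then show ?thesis
      using dilation_integral_approx[OF e m(1) me] a b * by linarith
  qed
  also have "(5 * e + 2 / real m) * (2 / real m) = 10 * (e / real m) + 4 * (1 / (real m)\<^sup>2)"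
    by (simp add: algebra_simps add_divide_distrib power2_eq_square)
  \<comment> \<open>\<open>11 * 2 + 4 * 4 + 2 = 40\<close>, from the bounds on \<open>e / m\<close>,
    \<open>1 / m\<^sup>2\<close> and \<open>m * e\<^sup>2\<close>.\<close>
  also have "10 * (e / real m) + 4 * (1 / (real m)\<^sup>2) + (real m * e\<^sup>2 + e / real m + real m * e\<^sup>2) \<le> 40 * e powr (4/3)"
    using me2 em m2 by linarith
  finally show "\<bar>dilation_integral e - e * ((euler_mascheroni - 1 + parabola_tail) - ln e)\<bar> \<le> 40 * e powr (4/3)" .
qed


text \<open>The exponents \<open>\<plusminus>1/3\<close> are chosen so that
  \<open>u * |ln u|\<close> is bounded by multiples of \<open>u powr (4/3)\<close> and
  \<open>u powr (2/3)\<close>, which do not exceed the error exponent of the autocorrelation at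
  infinity.\<close>

lemma abs_ln_le_powr:
  fixes u :: real
  assumes "0 < u"
  shows "\<bar>ln u\<bar> \<le> 3 * (u powr (1/3) + u powr (- 1/3))"
proof (cases "1 \<le> u")
  case True
  define p q where "p = u powr (1/3)" and "q = u powr (- 1/3)"
  have "ln u \<le> p / (1/3)" unfolding p_def by (rule ln_powr_bound) (use True in auto)
  moreover have "0 \<le> q" by (simp add: q_def)
  ultimately show ?thesis using True unfolding p_def[symmetric] q_def[symmetric] by simp
next
  case False
  then have "ln (1 / u) \<le> (1 / u) powr (1/3) / (1/3)" using assms by (intro ln_powr_bound) auto
  then have "- ln u \<le> 3 * u powr (- 1/3)"
    using assms by (simp add: ln_div powr_minus powr_divide inverse_eq_divide)
  moreover have "0 \<le> 3 * u powr (1/3)" by simp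
  moreover have "\<bar>ln u\<bar> = - ln u" using False assms by simp
  ultimately show ?thesis unfolding distrib_left by linarith
qed

text \<open>Near 0 the expansion of the dilation integral is inserted at
  \<open>e = exp u - 1\<close>; the passage from \<open>e\<close> to \<open>u\<close> costs only
  terms that are \<open>O(u powr (4/3))\<close>. Beyond some \<open>b\<close> the autocorrelation is
  bounded and the explicit terms are of lower order, so \<open>u powr (4/3)\<close> dominates
  everything. The bound is made global because it is integrated against a kernel over the whole
  line.\<close>

lemma autocorr_asymp:
  obtains B C where "0 \<le> C"
    "\<And>u. \<bar>autocorr u - (autocorr 0 + \<bar>u\<bar> * ln \<bar>u\<bar> / 2 + B * \<bar>u\<bar>)\<bar> \<le> C * \<bar>u\<bar> powr (4/3)"
proof -
  obtain c K where cK: "\<And>e. 0 < e \<Longrightarrow> e \<le> 1 \<Longrightarrow> \<bar>dilation_integral e - e * (c - ln e)\<bar> \<le> K * e powr (4/3)"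
    using dilation_integral_asymp by blast
  define r1 r2 r3 :: "real \<Rightarrow> real"
    where "r1 = (\<lambda>u. exp (- u / 2) * (exp u + 1) / 2 - 1)"
      and "r2 = (\<lambda>u. exp (- u / 2) * (exp u - 1) * ln (exp u - 1) / 2 - u * ln u / 2)"
      and "r3 = (\<lambda>u. u / 2 - exp (- u / 2) * (exp u - 1) / 2)"
  define r where "r = (\<lambda>u. autocorr 0 * r1 u + r2 u + c * r3 u)"
  define B where "B = - c / 2"
  define main where "main = (\<lambda>u. autocorr 0 + u * ln u / 2 + B * u)"
  have split: "autocorr u - main u
      = r u - exp (- u / 2) / 2 * (dilation_integral (exp u - 1) - (exp u - 1) * (c - ln (exp u - 1)))"
    if "0 < u" for u
    unfolding main_def B_def r_def r1_def r2_def r3_def using autocorr_eq_dilation_integral[of u] that by (simp add: field_simps)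
  have "r1 \<in> O[at_right 0](\<lambda>u. u powr (4/3))" "r2 \<in> O[at_right 0](\<lambda>u. u powr (4/3))"
       "r3 \<in> O[at_right 0](\<lambda>u. u powr (4/3))"
    unfolding r1_def r2_def r3_def by real_asymp+
  then have "r \<in> O[at_right 0](\<lambda>u. u powr (4/3))"
    unfolding r_def by (intro sum_in_bigo) auto
  then obtain c1 where c1: "c1 > 0" "eventually (\<lambda>u. norm (r u) \<le> c1 * norm (u powr (4/3))) (at_right 0)"
    by (rule landau_o.bigE)
  have "eventually (\<lambda>u::real. exp u - 1 \<le> 2 * u) (at_right 0)" "eventually (\<lambda>u::real. exp u - 1 \<le> 1) (at_right 0)"
    by real_asymp+
  with c1(2) have "eventually (\<lambda>u. \<bar>autocorr u - main u\<bar> \<le> (c1 + 4 * \<bar>K\<bar>) * u powr (4/3)) (at_right 0)"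
    using eventually_at_right_less[of 0]
  proof eventually_elim
    case (elim u)
    define e where "e = exp u - 1"
    have e: "0 < e" "e \<le> 1" "e \<le> 2 * u" using elim by (auto simp: e_def)
    have "\<bar>dilation_integral e - e * (c - ln e)\<bar> \<le> K * e powr (4/3)" by (rule cK[OF e(1,2)])
    also have "\<dots> \<le> \<bar>K\<bar> * (2 * u) powr (4/3)" using e by (intro mult_mono powr_mono2) auto
    also have "\<dots> = \<bar>K\<bar> * 2 powr (4/3) * u powr (4/3)" using elim by (simp add: powr_mult)
    also have "\<dots> \<le> \<bar>K\<bar> * 4 * u powr (4/3)"
    proof -
      have "(2::real) powr (4/3) \<le> 2 powr 2" by (rule powr_mono) auto
      then show ?thesis by (intro mult_right_mono mult_left_mono) auto
    qed
    finally have 1: "\<bar>dilation_integral e - e * (c - ln e)\<bar> \<le> \<bar>K\<bar> * 4 * u powr (4/3)" .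
    have "exp (- u / 2) / 2 * \<bar>dilation_integral e - e * (c - ln e)\<bar> \<le> 1 * (\<bar>K\<bar> * 4 * u powr (4/3))"
      using 1 elim by (intro mult_mono) (auto intro: order_trans[of _ 1])
    then have "\<bar>exp (- u / 2) / 2 * (dilation_integral e - e * (c - ln e))\<bar> \<le> \<bar>K\<bar> * 4 * u powr (4/3)"
      by (simp add: abs_mult)
    moreover have "\<bar>r u\<bar> \<le> c1 * u powr (4/3)" using elim by simp
    ultimately have "\<bar>autocorr u - main u\<bar> \<le> c1 * u powr (4/3) + \<bar>K\<bar> * 4 * u powr (4/3)"
      unfolding split[OF elim(4)] e_def[symmetric] by linarith
    then show ?case by (simp add: algebra_simps)
  qed
  then obtain b where b: "b > 0" "\<And>u. 0 < u \<Longrightarrow> u < b \<Longrightarrow> \<bar>autocorr u - main u\<bar> \<le> (c1 + 4 * \<bar>K\<bar>) * u powr (4/3)"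
    by (auto simp: eventually_at_right_field)
  define J where "J = (LINT x|lborel. frac_wave x)"
  define c2 where "c2 = 2 * J * b powr (- 4/3) + 3/2 * (1 + b powr (- 2/3)) + \<bar>B\<bar> * b powr (- 1/3)"
  have J: "0 \<le> autocorr u" "autocorr u \<le> J" for u
    using autocorr_nonneg autocorr_le by (auto simp: J_def)
  then have J0: "0 \<le> J" by (rule order_trans)
  have "\<bar>autocorr u - main u\<bar> \<le> c2 * u powr (4/3)" if u: "b \<le> u" for u
  proof -
    have u0: "0 < u" using u b by simp
    have scale: "u powr (4/3 - s) \<le> b powr (- s) * u powr (4/3)" if "0 \<le> s" for s
    proof -
      have "u powr (4/3 - s) = u powr (- s) * u powr (4/3)" by (simp flip: powr_add)
      also have "\<dots> \<le> b powr (- s) * u powr (4/3)"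
        using powr_mono2'[of "- s" b u] that u b by (intro mult_right_mono) auto
      finally show ?thesis .
    qed
    have "\<bar>autocorr u - autocorr 0\<bar> \<le> J" using J[of u] J[of 0] by linarith
    also have "J \<le> J * (2 * b powr (- 4/3) * u powr (4/3))"
    proof -
      have "1 \<le> b powr (- 4/3) * u powr (4/3)" using scale[of "4/3"] u0 by simp
      then show ?thesis using J0 mult_left_mono[of 1 "2 * b powr (- 4/3) * u powr (4/3)" J] by simp
    qed
    finally have 1: "\<bar>autocorr u - autocorr 0\<bar> \<le> 2 * J * b powr (- 4/3) * u powr (4/3)" by (simp add: mult_ac)
    have "u * \<bar>ln u\<bar> \<le> u * (3 * (u powr (1/3) + u powr (- 1/3)))"
      using u0 abs_ln_le_powr[OF u0] by (intro mult_left_mono) auto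
    also have "\<dots> = 3 * (u powr (4/3) + u powr (4/3 - 2/3))"
      using u0 powr_add[of u 1 "1/3"] powr_add[of u 1 "- 1/3"] by (simp add: algebra_simps)
    also have "\<dots> \<le> 3 * (u powr (4/3) + b powr (- (2/3)) * u powr (4/3))"
      using scale[of "2/3"] by simp
    finally have 2: "\<bar>u * ln u / 2\<bar> \<le> 3/2 * (1 + b powr (- 2/3)) * u powr (4/3)"
      using u0 by (simp add: abs_mult algebra_simps)
    have "u \<le> b powr (- 1/3) * u powr (4/3)" using scale[of "1/3"] u0 by simp
    then have 3: "\<bar>B * u\<bar> \<le> \<bar>B\<bar> * b powr (- 1/3) * u powr (4/3)"
      using u0 mult_left_mono[of u "b powr (- 1/3) * u powr (4/3)" "\<bar>B\<bar>"] by (simp add: abs_mult mult_ac)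
    have "\<bar>autocorr u - main u\<bar> \<le> \<bar>autocorr u - autocorr 0\<bar> + \<bar>u * ln u / 2\<bar> + \<bar>B * u\<bar>"
      unfolding main_def by linarith
    then show ?thesis using 1 2 3 unfolding c2_def by (simp add: algebra_simps)
  qed
  note big = this
  define C where "C = max (c1 + 4 * \<bar>K\<bar>) c2"
  have pos: "\<bar>autocorr u - main u\<bar> \<le> C * u powr (4/3)" if "0 < u" for u
  proof (cases "u < b")
    case True
    have "\<bar>autocorr u - main u\<bar> \<le> (c1 + 4 * \<bar>K\<bar>) * u powr (4/3)" by (rule b(2)[OF that True])
    also have "\<dots> \<le> C * u powr (4/3)" by (intro mult_right_mono) (auto simp: C_def)
    finally show ?thesis .
  next
    case False
    then have "\<bar>autocorr u - main u\<bar> \<le> c2 * u powr (4/3)" by (intro big) simp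
    also have "\<dots> \<le> C * u powr (4/3)" by (intro mult_right_mono) (auto simp: C_def)
    finally show ?thesis .
  qed
  show thesis
  proof
    show "0 \<le> C" using c1(1) by (simp add: C_def le_max_iff_disj)
    fix u
    have "autocorr \<bar>u\<bar> = autocorr u" by (simp add: abs_if autocorr_minus)
    then show "\<bar>autocorr u - (autocorr 0 + \<bar>u\<bar> * ln \<bar>u\<bar> / 2 + B * \<bar>u\<bar>)\<bar> \<le> C * \<bar>u\<bar> powr (4/3)"
      using pos[of "\<bar>u\<bar>"] by (cases "u = 0") (auto simp: main_def)
  qed
qed

section \<open>The kernels of the second Cesaro mean\<close>

lemma has_derivative_trig_integral:
  fixes p :: "real \<Rightarrow> real"
  assumes "continuous_on {0..1} p"
  shows "((\<lambda>v. integral {0..1} (\<lambda>t. p t * sin (t * v))) has_real_derivative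
            integral {0..1} (\<lambda>t. t * p t * cos (t * v))) (at v)" (is ?A)
    and "((\<lambda>v. integral {0..1} (\<lambda>t. p t * cos (t * v))) has_real_derivative
            - integral {0..1} (\<lambda>t. t * p t * sin (t * v))) (at v)" (is ?B)
proof -
  have c: "continuous_on (UNIV \<times> cbox 0 1) (\<lambda>x. p (snd x))"
    by (rule continuous_on_compose2[OF assms]) (auto intro!: continuous_intros)
  have "((\<lambda>v. integral (cbox 0 1) (\<lambda>t. p t * sin (t * v))) has_real_derivative
            integral (cbox 0 1) (\<lambda>t. t * p t * cos (t * v))) (at v within UNIV)"
    by (rule leibniz_rule_field_derivative)
       (use c assms in \<open>auto simp: split_beta intro!: derivative_eq_intros integrable_continuous_interval continuous_intros\<close>)
  then show ?A by simp
  have "((\<lambda>v. integral (cbox 0 1) (\<lambda>t. p t * cos (t * v))) has_real_derivative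
            integral (cbox 0 1) (\<lambda>t. - (t * p t * sin (t * v)))) (at v within UNIV)"
    by (rule leibniz_rule_field_derivative)
       (use c assms in \<open>auto simp: split_beta intro!: derivative_eq_intros integrable_continuous_interval continuous_intros\<close>)
  then show ?B by simp
qed

text \<open>An antiderivative of \<open>kernel2\<close> and, up to sign, the derivative of
  \<open>kernel0\<close>; through it the moments of \<open>kernel2\<close> become boundary
  values.\<close>

definition kernel1 :: "real \<Rightarrow> real" where
  "kernel1 v = integral {0..1} (\<lambda>t. t * (1 - t)\<^sup>2 * sin (t * v))"

lemma kernel1_deriv: "(kernel1 has_real_derivative kernel2 v) (at v)"
proof -
  have eq: "t * (t * (1 - t)\<^sup>2) = t\<^sup>2 * (1 - t)\<^sup>2" for t :: real by (simp add: power2_eq_square)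
  have "continuous_on {0..1} (\<lambda>t::real. t * (1 - t)\<^sup>2)" by (intro continuous_intros)
  from has_derivative_trig_integral(1)[OF this, of v] show ?thesis
    unfolding kernel1_def[abs_def] kernel2_def eq .
qed

lemma kernel0_deriv: "(kernel0 has_real_derivative - kernel1 v) (at v)"
proof -
  have "continuous_on {0..1} (\<lambda>t::real. (1 - t)\<^sup>2)" by (intro continuous_intros)
  from has_derivative_trig_integral(2)[OF this, of v] show ?thesis
    unfolding kernel0_def[abs_def] kernel1_def .
qed

text \<open>Repeated integration by parts supplies \<open>F\<close>. Writing \<open>r\<close> for
  \<open>1 / v\<close> turns the check of its derivative into a polynomial identity modulo
  \<open>r * v = 1\<close>; the same device serves the other two kernels.\<close>

lemma kernel0_eq:
  assumes v: "v \<noteq> 0"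
  shows "kernel0 v = 2 / v\<^sup>2 - 2 * sin v / v ^ 3"
proof -
  define r where "r = 1 / v"
  have rv: "r * v = 1" using v by (simp add: r_def)
  define F where "F = (\<lambda>t. (1 - t) * (1 - t) * sin (t * v) * r
      - 2 * (1 - t) * cos (t * v) * r ^ 2 - 2 * sin (t * v) * r ^ 3)"
  have d: "(F has_real_derivative (1 - t)\<^sup>2 * cos (t * v)) (at t)" for t
    unfolding F_def power2_eq_square by (rule derivative_eq_intros refl)+ (use rv in algebra)
  have "kernel0 v = F 1 - F 0"
    unfolding kernel0_def by (intro integral_unique has_integral_FTC_real d) simp
  then show ?thesis
    using v by (simp add: F_def r_def power_divide add_divide_distrib)
qed

lemma kernel1_eq:
  assumes v: "v \<noteq> 0"
  shows "kernel1 v = (2 * cos v + 4) / v ^ 3 - 6 * sin v / v ^ 4"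
proof -
  define r where "r = 1 / v"
  have rv: "r * v = 1" using v by (simp add: r_def)
  define F where "F = (\<lambda>t. (1 - 4 * t + 3 * t * t) * sin (t * v) * r ^ 2
      + (6 * t - 4) * cos (t * v) * r ^ 3 - 6 * sin (t * v) * r ^ 4 
      - (t - 2 * t * t + t * t * t) * cos (t * v) * r)"
  have d: "(F has_real_derivative t * (1 - t)\<^sup>2 * sin (t * v)) (at t)" for t
    unfolding F_def power2_eq_square by (rule derivative_eq_intros refl)+ (use rv in algebra)
  have "kernel1 v = F 1 - F 0"
    unfolding kernel1_def by (intro integral_unique has_integral_FTC_real d) simp
  then show ?thesis
    using v by (simp add: F_def r_def power_divide add_divide_distrib)
qed

lemma kernel2_eq:
  assumes v: "v \<noteq> 0"
  shows "kernel2 v = - 2 * sin v / v ^ 3 - 12 * cos v / v ^ 4 + 24 * sin v / v ^ 5 - 12 / v ^ 4"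
proof -
  define r where "r = 1 / v"
  have rv: "r * v = 1" using v by (simp add: r_def)
  define F where "F = (\<lambda>t. (t * t - 2 * t * t * t + t * t * t * t) * sin (t * v) * r
      + (2 * t - 6 * t * t + 4 * t * t * t) * cos (t * v) * r ^ 2
      - (2 - 12 * t + 12 * t * t) * sin (t * v) * r ^ 3
      - (24 * t - 12) * cos (t * v) * r ^ 4 + 24 * sin (t * v) * r ^ 5)"
  have d: "(F has_real_derivative t\<^sup>2 * (1 - t)\<^sup>2 * cos (t * v)) (at t)" for t
    unfolding F_def power2_eq_square by (rule derivative_eq_intros refl)+ (use rv in algebra)
  have "kernel2 v = F 1 - F 0"
    unfolding kernel2_def by (intro integral_unique has_integral_FTC_real d) simp
  then show ?thesis
    using v by (simp add: F_def r_def power_divide add_divide_distrib)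
qed

lemma kernel0_minus: "kernel0 (- v) = kernel0 v"
  by (simp add: kernel0_def)

lemma kernel1_minus: "kernel1 (- v) = - kernel1 v"
  by (simp add: kernel1_def)

lemma kernel_abs_le_1: "\<bar>kernel0 v\<bar> \<le> 1" "\<bar>kernel2 v\<bar> \<le> 1"
proof -
  have b: "\<bar>integral {0..1} (\<lambda>t. q t * cos (t * v))\<bar> \<le> 1"
    if "continuous_on {0..1} q" "\<And>t. t \<in> {0..1} \<Longrightarrow> 0 \<le> q t \<and> q t \<le> 1" for q :: "real \<Rightarrow> real"
  proof -
    have "norm (integral {0..1} (\<lambda>t. q t * cos (t * v))) \<le> 1 * (1 - 0)"
    proof (rule integral_bound)
      fix t :: real assume "t \<in> {0..1}"
      then show "norm (q t * cos (t * v)) \<le> 1"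
        using that(2)[of t] mult_mono[of "\<bar>q t\<bar>" 1 "\<bar>cos (t * v)\<bar>" 1] by (simp add: abs_mult)
    qed (use that in \<open>auto intro!: continuous_intros\<close>)
    then show ?thesis by simp
  qed
  show "\<bar>kernel0 v\<bar> \<le> 1" unfolding kernel0_def
    by (rule b) (auto intro!: continuous_intros power_le_one)
  show "\<bar>kernel2 v\<bar> \<le> 1" unfolding kernel2_def
    by (rule b) (auto intro!: continuous_intros power_le_one mult_le_one)
qed

lemma kernel_measurable [measurable]: "kernel0 \<in> borel_measurable borel" "kernel2 \<in> borel_measurable borel"
proof -
  have "continuous_on UNIV kernel0"
    using kernel0_deriv by (auto simp: continuous_on_eq_continuous_at intro!: DERIV_isCont)
  then show "kernel0 \<in> borel_measurable borel" by (rule borel_measurable_continuous_onI)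
  have "continuous_on {0..1} (\<lambda>t::real. t\<^sup>2 * (1 - t)\<^sup>2)" by (intro continuous_intros)
  from has_derivative_trig_integral(2)[OF this] have "\<exists>D. (kernel2 has_real_derivative D) (at v)" for v
    unfolding kernel2_def[abs_def] by blast
  then have "continuous_on UNIV kernel2"
    by (auto simp: continuous_on_eq_continuous_at intro: DERIV_isCont)
  then show "kernel2 \<in> borel_measurable borel" by (rule borel_measurable_continuous_onI)
qed

lemma kernel0_bound: "\<bar>kernel0 v\<bar> \<le> 16 * (1 + \<bar>v\<bar>) powr (-2)"
proof -
  have "\<bar>kernel0 v\<bar> * (1 + \<bar>v\<bar>)\<^sup>2 \<le> 16"
  proof (cases "\<bar>v\<bar> \<le> 1")
    case True
    have "(1 + \<bar>v\<bar>)\<^sup>2 \<le> 2\<^sup>2" using True by (intro power_mono) auto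
    then have "\<bar>kernel0 v\<bar> * (1 + \<bar>v\<bar>)\<^sup>2 \<le> 1 * 4"
      using kernel_abs_le_1[of v] by (intro mult_mono) auto
    then show ?thesis by simp
  next
    case False
    then have v: "v \<noteq> 0" by auto
    have s: "\<bar>sin v\<bar> \<le> \<bar>v\<bar>" using False abs_sin_le_one[of v] by linarith
    have "kernel0 v * v\<^sup>2 = 2 - 2 * (sin v / v)"
      unfolding kernel0_eq[OF v] using v by (simp add: field_simps eval_nat_numeral)
    then have "\<bar>kernel0 v\<bar> * v\<^sup>2 = \<bar>2 - 2 * (sin v / v)\<bar>"
      by (metis abs_mult abs_power2)
    also have "\<dots> \<le> 4"
    proof -
      have "\<bar>sin v / v\<bar> \<le> 1" using s v by (simp add: abs_divide divide_le_eq_1)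
      then show ?thesis by linarith
    qed
    finally have 1: "\<bar>kernel0 v\<bar> * v\<^sup>2 \<le> 4" .
    have "(1 + \<bar>v\<bar>)\<^sup>2 \<le> (2 * \<bar>v\<bar>)\<^sup>2" using False by (intro power_mono) auto
    then have "\<bar>kernel0 v\<bar> * (1 + \<bar>v\<bar>)\<^sup>2 \<le> \<bar>kernel0 v\<bar> * (4 * v\<^sup>2)"
      by (intro mult_left_mono) (auto simp: power_mult_distrib)
    with 1 show ?thesis by simp
  qed
  then show ?thesis by (simp add: powr_minus powr_numeral field_simps)
qed

text \<open>The weight \<open>t\<^sup>2 * (1 - t)\<^sup>2\<close> has double zeros at both ends, so
  the first two boundary terms of the integration by parts vanish. For \<open>|v| > 1\<close> the
  constant is \<open>2 + 12 + 24 + 12 = 50\<close>, times 8 for the passage from \<open>|v|\<close>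
  to \<open>1 + |v|\<close>.\<close>

lemma kernel2_bound: "\<bar>kernel2 v\<bar> \<le> 400 * (1 + \<bar>v\<bar>) powr (-3)"
proof -
  have "\<bar>kernel2 v\<bar> * (1 + \<bar>v\<bar>) ^ 3 \<le> 400"
  proof (cases "\<bar>v\<bar> \<le> 1")
    case True
    have "(1 + \<bar>v\<bar>) ^ 3 \<le> 2 ^ 3" using True by (intro power_mono) auto
    then have "\<bar>kernel2 v\<bar> * (1 + \<bar>v\<bar>) ^ 3 \<le> 1 * 8"
      using kernel_abs_le_1[of v] by (intro mult_mono) auto
    then show ?thesis by simp
  next
    case False
    then have v: "v \<noteq> 0" by auto
    have q: "\<bar>q / v\<bar> \<le> B" if "\<bar>q\<bar> \<le> B" for q B
    proof -
      have "\<bar>q\<bar> * 1 \<le> B * \<bar>v\<bar>" using that False by (intro mult_mono) auto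
      then show ?thesis using v by (simp add: abs_divide divide_le_eq)
    qed
    have "\<bar>kernel2 v\<bar> * \<bar>v\<bar> ^ 3 = \<bar>- 2 * sin v - 12 * (cos v / v) + 24 * (sin v / v / v) - 12 / v\<bar>"
      unfolding kernel2_eq[OF v] power_abs[symmetric] abs_mult[symmetric]
      by (rule arg_cong[of _ _ abs]) (use v in \<open>simp add: field_simps eval_nat_numeral\<close>)
    also have "\<dots> \<le> 50"
    proof -
      have "\<bar>sin v\<bar> \<le> 1" "\<bar>cos v / v\<bar> \<le> 1" "\<bar>sin v / v / v\<bar> \<le> 1" "\<bar>12 / v\<bar> \<le> 12"
        using abs_sin_le_one q[OF abs_cos_le_one] q[OF q[OF abs_sin_le_one]] q[of 12 12] by auto
      then show ?thesis by linarith
    qed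
    finally have 1: "\<bar>kernel2 v\<bar> * \<bar>v\<bar> ^ 3 \<le> 50" .
    have "(1 + \<bar>v\<bar>) ^ 3 \<le> (2 * \<bar>v\<bar>) ^ 3" using False by (intro power_mono) auto
    then have "\<bar>kernel2 v\<bar> * (1 + \<bar>v\<bar>) ^ 3 \<le> \<bar>kernel2 v\<bar> * (8 * \<bar>v\<bar> ^ 3)"
      by (intro mult_left_mono) (auto simp: power_mult_distrib)
    with 1 show ?thesis by simp
  qed
  then show ?thesis by (simp add: powr_minus powr_numeral field_simps)
qed

lemma kernel2_powr_bound:
  assumes "\<bar>g v\<bar> \<le> C * (1 + \<bar>v\<bar>) powr q" "0 \<le> C"
  shows "\<bar>g v * kernel2 v\<bar> \<le> C * 400 * (1 + \<bar>v\<bar>) powr (q - 3)"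
proof -
  have "\<bar>g v * kernel2 v\<bar> \<le> (C * (1 + \<bar>v\<bar>) powr q) * (400 * (1 + \<bar>v\<bar>) powr (-3))"
    unfolding abs_mult using assms kernel2_bound by (intro mult_mono) auto
  also have "\<dots> = C * 400 * ((1 + \<bar>v\<bar>) powr q * (1 + \<bar>v\<bar>) powr (-3))" by simp
  also have "(1 + \<bar>v\<bar>) powr q * (1 + \<bar>v\<bar>) powr (-3) = (1 + \<bar>v\<bar>) powr (q - 3)"
    by (simp flip: powr_add)
  finally show ?thesis .
qed

lemma integrable_kernel2: "integrable lborel kernel2"
  by (rule integrable_powr_boundI[OF _ _ kernel2_bound]) auto

text \<open>The antiderivative \<open>kernel1\<close> decays like \<open>1 / v ^ 3\<close> in both
  directions. This vanishing removes the contribution of \<open>autocorr 0\<close>, which would be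
  of order \<open>T\<close> in a mean of order \<open>ln T\<close>.\<close>

lemma integral_kernel2: "(LINT v|lborel. kernel2 v) = 0"
proof -
  have "(\<lambda>N. integral {- real N..real N} kernel2) \<longlonglongrightarrow> 0"
  proof (rule Lim_transform_eventually)
    have "(\<lambda>N. ((2 * c N + 4) / real N ^ 3 - 6 * s N / real N ^ 4)) \<longlonglongrightarrow> 0"
      if "\<And>N. \<bar>c N\<bar> \<le> 1" "\<And>N. \<bar>s N\<bar> \<le> 1" for c s :: "nat \<Rightarrow> real"
    proof (rule Lim_null_comparison)
      show "(\<lambda>N. 6 / real N ^ 3 + 6 / real N ^ 4) \<longlonglongrightarrow> 0" by real_asymp
      have "\<bar>(2 * c N + 4) / real N ^ 3 - 6 * s N / real N ^ 4\<bar> \<le> 6 / real N ^ 3 + 6 / real N ^ 4" for N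
      proof -
        have "\<bar>(2 * c N + 4) / real N ^ 3\<bar> \<le> 6 / real N ^ 3" "\<bar>6 * s N / real N ^ 4\<bar> \<le> 6 / real N ^ 4"
        proof -
          have "\<bar>2 * c N + 4\<bar> \<le> 6" "\<bar>6 * s N\<bar> \<le> 6" using that[of N] by linarith+
          then show "\<bar>(2 * c N + 4) / real N ^ 3\<bar> \<le> 6 / real N ^ 3" "\<bar>6 * s N / real N ^ 4\<bar> \<le> 6 / real N ^ 4"
            by (simp_all add: abs_divide divide_right_mono)
        qed
        then show ?thesis by linarith
      qed
      then show "\<forall>\<^sub>F N in sequentially. norm ((2 * c N + 4) / real N ^ 3 - 6 * s N / real N ^ 4)
          \<le> 6 / real N ^ 3 + 6 / real N ^ 4" by simp
    qed
    from this[of "\<lambda>N. cos (real N)" "\<lambda>N. sin (real N)"] this[of "\<lambda>N. cos (- real N)" "\<lambda>N. sin (- real N)"]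
    have "(\<lambda>N. 2 * ((2 * cos (real N) + 4) / real N ^ 3 - 6 * sin (real N) / real N ^ 4)) \<longlonglongrightarrow> 2 * 0"
      by (intro tendsto_intros) auto
    then show "(\<lambda>N. 2 * ((2 * cos (real N) + 4) / real N ^ 3 - 6 * sin (real N) / real N ^ 4)) \<longlonglongrightarrow> 0" by simp
    show "\<forall>\<^sub>F N in sequentially. 2 * ((2 * cos (real N) + 4) / real N ^ 3 - 6 * sin (real N) / real N ^ 4)
        = integral {- real N..real N} kernel2"
      using eventually_gt_at_top[of 0]
    proof eventually_elim
      case (elim N)
      have "integral {- real N..real N} kernel2 = kernel1 (real N) - kernel1 (- real N)"
        by (intro integral_unique has_integral_FTC_real kernel1_deriv) simp
      then show ?case using elim by (simp add: kernel1_minus kernel1_eq)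
    qed
  qed
  from LIMSEQ_unique[OF integral_symmetric_limit[OF integrable_kernel2] this] show ?thesis .
qed

lemma abs_mult_kernel2_bound: "\<bar>\<bar>v\<bar> * kernel2 v\<bar> \<le> 1 * 400 * (1 + \<bar>v\<bar>) powr (1 - 3)"
  by (rule kernel2_powr_bound) auto

lemma integrable_abs_mult_kernel2: "integrable lborel (\<lambda>v. \<bar>v\<bar> * kernel2 v)"
  by (rule integrable_powr_boundI[OF _ _ abs_mult_kernel2_bound]) auto

text \<open>\<open>Q\<close> is an antiderivative of \<open>v * kernel2 v\<close> that tends to 0 at
  infinity, and \<open>Q 0\<close> is the integral of \<open>(1 - t)\<^sup>2\<close> over
  \<open>[0, 1]\<close>; by evenness the value is \<open>- 2 * Q 0\<close>. Multiplied by
  \<open>- ln T / 2\<close> it becomes the leading term \<open>ln T / 3\<close> of the second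
  mean.\<close>

lemma integral_abs_mult_kernel2: "(LINT v|lborel. \<bar>v\<bar> * kernel2 v) = - 2 / 3"
proof -
  define Q where "Q = (\<lambda>v. v * kernel1 v + kernel0 v)"
  have Q_deriv: "(Q has_real_derivative v * kernel2 v) (at v)" for v
    unfolding Q_def by (rule derivative_eq_intros kernel0_deriv kernel1_deriv refl)+ simp
  have Q0: "Q 0 = 1/3"
  proof -
    define F where "F = (\<lambda>t. (- ((1 - t) ^ 3)) / (3::real))"
    have "(F has_real_derivative (1 - t)\<^sup>2) (at t)" for t
      unfolding F_def by (rule derivative_eq_intros refl | simp)+
    then have "((\<lambda>t. (1 - t)\<^sup>2) has_integral F 1 - F 0) {0..1}"
      by (intro has_integral_FTC_real) auto
    then show ?thesis unfolding Q_def kernel0_def F_def by (simp add: integral_unique)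
  qed
  have "(\<lambda>N. integral {- real N..real N} (\<lambda>v. \<bar>v\<bar> * kernel2 v)) \<longlonglongrightarrow> - 2 / 3"
  proof (rule Lim_transform_eventually)
    have "(\<lambda>N. 2 * Q (real N)) \<longlonglongrightarrow> 0"
    proof (rule Lim_null_comparison)
      show "(\<lambda>N. 16 / real N ^ 2 + 16 / real N ^ 3) \<longlonglongrightarrow> 0" by real_asymp
      show "\<forall>\<^sub>F N in sequentially. norm (2 * Q (real N)) \<le> 16 / real N ^ 2 + 16 / real N ^ 3"
        using eventually_gt_at_top[of 0]
      proof eventually_elim
        case (elim N)
        have "2 * Q (real N) = (4 * cos (real N) + 12) / real N ^ 2 - 16 * sin (real N) / real N ^ 3"
          unfolding Q_def using elim by (simp add: kernel0_eq kernel1_eq field_simps eval_nat_numeral)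
        moreover have "\<bar>(4 * cos (real N) + 12) / real N ^ 2\<bar> \<le> 16 / real N ^ 2"
          "\<bar>16 * sin (real N) / real N ^ 3\<bar> \<le> 16 / real N ^ 3"
        proof -
          have "\<bar>4 * cos (real N) + 12\<bar> \<le> 16" "\<bar>16 * sin (real N)\<bar> \<le> 16"
            using abs_cos_le_one[of "real N"] abs_sin_le_one[of "real N"] by linarith+
          then show "\<bar>(4 * cos (real N) + 12) / real N ^ 2\<bar> \<le> 16 / real N ^ 2"
            "\<bar>16 * sin (real N) / real N ^ 3\<bar> \<le> 16 / real N ^ 3"
            by (simp_all add: abs_divide divide_right_mono del: abs_mult)
        qed
        ultimately show ?case by (simp; linarith)
      qed
    qed
    then have "(\<lambda>N. 2 * Q (real N) - 2 / 3) \<longlonglongrightarrow> 0 - 2 / 3" by (intro tendsto_intros)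
    then show "(\<lambda>N. 2 * Q (real N) - 2 / 3) \<longlonglongrightarrow> - 2 / 3" by simp
    show "\<forall>\<^sub>F N in sequentially. 2 * Q (real N) - 2 / 3
        = integral {- real N..real N} (\<lambda>v. \<bar>v\<bar> * kernel2 v)"
      using eventually_gt_at_top[of 0]
    proof eventually_elim
      case (elim N)
      have "((\<lambda>v. v * kernel2 v) has_integral Q (real N) - Q 0) {0..real N}"
        by (intro has_integral_FTC_real Q_deriv) simp
      then have 1: "((\<lambda>v. \<bar>v\<bar> * kernel2 v) has_integral Q (real N) - Q 0) {0..real N}"
        by (rule has_integral_eq[rotated]) auto
      have "((\<lambda>v. v * kernel2 v) has_integral Q 0 - Q (- real N)) {- real N..0}"
        by (intro has_integral_FTC_real Q_deriv) simp
      then have "((\<lambda>v. - (v * kernel2 v)) has_integral - (Q 0 - Q (- real N))) {- real N..0}"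
        by (rule has_integral_neg)
      then have 2: "((\<lambda>v. \<bar>v\<bar> * kernel2 v) has_integral - (Q 0 - Q (- real N))) {- real N..0}"
        by (rule has_integral_eq[rotated]) auto
      have "Q (- real N) = Q (real N)"
        by (simp add: Q_def kernel0_minus kernel1_minus)
      then show ?case
        using integral_unique[OF has_integral_combine[OF _ _ 2 1]] Q0 by simp
    qed
  qed
  from LIMSEQ_unique[OF integral_symmetric_limit[OF integrable_abs_mult_kernel2] this] show ?thesis .
qed

section \<open>The mean square of the zeta function on the critical line\<close>

lemma abs_ln_mult_le_powr: "\<bar>\<bar>v\<bar> * ln \<bar>v\<bar>\<bar> \<le> 6 * (1 + \<bar>v\<bar>) powr (4/3)" for v :: real
proof (cases "v = 0")
  case False
  define u where "u = \<bar>v\<bar>"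
  have u: "0 < u" using False by (simp add: u_def)
  have m: "u powr s \<le> (1 + u) powr (4/3)" if "0 \<le> s" "s \<le> 4/3" for s
  proof -
    have "u powr s \<le> (1 + u) powr s" using u that by (intro powr_mono2) auto
    also have "\<dots> \<le> (1 + u) powr (4/3)" using u that by (intro powr_mono) auto
    finally show ?thesis .
  qed
  have "u * \<bar>ln u\<bar> \<le> u * (3 * (u powr (1/3) + u powr (- 1/3)))"
    using u abs_ln_le_powr[OF u] by (intro mult_left_mono) auto
  also have "\<dots> = 3 * (u powr (4/3) + u powr (2/3))"
    using u powr_add[of u 1 "1/3"] powr_add[of u 1 "- 1/3"] by (simp add: algebra_simps)
  also have "\<dots> \<le> 6 * (1 + u) powr (4/3)" using m[of "4/3"] m[of "2/3"] by simp
  finally show ?thesis using u by (simp add: u_def abs_mult)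
qed simp

text \<open>After \<open>v = T * u\<close> the \<open>kernel2\<close> term carries the factor
  \<open>T\<^sup>2 / T = T\<close>, by which the expansion of the autocorrelation at
  \<open>v / T\<close> is multiplied. The constant integrates to 0, the logarithmic term splits off
  \<open>- ln T / 2\<close> times the integral of \<open>|v| * kernel2 v\<close>, and the remainder
  \<open>T * (|v| / T) powr (4/3)\<close> is of order \<open>T powr (-1/3)\<close>. The
  \<open>kernel0\<close> term is of order \<open>1 / T\<close>.\<close>

lemma cesaro_zeta_norm2_asymp:
  obtains b C where
    "\<And>T. 1 \<le> T \<Longrightarrow> \<bar>integral {0..1} (\<lambda>t. (1 - t)\<^sup>2 * zeta_norm2 (T * t)) - (ln T / 3 + b)\<bar> \<le> C * T powr (- 1/3)"
proof -
  obtain B C where C: "0 \<le> C"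
    and asy: "\<And>u. \<bar>autocorr u - (autocorr 0 + \<bar>u\<bar> * ln \<bar>u\<bar> / 2 + B * \<bar>u\<bar>)\<bar> \<le> C * \<bar>u\<bar> powr (4/3)"
    using autocorr_asymp by blast
  define J where "J = (LINT x|lborel. frac_wave x)"
  define rho where "rho = (\<lambda>u. autocorr u - (autocorr 0 + \<bar>u\<bar> * ln \<bar>u\<bar> / 2 + B * \<bar>u\<bar>))"
  have [measurable]: "rho \<in> borel_measurable borel" unfolding rho_def by measurable
  define L1 where "L1 = (\<lambda>v. \<bar>v\<bar> * ln \<bar>v\<bar> * kernel2 v)"
  define P where "P = (\<lambda>v. \<bar>v\<bar> powr (4/3) * \<bar>kernel2 v\<bar>)"
  have L1_int: "integrable lborel L1"
  proof (rule integrable_powr_boundI)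
    show "\<bar>L1 v\<bar> \<le> 6 * 400 * (1 + \<bar>v\<bar>) powr (4/3 - 3)" for v
      unfolding L1_def by (rule kernel2_powr_bound[OF abs_ln_mult_le_powr]) simp
  qed (auto simp: L1_def)
  have P_int: "integrable lborel P"
  proof -
    have "\<bar>\<bar>v\<bar> powr (4/3)\<bar> \<le> 1 * (1 + \<bar>v\<bar>) powr (4/3)" for v :: real
      by (auto intro!: powr_mono2)
    from kernel2_powr_bound[where g = "\<lambda>v. \<bar>v\<bar> powr (4/3)", OF this]
    have "\<bar>P v\<bar> \<le> 1 * 400 * (1 + \<bar>v\<bar>) powr (4/3 - 3)" for v
      by (simp add: P_def abs_mult)
    then show ?thesis by (rule integrable_powr_boundI[rotated 2]) (auto simp: P_def)
  qed
  have K_int: "integrable lborel (\<lambda>v. \<bar>kernel0 v\<bar>)"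
    by (rule integrable_powr_boundI[where C = 16 and p = "-2"]) (use kernel0_bound in auto)
  have J: "0 \<le> autocorr u" "autocorr u \<le> J" for u
    using autocorr_nonneg autocorr_le by (auto simp: J_def)
  have J0: "0 \<le> J" using J order_trans by blast
  define b where "b = (LINT v|lborel. L1 v) / 2 - 2 / 3 * B"
  define D where "D = C * (LINT v|lborel. P v) + J * (LINT v|lborel. \<bar>kernel0 v\<bar>)"
  have "\<bar>integral {0..1} (\<lambda>t. (1 - t)\<^sup>2 * zeta_norm2 (T * t)) - (ln T / 3 + b)\<bar> \<le> D * T powr (- 1/3)"
    if T: "1 \<le> T" for T
  proof -
    have AK_int: "integrable lborel (\<lambda>v. autocorr (v / T) * kernel0 v)"
      by (rule Bochner_Integration.integrable_bound[OF integrable_mult_right[OF K_int, of J]])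
         (use J J0 in \<open>auto simp: abs_mult intro!: mult_right_mono\<close>)
    have rho_bound: "\<bar>T * (rho (v / T) * kernel2 v)\<bar> \<le> C * T powr (- 1/3) * P v" for v
    proof -
      have "\<bar>T * (rho (v / T) * kernel2 v)\<bar> \<le> T * ((C * \<bar>v / T\<bar> powr (4/3)) * \<bar>kernel2 v\<bar>)"
        unfolding abs_mult rho_def using T asy[of "v / T"] by (intro mult_mono) auto
      also have "\<bar>v / T\<bar> powr (4/3) = \<bar>v\<bar> powr (4/3) * T powr (- 4/3)"
        using T by (simp add: abs_divide powr_divide powr_minus_divide)
      also have "T * ((C * (\<bar>v\<bar> powr (4/3) * T powr (- 4/3))) * \<bar>kernel2 v\<bar>) = C * (T powr 1 * T powr (- 4/3)) * P v"
        using T by (simp add: P_def)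
      also have "T powr 1 * T powr (- 4/3) = T powr (- 1/3)"
        using powr_add[of T 1 "- 4 / 3"] by simp
      finally show ?thesis .
    qed
    have rho_int: "integrable lborel (\<lambda>v. T * (rho (v / T) * kernel2 v))"
      by (rule Bochner_Integration.integrable_bound[OF integrable_mult_right[OF P_int, of "C * T powr (- 1/3)"]])
         (use rho_bound C in \<open>auto simp: P_def abs_mult\<close>)
    have main_eq: "T * (autocorr (v / T) * kernel2 v) = T * autocorr 0 * kernel2 v + L1 v / 2
         + (B - ln T / 2) * (\<bar>v\<bar> * kernel2 v) + T * (rho (v / T) * kernel2 v)" for v
    proof (cases "v = 0")
      case False
      have "ln \<bar>v / T\<bar> = ln \<bar>v\<bar> - ln T" using False T by (simp add: abs_divide ln_div)
      then have "autocorr (v / T) = autocorr 0 + \<bar>v\<bar> / T * (ln \<bar>v\<bar> - ln T) / 2 + B * (\<bar>v\<bar> / T) + rho (v / T)"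
        using T by (simp add: rho_def abs_divide)
      then have "T * autocorr (v / T) = T * autocorr 0 + \<bar>v\<bar> * ln \<bar>v\<bar> / 2
          + (B - ln T / 2) * \<bar>v\<bar> + T * rho (v / T)"
        using T by (simp add: field_simps)
      then have "T * autocorr (v / T) * kernel2 v = (T * autocorr 0 + \<bar>v\<bar> * ln \<bar>v\<bar> / 2
          + (B - ln T / 2) * \<bar>v\<bar> + T * rho (v / T)) * kernel2 v" by (rule arg_cong)
      then show ?thesis by (simp add: L1_def distrib_right mult.assoc)
    qed (simp add: L1_def rho_def)
    have M_int: "integrable lborel (\<lambda>v. T * (autocorr (v / T) * kernel2 v))"
      unfolding main_eq
      using L1_int rho_int integrable_kernel2 integrable_abs_mult_kernel2
      by (intro Bochner_Integration.integrable_add integrable_mult_right integrable_divide) auto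
    have "(LINT v|lborel. T * (autocorr (v / T) * kernel2 v))
        = T * autocorr 0 * (LINT v|lborel. kernel2 v) + (LINT v|lborel. L1 v) / 2
          + (B - ln T / 2) * (LINT v|lborel. \<bar>v\<bar> * kernel2 v) + (LINT v|lborel. T * (rho (v / T) * kernel2 v))"
      unfolding main_eq
      using L1_int rho_int integrable_kernel2 integrable_abs_mult_kernel2
      by (subst Bochner_Integration.integral_add Bochner_Integration.integral_add Bochner_Integration.integral_add;
          simp)
    then have M_val: "(LINT v|lborel. T * (autocorr (v / T) * kernel2 v))
        = ln T / 3 + b + (LINT v|lborel. T * (rho (v / T) * kernel2 v))"
      unfolding integral_kernel2 integral_abs_mult_kernel2 b_def by (simp add: field_simps)
    have "norm (LINT v|lborel. T * (rho (v / T) * kernel2 v)) \<le> (LINT v|lborel. C * T powr (- 1/3) * P v)"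
      by (rule Bochner_Integration.integral_norm_bound_integral[OF rho_int integrable_mult_right[OF P_int]])
         (use rho_bound in auto)
    then have E1: "\<bar>LINT v|lborel. T * (rho (v / T) * kernel2 v)\<bar> \<le> C * T powr (- 1/3) * (LINT v|lborel. P v)" by simp
    have "norm (LINT v|lborel. autocorr (v / T) * kernel0 v) \<le> (LINT v|lborel. J * \<bar>kernel0 v\<bar>)"
      by (rule Bochner_Integration.integral_norm_bound_integral[OF AK_int integrable_mult_right[OF K_int]])
         (use J in \<open>auto simp: abs_mult intro!: mult_right_mono\<close>)
    then have E2: "\<bar>LINT v|lborel. autocorr (v / T) * kernel0 v\<bar> \<le> J * (LINT v|lborel. \<bar>kernel0 v\<bar>)" by simp
    have "integral {0..1} (\<lambda>t. (1 - t)\<^sup>2 * zeta_norm2 (T * t))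
        = \<bar>1 / T\<bar> *\<^sub>R (LINT v|lborel. autocorr (0 + 1 / T * v)
             * (1/4 * kernel0 (T * (0 + 1 / T * v)) + T\<^sup>2 * kernel2 (T * (0 + 1 / T * v))))"
      unfolding integral_zeta_norm2_eq_kernels by (rule lborel_integral_real_affine) (use T in auto)
    also have "\<dots> = (LINT v|lborel. 1 / T * (autocorr (v / T) * (1/4 * kernel0 v + T\<^sup>2 * kernel2 v)))"
      using T by simp
    also have "\<dots> = (LINT v|lborel. 1 / (4 * T) * (autocorr (v / T) * kernel0 v) + T * (autocorr (v / T) * kernel2 v))"
      by (rule Bochner_Integration.integral_cong) (use T in \<open>auto simp: field_simps power2_eq_square\<close>)
    also have "\<dots> = 1 / (4 * T) * (LINT v|lborel. autocorr (v / T) * kernel0 v)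
        + (LINT v|lborel. T * (autocorr (v / T) * kernel2 v))"
      using AK_int M_int
      by (subst Bochner_Integration.integral_add) (auto simp del: times_divide_eq_left)
    finally have val: "integral {0..1} (\<lambda>t. (1 - t)\<^sup>2 * zeta_norm2 (T * t)) - (ln T / 3 + b)
        = 1 / (4 * T) * (LINT v|lborel. autocorr (v / T) * kernel0 v) + (LINT v|lborel. T * (rho (v / T) * kernel2 v))"
      unfolding M_val by simp
    have E3: "\<bar>1 / (4 * T) * (LINT v|lborel. autocorr (v / T) * kernel0 v)\<bar>
        \<le> T powr (- 1/3) * (J * (LINT v|lborel. \<bar>kernel0 v\<bar>))"
      unfolding abs_mult
    proof (rule mult_mono[OF _ E2])
      have "1 / (4 * T) \<le> T powr (-1)" using T by (simp add: powr_minus divide_simps)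
      also have "\<dots> \<le> T powr (- 1/3)" using T by (intro powr_mono) auto
      finally show "\<bar>1 / (4 * T)\<bar> \<le> T powr (- 1/3)" using T by simp
    qed auto
    have "D * T powr (- 1/3) = T powr (- 1/3) * (J * (LINT v|lborel. \<bar>kernel0 v\<bar>))
        + C * T powr (- 1/3) * (LINT v|lborel. P v)"
      by (simp add: D_def algebra_simps)
    then show ?thesis using E1 E3 unfolding val by linarith
  qed
  then show thesis by (rule that)
qed

text \<open>For increasing \<open>f = F'\<close> the mean value theorem puts \<open>f x\<close>
  between the difference quotients of \<open>F\<close> over \<open>[x - h, x]\<close> and
  \<open>[x, x + h]\<close>. Replacing \<open>F\<close> by \<open>\<Phi>\<close> costs errors of
  size \<open>g / h\<close>, replacing the quotients of \<open>\<Phi>\<close> by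
  \<open>\<phi>\<close> costs a Taylor error growing with \<open>h\<close>; a good \<open>h\<close>
  balances the two.\<close>

lemma tauber_difference_step:
  fixes f F \<Phi> \<phi> h g k :: "real \<Rightarrow> real"
  assumes mono: "\<And>x y. 0 < x \<Longrightarrow> x \<le> y \<Longrightarrow> f x \<le> f y"
    and deriv: "\<And>x. 0 < x \<Longrightarrow> (F has_real_derivative f x) (at x)"
    and err: "(\<lambda>x. F x - \<Phi> x) \<in> O(g)"
    and h: "eventually (\<lambda>x. 0 < h x) at_top" "filterlim (\<lambda>x. x - h x) at_top at_top" "filterlim (\<lambda>x. x + h x) at_top at_top"
    and main: "(\<lambda>x. (\<Phi> (x + h x) - \<Phi> x) / h x - \<phi> x) \<in> O(k)" "(\<lambda>x. (\<Phi> x - \<Phi> (x - h x)) / h x - \<phi> x) \<in> O(k)"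
    and gk: "(\<lambda>x. g (x + h x) / h x) \<in> O(k)" "(\<lambda>x. g x / h x) \<in> O(k)" "(\<lambda>x. g (x - h x) / h x) \<in> O(k)"
  shows "(\<lambda>x. f x - \<phi> x) \<in> O(k)"
proof -
  define E where "E = (\<lambda>x. F x - \<Phi> x)"
  have E: "(\<lambda>x. E (x + h x) / h x) \<in> O(k)" "(\<lambda>x. E x / h x) \<in> O(k)" "(\<lambda>x. E (x - h x) / h x) \<in> O(k)"
  proof -
    have *: "(\<lambda>x. E (q x) / h x) \<in> O(\<lambda>x. g (q x) / h x)" if "filterlim q at_top at_top" for q
      using landau_o.big.compose[OF err that] unfolding E_def
      by (intro landau_o.big.divide_right eventually_mono[OF h(1)]) auto
    show "(\<lambda>x. E (x + h x) / h x) \<in> O(k)" "(\<lambda>x. E x / h x) \<in> O(k)" "(\<lambda>x. E (x - h x) / h x) \<in> O(k)"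
      using landau_o.big_trans[OF *[OF h(3)] gk(1)] landau_o.big_trans[OF *[OF filterlim_ident] gk(2)]
        landau_o.big_trans[OF *[OF h(2)] gk(3)] by auto
  qed
  define U where "U = (\<lambda>x. (E (x + h x) / h x - E x / h x) + ((\<Phi> (x + h x) - \<Phi> x) / h x - \<phi> x))"
  define L where "L = (\<lambda>x. (E x / h x - E (x - h x) / h x) + ((\<Phi> x - \<Phi> (x - h x)) / h x - \<phi> x))"
  have UL: "U \<in> O(k)" "L \<in> O(k)"
    unfolding U_def L_def by (intro sum_in_bigo E main)+
  have "(\<lambda>x. f x - \<phi> x) \<in> O(\<lambda>x. \<bar>U x\<bar> + \<bar>L x\<bar>)"
  proof (rule bigoI[of _ 1])
    have "eventually (\<lambda>x. 0 < x - h x) at_top"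
      using h(2) unfolding filterlim_at_top_dense by blast
    then show "\<forall>\<^sub>F x in at_top. norm (f x - \<phi> x) \<le> 1 * norm (\<bar>U x\<bar> + \<bar>L x\<bar>)"
      using h(1)
    proof eventually_elim
      case (elim x)
      have "f x * h x \<le> F (x + h x) - F x"
      proof -
        obtain z where z: "x < z" "z < x + h x" "F (x + h x) - F x = (x + h x - x) * f z"
          using MVT2[of x "x + h x" F f] deriv elim by auto
        then show ?thesis using mono[of x z] elim by (simp add: mult.commute mult_left_mono)
      qed
      then have 1: "f x - \<phi> x \<le> U x"
        using elim by (simp add: U_def E_def pos_le_divide_eq[symmetric] diff_divide_distrib add_divide_distrib)
      have "F x - F (x - h x) \<le> f x * h x"
      proof -
        obtain z where z: "x - h x < z" "z < x" "F x - F (x - h x) = (x - (x - h x)) * f z"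
          using MVT2[of "x - h x" x F f] deriv elim by auto
        then show ?thesis using mono[of z x] elim by (simp add: mult.commute mult_left_mono)
      qed
      then have 2: "L x \<le> f x - \<phi> x"
        using elim by (simp add: L_def E_def pos_divide_le_eq[symmetric] diff_divide_distrib add_divide_distrib)
      from 1 2 show ?case by auto
    qed
  qed
  also have "(\<lambda>x. \<bar>U x\<bar> + \<bar>L x\<bar>) \<in> O(k)"
    using UL by (intro sum_in_bigo) auto
  finally show ?thesis .
qed

section \<open>The iterated integrals of the mean square and their differencing\<close>

lemma has_real_derivative_integral_from_0:
  fixes q :: "real \<Rightarrow> real"
  assumes "continuous_on UNIV q" "0 < x"
  shows "((\<lambda>T. integral {0..T} q) has_real_derivative q x) (at x)"
proof -
  have "((\<lambda>T. integral {0..T} q) has_real_derivative q x) (at x within {0..x + 1})"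
    by (rule integral_has_real_derivative) (use assms in \<open>auto intro: continuous_on_subset\<close>)
  then show ?thesis
    using assms by (simp add: at_within_interior[of x "{0..x+1}"])
qed

lemma zeta_mean_square_eq: "zeta_mean_square T = integral {0..T} zeta_norm2"
  by (simp add: zeta_mean_square_def zeta_norm2_def[abs_def])

definition zeta_cesaro :: "nat \<Rightarrow> real \<Rightarrow> real" where
  "zeta_cesaro k T = integral {0..T} (\<lambda>t. (T - t) ^ k * zeta_norm2 t)"

lemma integrable_zeta_norm2_mult:
  assumes "continuous_on UNIV q"
  shows "(\<lambda>t. q t * zeta_norm2 t) integrable_on {a..b}"
  using assms by (intro integrable_continuous_interval continuous_intros continuous_on_zeta_norm2)
     (auto intro: continuous_on_subset)

lemma zeta_cesaro_1_eq:
  "zeta_cesaro 1 T = T * integral {0..T} zeta_norm2 - integral {0..T} (\<lambda>t. t * zeta_norm2 t)"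
proof -
  have "zeta_cesaro 1 T = integral {0..T} (\<lambda>t. T * zeta_norm2 t - t * zeta_norm2 t)"
    by (simp add: zeta_cesaro_def left_diff_distrib)
  also have "\<dots> = integral {0..T} (\<lambda>t. T * zeta_norm2 t) - integral {0..T} (\<lambda>t. t * zeta_norm2 t)"
    by (intro integral_diff integrable_zeta_norm2_mult continuous_intros)
  finally show ?thesis by simp
qed

lemma zeta_cesaro_1_deriv:
  assumes "0 < x"
  shows "(zeta_cesaro 1 has_real_derivative zeta_mean_square x) (at x)"
proof -
  have "zeta_cesaro 1 = (\<lambda>T. T * integral {0..T} zeta_norm2 - integral {0..T} (\<lambda>t. t * zeta_norm2 t))"
    using zeta_cesaro_1_eq by auto
  then show ?thesis
    unfolding zeta_mean_square_eq using assms
    by (auto intro!: derivative_eq_intros has_real_derivative_integral_from_0 continuous_intros continuous_on_zeta_norm2)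
qed

lemma zeta_cesaro_2_deriv:
  assumes "0 < x"
  shows "(zeta_cesaro 2 has_real_derivative 2 * zeta_cesaro 1 x) (at x)"
proof -
  have e2: "zeta_cesaro 2 T = T\<^sup>2 * integral {0..T} zeta_norm2 - 2 * T * integral {0..T} (\<lambda>t. t * zeta_norm2 t)
      + integral {0..T} (\<lambda>t. t\<^sup>2 * zeta_norm2 t)" for T
  proof -
    have "zeta_cesaro 2 T = integral {0..T} (\<lambda>t. (T\<^sup>2 * zeta_norm2 t - 2 * T * (t * zeta_norm2 t)) + t\<^sup>2 * zeta_norm2 t)"
      by (simp add: zeta_cesaro_def power2_diff algebra_simps)
    also have "\<dots> = integral {0..T} (\<lambda>t. T\<^sup>2 * zeta_norm2 t - 2 * T * (t * zeta_norm2 t)) + integral {0..T} (\<lambda>t. t\<^sup>2 * zeta_norm2 t)"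
      by (intro integral_add integrable_diff integrable_on_mult_right integrable_zeta_norm2_mult continuous_intros)
    also have "integral {0..T} (\<lambda>t. T\<^sup>2 * zeta_norm2 t - 2 * T * (t * zeta_norm2 t))
        = integral {0..T} (\<lambda>t. T\<^sup>2 * zeta_norm2 t) - integral {0..T} (\<lambda>t. 2 * T * (t * zeta_norm2 t))"
      by (intro integral_diff integrable_on_mult_right integrable_zeta_norm2_mult continuous_intros)
    finally show ?thesis by simp
  qed
  have "zeta_cesaro 2 = (\<lambda>T. T\<^sup>2 * integral {0..T} zeta_norm2 - 2 * T * integral {0..T} (\<lambda>t. t * zeta_norm2 t)
      + integral {0..T} (\<lambda>t. t\<^sup>2 * zeta_norm2 t))" using e2 by auto
  moreover have "((\<lambda>T. T\<^sup>2 * integral {0..T} zeta_norm2 - 2 * T * integral {0..T} (\<lambda>t. t * zeta_norm2 t)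
      + integral {0..T} (\<lambda>t. t\<^sup>2 * zeta_norm2 t)) has_real_derivative 2 * zeta_cesaro 1 x) (at x)"
    unfolding zeta_cesaro_1_eq using assms
    by (auto intro!: derivative_eq_intros has_real_derivative_integral_from_0 continuous_intros continuous_on_zeta_norm2
        simp: algebra_simps power2_eq_square)
  ultimately show ?thesis by simp
qed

lemma zeta_mean_square_mono: "x \<le> y \<Longrightarrow> zeta_mean_square x \<le> zeta_mean_square y"
  unfolding zeta_mean_square_eq
  by (rule integral_subset_le)
     (auto intro!: integrable_continuous_interval continuous_on_zeta_norm2 simp: zeta_norm2_nonneg)

lemma zeta_mean_square_nonneg: "0 \<le> zeta_mean_square x"
  unfolding zeta_mean_square_eq
  by (auto intro!: integral_nonneg integrable_continuous_interval continuous_on_zeta_norm2 simp: zeta_norm2_nonneg)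

lemma zeta_cesaro_2_asymp:
  obtains b where "(\<lambda>T. zeta_cesaro 2 T - T ^ 3 * (ln T / 3 + b)) \<in> O(\<lambda>T. T powr (8/3))"
proof -
  obtain b C where bC: "\<And>T. 1 \<le> T \<Longrightarrow>
      \<bar>integral {0..1} (\<lambda>t. (1 - t)\<^sup>2 * zeta_norm2 (T * t)) - (ln T / 3 + b)\<bar> \<le> C * T powr (- 1/3)"
    using cesaro_zeta_norm2_asymp by blast
  have "(\<lambda>T. zeta_cesaro 2 T - T ^ 3 * (ln T / 3 + b)) \<in> O(\<lambda>T. T powr (8/3))"
  proof (rule bigoI[of _ C])
    show "\<forall>\<^sub>F T in at_top. norm (zeta_cesaro 2 T - T ^ 3 * (ln T / 3 + b)) \<le> C * norm (T powr (8/3))"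
      using eventually_ge_at_top[of 1]
    proof eventually_elim
      case (elim T)
      define G where "G = (\<lambda>t. (T - t)\<^sup>2 * zeta_norm2 t)"
      have "(G has_integral zeta_cesaro 2 T) (cbox 0 T)"
        unfolding G_def zeta_cesaro_def
        by (simp only: cbox_interval, intro integrable_integral integrable_zeta_norm2_mult continuous_intros)
      then have "((\<lambda>t. G (T *\<^sub>R t + 0)) has_integral (zeta_cesaro 2 T /\<^sub>R T ^ DIM(real))) (cbox ((0 - 0) /\<^sub>R T) ((T - 0) /\<^sub>R T))"
        using elim by (intro has_integral_affinity') auto
      then have "((\<lambda>t. G (T * t)) has_integral (zeta_cesaro 2 T / T)) {0..1}"
        using elim by (simp add: divide_inverse mult.commute)
      then have "((\<lambda>t. 1 / T\<^sup>2 * G (T * t)) has_integral (1 / T\<^sup>2 * (zeta_cesaro 2 T / T))) {0..1}"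
        by (rule has_integral_mult_right)
      moreover have "1 / T\<^sup>2 * G (T * t) = (1 - t)\<^sup>2 * zeta_norm2 (T * t)" for t
      proof -
        have "(T - T * t)\<^sup>2 = T\<^sup>2 * (1 - t)\<^sup>2" by (simp add: power2_eq_square algebra_simps)
        then show ?thesis using elim by (simp add: G_def)
      qed
      ultimately have "integral {0..1} (\<lambda>t. (1 - t)\<^sup>2 * zeta_norm2 (T * t)) = 1 / T\<^sup>2 * (zeta_cesaro 2 T / T)"
        by (simp add: integral_unique)
      then have "zeta_cesaro 2 T = T ^ 3 * integral {0..1} (\<lambda>t. (1 - t)\<^sup>2 * zeta_norm2 (T * t))"
        using elim by (simp add: field_simps eval_nat_numeral)
      then have "\<bar>zeta_cesaro 2 T - T ^ 3 * (ln T / 3 + b)\<bar>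
          = T ^ 3 * \<bar>integral {0..1} (\<lambda>t. (1 - t)\<^sup>2 * zeta_norm2 (T * t)) - (ln T / 3 + b)\<bar>"
        using elim by (simp add: abs_mult flip: right_diff_distrib)
      also have "\<dots> \<le> T ^ 3 * (C * T powr (- 1/3))"
        using elim by (intro mult_left_mono bC) auto
      also have "\<dots> = C * T powr (8/3)"
        using elim powr_add[of T 3 "- 1/3"] by (simp add: powr_numeral)
      finally show ?case by simp
    qed
  qed
  then show thesis by (rule that)
qed

lemma bigo_cmult: "f \<in> O[F](g) \<Longrightarrow> (\<lambda>x. c * f x) \<in> O[F](g)" for c :: real
  by (cases "c = 0") auto

lemma zeta_cesaro_1_asymp:
  obtains b where "(\<lambda>T. zeta_cesaro 1 T - T ^ 2 * (ln T / 2 + b)) \<in> O(\<lambda>T. T powr 1.9)"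
proof -
  obtain b where b: "(\<lambda>T. zeta_cesaro 2 T - T ^ 3 * (ln T / 3 + b)) \<in> O(\<lambda>T. T powr (8/3))"
    using zeta_cesaro_2_asymp by blast
  have mono: "2 * zeta_cesaro 1 x \<le> 2 * zeta_cesaro 1 y" if "0 < x" "x \<le> y" for x y
  proof -
    have "zeta_cesaro 1 x \<le> zeta_cesaro 1 y"
    proof (rule DERIV_nonneg_imp_nondecreasing[OF that(2)])
      fix z assume "x \<le> z" "z \<le> y"
      then show "\<exists>D. (zeta_cesaro 1 has_real_derivative D) (at z) \<and> 0 \<le> D"
        using zeta_cesaro_1_deriv[of z] zeta_mean_square_nonneg that by auto
    qed
    then show ?thesis by simp
  qed
  have m: "(\<lambda>x::real. ((x + x powr (5/6)) ^ 3 * ln (x + x powr (5/6)) - x ^ 3 * ln x) / x powr (5/6) - x ^ 2 * (3 * ln x + 1)) \<in> O(\<lambda>x. x powr 1.9)"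
    "(\<lambda>x::real. (x ^ 3 * ln x - (x - x powr (5/6)) ^ 3 * ln (x - x powr (5/6))) / x powr (5/6) - x ^ 2 * (3 * ln x + 1)) \<in> O(\<lambda>x. x powr 1.9)"
    "(\<lambda>x::real. ((x + x powr (5/6)) ^ 3 - x ^ 3) / x powr (5/6) - 3 * x ^ 2) \<in> O(\<lambda>x. x powr 1.9)"
    "(\<lambda>x::real. (x ^ 3 - (x - x powr (5/6)) ^ 3) / x powr (5/6) - 3 * x ^ 2) \<in> O(\<lambda>x. x powr 1.9)"
    by real_asymp+
  have "(\<lambda>x. 2 * zeta_cesaro 1 x - (1/3 * (x ^ 2 * (3 * ln x + 1)) + b * (3 * x ^ 2))) \<in> O(\<lambda>x. x powr 1.9)"
  \<comment> \<open>\<open>8/3 - 5/6 = 11/6\<close> is also the exponent of the Taylor error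
    \<open>x * h\<close>, up to a logarithm; 1.9 lies above it.\<close>
  proof (rule tauber_difference_step[OF mono zeta_cesaro_2_deriv b, where h = "\<lambda>x. x powr (5/6)"])
    show "(\<lambda>x. ((x + x powr (5/6)) ^ 3 * (ln (x + x powr (5/6)) / 3 + b) - x ^ 3 * (ln x / 3 + b)) / x powr (5/6)
        - (1/3 * (x ^ 2 * (3 * ln x + 1)) + b * (3 * x ^ 2))) \<in> O(\<lambda>x. x powr 1.9)"
      using sum_in_bigo(1)[OF bigo_cmult[OF m(1), of "1/3"] bigo_cmult[OF m(3), of b]]
      by (simp add: algebra_simps add_divide_distrib diff_divide_distrib)
    show "(\<lambda>x. (x ^ 3 * (ln x / 3 + b) - (x - x powr (5/6)) ^ 3 * (ln (x - x powr (5/6)) / 3 + b)) / x powr (5/6)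
        - (1/3 * (x ^ 2 * (3 * ln x + 1)) + b * (3 * x ^ 2))) \<in> O(\<lambda>x. x powr 1.9)"
      using sum_in_bigo(1)[OF bigo_cmult[OF m(2), of "1/3"] bigo_cmult[OF m(4), of b]]
      by (simp add: algebra_simps add_divide_distrib diff_divide_distrib)
  qed (auto, real_asymp+)
  then have "(\<lambda>x. 1/2 * (2 * zeta_cesaro 1 x - (1/3 * (x ^ 2 * (3 * ln x + 1)) + b * (3 * x ^ 2)))) \<in> O(\<lambda>x. x powr 1.9)"
    by simp
  then have "(\<lambda>T. zeta_cesaro 1 T - T ^ 2 * (ln T / 2 + (1/6 + 3/2 * b))) \<in> O(\<lambda>T. T powr 1.9)"
    by (simp add: algebra_simps)
  then show thesis by (rule that)
qed

theorem zeta_mean_square_asymp: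
  obtains A where "(\<lambda>T. zeta_mean_square T - (T * ln T + A * T)) \<in> o(\<lambda>T. T)"
proof -
  obtain b where b: "(\<lambda>T. zeta_cesaro 1 T - T ^ 2 * (ln T / 2 + b)) \<in> O(\<lambda>T. T powr 1.9)"
    using zeta_cesaro_1_asymp by blast
  have m: "(\<lambda>x::real. ((x + x powr 0.95) ^ 2 * ln (x + x powr 0.95) - x ^ 2 * ln x) / x powr 0.95 - x * (2 * ln x + 1)) \<in> O(\<lambda>x. x powr 0.96)"
    "(\<lambda>x::real. (x ^ 2 * ln x - (x - x powr 0.95) ^ 2 * ln (x - x powr 0.95)) / x powr 0.95 - x * (2 * ln x + 1)) \<in> O(\<lambda>x. x powr 0.96)"
    "(\<lambda>x::real. ((x + x powr 0.95) ^ 2 - x ^ 2) / x powr 0.95 - 2 * x) \<in> O(\<lambda>x. x powr 0.96)"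
    "(\<lambda>x::real. (x ^ 2 - (x - x powr 0.95) ^ 2) / x powr 0.95 - 2 * x) \<in> O(\<lambda>x. x powr 0.96)"
    by real_asymp+
  have "(\<lambda>x. zeta_mean_square x - (1/2 * (x * (2 * ln x + 1)) + b * (2 * x))) \<in> O(\<lambda>x. x powr 0.96)"
  \<comment> \<open>\<open>1.9 - 0.95 = 0.95\<close> is also the exponent of the Taylor error
    \<open>h\<close>, up to a logarithm, which 0.96 absorbs.\<close>
  proof (rule tauber_difference_step[OF zeta_mean_square_mono zeta_cesaro_1_deriv b, where h = "\<lambda>x. x powr 0.95"])
    show "(\<lambda>x. ((x + x powr 0.95) ^ 2 * (ln (x + x powr 0.95) / 2 + b) - x ^ 2 * (ln x / 2 + b)) / x powr 0.95
        - (1/2 * (x * (2 * ln x + 1)) + b * (2 * x))) \<in> O(\<lambda>x. x powr 0.96)"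
      using sum_in_bigo(1)[OF bigo_cmult[OF m(1), of "1/2"] bigo_cmult[OF m(3), of b]]
      by (simp add: algebra_simps add_divide_distrib diff_divide_distrib)
    show "(\<lambda>x. (x ^ 2 * (ln x / 2 + b) - (x - x powr 0.95) ^ 2 * (ln (x - x powr 0.95) / 2 + b)) / x powr 0.95
        - (1/2 * (x * (2 * ln x + 1)) + b * (2 * x))) \<in> O(\<lambda>x. x powr 0.96)"
      using sum_in_bigo(1)[OF bigo_cmult[OF m(2), of "1/2"] bigo_cmult[OF m(4), of b]]
      by (simp add: algebra_simps add_divide_distrib diff_divide_distrib)
  qed (auto, real_asymp+)
  then have "(\<lambda>T. zeta_mean_square T - (T * ln T + (1/2 + 2 * b) * T)) \<in> O(\<lambda>x. x powr 0.96)"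
    by (simp add: algebra_simps)
  also have "(\<lambda>x::real. x powr 0.96) \<in> o(\<lambda>x. x)" by real_asymp
  finally show thesis by (rule that)
qed

section \<open>The Laplace mean of the zeta function\<close>

lemma integrable_powr_exp_neg:
  assumes "0 \<le> p"
  shows "set_integrable lborel {0..} (\<lambda>t::real. t powr p / exp t)"
proof -
  have "(\<lambda>t::real. t powr p / exp t) absolutely_integrable_on {0..}"
    using Gamma_integral_real[of "p + 1"] assms
    by (intro nonnegative_absolutely_integrable_1) (auto simp: integrable_on_def)
  then show ?thesis
    unfolding set_integrable_def by (subst (asm) integrable_completion) auto
qed

lemma set_lebesgue_integral_powr_exp_neg:
  fixes p :: real
  assumes "0 \<le> p"
  shows "(LINT t:{0..}|lborel. t powr p / exp t) = Gamma (p + 1)"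
  using set_borel_integral_eq_integral(2)[OF integrable_powr_exp_neg[OF assms]]
    Gamma_integral_real[of "p + 1"] assms by (simp add: integral_unique)

text \<open>\<open>exp z \<ge> 1 + z\<close> at \<open>z = h * ln u\<close> and at
  \<open>z = - h * ln u\<close> gives the two sides. The bound is free of \<open>h\<close>, so it
  can dominate the difference quotients when the Gamma integral is differentiated.\<close>

lemma powr_diff_quotient_bound:
  fixes u h :: real
  assumes "0 < u" "0 < h" "h \<le> 1"
  shows "\<bar>(u powr h - 1) / h\<bar> \<le> \<bar>ln u\<bar> * (1 + u)"
proof -
  have u: "u powr h = exp (h * ln u)" using assms by (simp add: powr_def)
  have low: "h * ln u \<le> u powr h - 1" unfolding u using exp_ge_add_one_self[of "h * ln u"] by linarith
  have "(1 - h * ln u) * exp (h * ln u) \<le> exp (- (h * ln u)) * exp (h * ln u)"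
    using exp_ge_add_one_self[of "- (h * ln u)"] by (intro mult_right_mono) auto
  then have up: "u powr h - 1 \<le> h * ln u * u powr h"
    unfolding u by (simp add: algebra_simps flip: exp_add)
  have "\<bar>u powr h - 1\<bar> \<le> h * (\<bar>ln u\<bar> * (1 + u))"
  proof (cases "1 \<le> u")
    case True
    have "u powr h \<le> u powr 1" using True assms by (intro powr_mono) auto
    then have "h * ln u * u powr h \<le> h * ln u * (1 + u)" using True assms by (intro mult_left_mono) auto
    moreover have "0 \<le> h * ln u" using True assms by simp
    ultimately show ?thesis using low up True by (simp add: mult.assoc)
  next
    case False
    then have "ln u < 0" using assms by simp
    then have "h * ln u * u powr h \<le> 0" using assms by (simp add: mult_nonpos_nonneg mult_nonneg_nonpos)
    then have "u powr h - 1 \<le> 0" using up by linarith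
    then have "\<bar>u powr h - 1\<bar> \<le> h * \<bar>ln u\<bar>" using low \<open>ln u < 0\<close> by simp
    also have "\<dots> \<le> h * (\<bar>ln u\<bar> * (1 + u))"
      using assms by (intro mult_left_mono) (auto simp: mult_le_cancel_left1)
    finally show ?thesis .
  qed
  then show ?thesis using assms by (simp add: abs_divide pos_divide_le_eq mult.commute)
qed

text \<open>The integral is the derivative of \<open>Gamma\<close> at 2: the difference quotients of
  \<open>u powr (1 + h) / exp u\<close> integrate to those of \<open>Gamma\<close>, dominated
  convergence produces the factor \<open>ln u\<close>, and
  \<open>Digamma 2 = 1 - euler_mascheroni\<close>.\<close>

lemma
  shows set_integrable_ln_exp: "set_integrable lborel {0..} (\<lambda>u::real. u * ln u / exp u)"
    and set_integral_ln_exp: "(LINT u:{0..}|lborel. u * ln u / exp u) = 1 - (euler_mascheroni :: real)"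
proof -
  define w where "w = (\<lambda>u::real. 3 * (u powr (4/3) / exp u + u powr (2/3) / exp u + u powr (7/3) / exp u + u powr (5/3) / exp u))"
  have w_int: "set_integrable lborel {0..} w"
    unfolding w_def
    by (intro set_integral_add set_integrable_mult_right integrable_powr_exp_neg) auto
  have bound: "u * (\<bar>ln u\<bar> * (1 + u)) / exp u \<le> w u" if "0 < u" for u
  proof -
    have "u * (\<bar>ln u\<bar> * (1 + u)) \<le> u * ((3 * (u powr (1/3) + u powr (- 1/3))) * (1 + u))"
      using that abs_ln_le_powr[OF that] by (intro mult_left_mono mult_right_mono) auto
    also have "\<dots> = 3 * (u powr (4/3) + u powr (2/3) + u powr (7/3) + u powr (5/3))"
      using that powr_add[of u 1 "1/3"] powr_add[of u 1 "- 1/3"] powr_add[of u 2 "1/3"] powr_add[of u 2 "- 1/3"]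
      by (simp add: algebra_simps powr_numeral power2_eq_square)
    finally show ?thesis
      unfolding w_def by (simp add: add_divide_distrib[symmetric] divide_right_mono)
  qed
  show i: "set_integrable lborel {0..} (\<lambda>u::real. u * ln u / exp u)"
  proof (rule set_integrable_bound[OF w_int])
    show "set_borel_measurable lborel {0..} (\<lambda>u::real. u * ln u / exp u)"
      unfolding set_borel_measurable_def by measurable
    have "norm (u * ln u / exp u) \<le> norm (w u)" if "0 \<le> u" for u
    proof (cases "u = 0")
      case False
      have "\<bar>u * ln u / exp u\<bar> \<le> u * (\<bar>ln u\<bar> * (1 + u)) / exp u"
        using that by (simp add: abs_mult divide_right_mono mult_left_mono mult_le_cancel_left1)
      also have "\<dots> \<le> w u" using bound that False by simp
      finally show ?thesis by simp
    qed simp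
    then show "AE x in lborel. x \<in> {0..} \<longrightarrow> norm (x * ln x / exp x) \<le> norm (w x)" by simp
  qed
  \<comment> \<open>A sequence tending to 0 inside \<open>(0, 1]\<close>, the range in which the
    dominating bound holds.\<close>
  define h where "h = (\<lambda>n. 1 / real (Suc n))"
  have h: "0 < h n" "h n \<le> 1" for n by (auto simp: h_def)
  have h_lim: "h \<longlonglongrightarrow> 0" unfolding h_def by real_asymp
  have lim: "(\<lambda>n. LINT u|lborel. indicator {0..} u *\<^sub>R ((u powr (1 + h n) / exp u - u powr 1 / exp u) / h n))
      \<longlonglongrightarrow> (LINT u|lborel. indicator {0..} u *\<^sub>R (u * ln u / exp u))"
  proof (rule integral_dominated_convergence)
    show "integrable lborel (\<lambda>u. indicator {0..} u *\<^sub>R w u)" using w_int by (simp add: set_integrable_def)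
    have q: "(u powr (1 + h n) / exp u - u powr 1 / exp u) / h n = u * ((u powr h n - 1) / h n) / exp u" if "0 < u" for u n
      using that h[of n] by (simp add: powr_add field_simps)
    show "AE u in lborel. (\<lambda>n. indicator {0..} u *\<^sub>R ((u powr (1 + h n) / exp u - u powr 1 / exp u) / h n))
        \<longlonglongrightarrow> indicator {0..} u *\<^sub>R (u * ln u / exp u)"
    proof (rule AE_I2)
      fix u :: real
      show "(\<lambda>n. indicator {0..} u *\<^sub>R ((u powr (1 + h n) / exp u - u powr 1 / exp u) / h n))
        \<longlonglongrightarrow> indicator {0..} u *\<^sub>R (u * ln u / exp u)"
      proof (cases "0 < u")
        case True
        have "((\<lambda>x. u powr x) has_real_derivative u powr 0 * ln u) (at 0)"
          using True by (auto intro!: derivative_eq_intros)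
        then have "((\<lambda>x. (u powr x - 1) / x) \<longlongrightarrow> ln u) (at 0)"
          using True by (simp add: has_field_derivative_iff)
        moreover have "filterlim h (at 0) sequentially"
          using h_lim h(1) by (auto simp: filterlim_at intro!: always_eventually less_imp_neq[symmetric])
        ultimately have "(\<lambda>n. (u powr h n - 1) / h n) \<longlonglongrightarrow> ln u"
          by (rule filterlim_compose)
        then have "(\<lambda>n. u * ((u powr h n - 1) / h n) / exp u) \<longlonglongrightarrow> u * ln u / exp u"
          by (intro tendsto_intros) auto
        then show ?thesis unfolding q[OF True] using True by simp
      qed (auto simp: indicator_def)
    qed
    have "norm (indicator {0..} u *\<^sub>R ((u powr (1 + h n) / exp u - u powr 1 / exp u) / h n))
        \<le> indicator {0..} u *\<^sub>R w u" for u n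
    proof (cases "0 < u")
      case True
      have "\<bar>u * ((u powr h n - 1) / h n) / exp u\<bar> = u * \<bar>(u powr h n - 1) / h n\<bar> / exp u"
        using True by (simp add: abs_mult)
      also have "\<dots> \<le> u * (\<bar>ln u\<bar> * (1 + u)) / exp u"
        using True h[of n] by (intro divide_right_mono mult_left_mono powr_diff_quotient_bound) auto
      also have "\<dots> \<le> w u" by (rule bound[OF True])
      finally show ?thesis unfolding q[OF True] using True by simp
    qed (auto simp: indicator_def w_def)
    then show "AE u in lborel. norm (indicator {0..} u *\<^sub>R ((u powr (1 + h n) / exp u - u powr 1 / exp u) / h n))
        \<le> indicator {0..} u *\<^sub>R w u" for n by simp
  qed measurable
  have val: "(LINT u|lborel. indicator {0..} u *\<^sub>R ((u powr (1 + h n) / exp u - u powr 1 / exp u) / h n))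
      = (Gamma (2 + h n) - Gamma 2) / h n" for n
  proof -
    define f g where "f = (\<lambda>u. u powr (1 + h n) / exp u)" and "g = (\<lambda>u::real. u powr 1 / exp u)"
    have fg: "set_integrable lborel {0..} f" "set_integrable lborel {0..} g"
      unfolding f_def g_def by (rule integrable_powr_exp_neg; use h[of n] in linarith)+
    have "(LINT u:{0..}|lborel. f u) = Gamma (1 + h n + 1)" "(LINT u:{0..}|lborel. g u) = Gamma (1 + 1)"
      unfolding f_def g_def by (rule set_lebesgue_integral_powr_exp_neg; use h[of n] in linarith)+
    moreover have "1 + h n + 1 = 2 + h n" "1 + 1 = (2::real)" by linarith+
    ultimately have val: "(LINT u:{0..}|lborel. f u) = Gamma (2 + h n)" "(LINT u:{0..}|lborel. g u) = Gamma 2"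
      by metis+
    have "(LINT u:{0..}|lborel. (f u - g u) / h n) = ((LINT u:{0..}|lborel. f u) - (LINT u:{0..}|lborel. g u)) / h n"
      using fg by (simp add: set_integral_diff)
    then show ?thesis
      unfolding val by (simp only: set_lebesgue_integral_def f_def g_def)
  qed
  have 1: "(\<lambda>n. (Gamma (2 + h n) - Gamma 2) / h n) \<longlonglongrightarrow> (LINT u:{0..}|lborel. u * ln u / exp u)"
    using lim unfolding val set_lebesgue_integral_def .
  have "(Gamma has_real_derivative Gamma 2 * Digamma 2) (at 2)"
    by (rule has_field_derivative_Gamma) (auto elim!: nonpos_Ints_cases)
  then have "((\<lambda>x. (Gamma (2 + x) - Gamma 2) / x) \<longlongrightarrow> Gamma 2 * Digamma (2::real)) (at 0)"
    by (simp add: DERIV_def)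
  moreover have "filterlim h (at 0) sequentially"
    using h_lim h(1) by (auto simp: filterlim_at intro!: always_eventually less_imp_neq[symmetric])
  ultimately have 2: "(\<lambda>n. (Gamma (2 + h n) - Gamma 2) / h n) \<longlonglongrightarrow> Gamma 2 * Digamma (2::real)"
    by (rule filterlim_compose)
  have "Gamma 2 = (1::real)" using Gamma_fact[of 1, where 'a = real] by simp
  moreover have "Digamma 2 = 1 - (euler_mascheroni::real)"
    by (subst Digamma_numeral) (simp add: harm_def)
  ultimately show "(LINT u:{0..}|lborel. u * ln u / exp u) = 1 - (euler_mascheroni :: real)"
    using LIMSEQ_unique[OF 1 2] by simp
qed

lemma integral_ln_exp_limit:
  "((\<lambda>s. integral {0..s} (\<lambda>u::real. u * ln u / exp u)) \<longlongrightarrow> 1 - euler_mascheroni) at_top"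
proof -
  have "((\<lambda>s::real. LINT u:{0..s}|lborel. u * ln u / exp u) \<longlongrightarrow> 1 - euler_mascheroni) at_top"
    unfolding set_integral_ln_exp[symmetric]
    by (rule tendsto_set_lebesgue_integral_at_top[OF _ set_integrable_ln_exp]) simp
  moreover have "(LINT u:{0..s}|lborel. u * ln u / exp u) = integral {0..s} (\<lambda>u. u * ln u / exp u)" for s :: real
    by (rule set_borel_integral_eq_integral(2)[OF set_integrable_subset[OF set_integrable_ln_exp]]) auto
  ultimately show ?thesis by simp
qed

text \<open>Integration by parts trades \<open>Z\<close> for \<open>I\<close>, whose expansion is
  known; the scaling \<open>t = y * u\<close> then lets \<open>ln y\<close> split off.\<close>

lemma integral_laplace_by_parts:
  assumes "0 < y" "0 \<le> s"
  shows "integral {0..y * s} (\<lambda>t. zeta_norm2 t * exp (- t / y))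
    = zeta_mean_square (y * s) * exp (- s) + integral {0..s} (\<lambda>u. zeta_mean_square (y * u) / exp u)"
    and "(\<lambda>u. zeta_mean_square (y * u) / exp u) integrable_on {0..s}"
proof -
  let ?M = "y * s"
  have M: "0 \<le> ?M" using assms by simp
  have der: "(zeta_mean_square has_real_derivative zeta_norm2 t) (at t within {0..?M})" if "t \<in> {0..?M}" for t
    unfolding zeta_mean_square_eq[abs_def]
    by (rule integral_has_real_derivative) (use that continuous_on_zeta_norm2 in auto)
  have "continuous_on {0..?M} zeta_mean_square" using der by (rule DERIV_continuous_on)
  then have "continuous_on {0..s} (\<lambda>u. zeta_mean_square (y * u))"
    by (rule continuous_on_compose2) (use assms in \<open>auto intro!: continuous_intros mult_left_mono\<close>)
  then show i: "(\<lambda>u. zeta_mean_square (y * u) / exp u) integrable_on {0..s}"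
    by (intro integrable_continuous_interval continuous_intros) auto
  have "((\<lambda>t. zeta_norm2 t * exp (- t / y) - zeta_mean_square t * exp (- t / y) / y) has_integral
      zeta_mean_square ?M * exp (- ?M / y) - zeta_mean_square 0 * exp (- 0 / y)) {0..?M}"
  proof (rule fundamental_theorem_of_calculus[OF M])
    fix t assume t: "t \<in> {0..?M}"
    have "((\<lambda>t. zeta_mean_square t * exp (- t / y)) has_real_derivative
        zeta_norm2 t * exp (- t / y) - zeta_mean_square t * exp (- t / y) / y) (at t within {0..?M})"
    proof (rule DERIV_cong)
      have "((\<lambda>t. exp (- t / y)) has_real_derivative - exp (- t / y) / y) (at t within {0..?M})"
        using assms by (auto intro!: derivative_eq_intros)
      from DERIV_mult[OF der[OF t] this]
      show "((\<lambda>t. zeta_mean_square t * exp (- t / y)) has_real_derivative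
          (zeta_norm2 t * exp (- t / y) + - exp (- t / y) / y * zeta_mean_square t)) (at t within {0..?M})" .
    qed simp
    then show "((\<lambda>t. zeta_mean_square t * exp (- t / y)) has_vector_derivative
        zeta_norm2 t * exp (- t / y) - zeta_mean_square t * exp (- t / y) / y) (at t within {0..?M})"
      by (simp add: has_real_derivative_iff_has_vector_derivative)
  qed
  then have A: "((\<lambda>t. zeta_norm2 t * exp (- t / y) - zeta_mean_square t * exp (- t / y) / y) has_integral
      zeta_mean_square ?M * exp (- s)) {0..?M}"
    using assms by (simp add: zeta_mean_square_eq)
  have "((\<lambda>u. zeta_mean_square (y * u) / exp u) has_integral integral {0..s} (\<lambda>u. zeta_mean_square (y * u) / exp u)) (cbox 0 s)"
    using i by (simp add: integrable_integral)
  from has_integral_affinity'[OF this, of "1 / y" 0]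
  have "((\<lambda>t. zeta_mean_square t / exp (t / y)) has_integral (integral {0..s} (\<lambda>u. zeta_mean_square (y * u) / exp u) * y)) {0..?M}"
    using assms by (simp add: field_simps)
  then have "((\<lambda>t. zeta_mean_square t / exp (t / y) * (1 / y)) has_integral
      (integral {0..s} (\<lambda>u. zeta_mean_square (y * u) / exp u) * y * (1 / y))) {0..?M}"
    by (rule has_integral_mult_left)
  then have B: "((\<lambda>t. zeta_mean_square t * exp (- t / y) / y) has_integral
      integral {0..s} (\<lambda>u. zeta_mean_square (y * u) / exp u)) {0..?M}"
  proof (rule has_integral_eq_rhs[OF has_integral_eq, rotated])
    show "integral {0..s} (\<lambda>u. zeta_mean_square (y * u) / exp u)
        = integral {0..s} (\<lambda>u. zeta_mean_square (y * u) / exp u) * y * (1 / y)" using assms by simp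
  qed (simp add: exp_minus divide_inverse)
  show "integral {0..y * s} (\<lambda>t. zeta_norm2 t * exp (- t / y))
    = zeta_mean_square (y * s) * exp (- s) + integral {0..s} (\<lambda>u. zeta_mean_square (y * u) / exp u)"
    using integral_unique[OF has_integral_add[OF A B]] by simp
qed

lemma integral_mult_exp_neg:
  assumes "0 \<le> s"
  shows "((\<lambda>u. u / exp u) has_integral 1 - (s + 1) * exp (- s)) {0..s::real}"
proof -
  define F where "F = (\<lambda>u::real. - (u + 1) * exp (- u))"
  have "(F has_real_derivative u / exp u) (at u)" for u
    unfolding F_def by (auto intro!: derivative_eq_intros simp: exp_minus field_simps)
  then have "((\<lambda>u. u / exp u) has_integral F s - F 0) {0..s}"
    by (rule has_integral_FTC_real[OF assms])
  moreover have "F s - F 0 = 1 - (s + 1) * exp (- s)" by (simp add: F_def algebra_simps)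
  ultimately show ?thesis by simp
qed

text \<open>The asymptotic statement is silent about small \<open>t\<close>, but the Laplace
  integral starts at 0. The constant \<open>C\<close> covers that range; in the Laplace mean it ends
  up divided by \<open>y\<close>.\<close>

lemma zeta_mean_square_remainder:
  assumes "(\<lambda>T. zeta_mean_square T - (T * ln T + A * T)) \<in> o(\<lambda>T. T)" "0 < e"
  obtains C where "0 \<le> C" "\<And>t. 0 \<le> t \<Longrightarrow> \<bar>zeta_mean_square t - (t * ln t + A * t)\<bar> \<le> e * t + C"
proof -
  from landau_o.smallD[OF assms] obtain T0 where T0:
    "\<And>t. T0 \<le> t \<Longrightarrow> \<bar>zeta_mean_square t - (t * ln t + A * t)\<bar> \<le> e * \<bar>t\<bar>"
    by (auto simp: eventually_at_top_linorder)
  define C where "C = zeta_mean_square \<bar>T0\<bar> + 6 * (1 + \<bar>T0\<bar>) powr (4/3) + \<bar>A\<bar> * \<bar>T0\<bar>"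
  have C0: "0 \<le> C" using zeta_mean_square_nonneg by (simp add: C_def)
  moreover have "\<bar>zeta_mean_square t - (t * ln t + A * t)\<bar> \<le> e * t + C" if t: "0 \<le> t" for t
  proof (cases "T0 \<le> t")
    case True
    then show ?thesis using T0[OF True] C0 t by simp
  next
    case False
    then have tT: "t \<le> \<bar>T0\<bar>" by simp
    have "zeta_mean_square t \<le> zeta_mean_square \<bar>T0\<bar>" by (rule zeta_mean_square_mono[OF tT])
    moreover have "\<bar>t * ln t\<bar> \<le> 6 * (1 + \<bar>T0\<bar>) powr (4/3)"
    proof -
      have "\<bar>t * ln t\<bar> \<le> 6 * (1 + t) powr (4/3)" using abs_ln_mult_le_powr[of t] t by simp
      also have "\<dots> \<le> 6 * (1 + \<bar>T0\<bar>) powr (4/3)" using t tT by (intro mult_left_mono powr_mono2) auto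
      finally show ?thesis .
    qed
    moreover have "\<bar>A * t\<bar> \<le> \<bar>A\<bar> * \<bar>T0\<bar>" using t tT by (simp add: abs_mult mult_left_mono)
    moreover have "0 \<le> e * t" using t assms by simp
    ultimately show ?thesis using zeta_mean_square_nonneg[of t] unfolding C_def by linarith
  qed
  ultimately show thesis by (rule that)
qed

lemma sq_mult_exp_neg_le:
  fixes s :: real
  assumes "0 \<le> s"
  shows "(1 + s)\<^sup>2 * exp (- s) \<le> 16 * exp (- s / 2)"
proof -
  have "(1 + s) \<le> 4 * exp (s / 4)" using exp_ge_add_one_self[of "s / 4"] by linarith
  then have "(1 + s)\<^sup>2 \<le> (4 * exp (s / 4))\<^sup>2" using assms by (intro power_mono) auto
  also have "\<dots> = 16 * exp (s / 2)" by (simp add: power_mult_distrib power2_eq_square flip: exp_add)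
  finally have "(1 + s)\<^sup>2 * exp (- s) \<le> 16 * exp (s / 2) * exp (- s)" by (intro mult_right_mono) auto
  also have "\<dots> = 16 * exp (- s / 2)"
    by (simp add: mult.assoc flip: exp_add)
  finally show ?thesis .
qed

text \<open>The expansion of \<open>I\<close> at \<open>y * u\<close> contributes
  \<open>ln y + A\<close> times the mass of \<open>u / exp u\<close>, the logarithmic integral with
  limit \<open>1 - euler_mascheroni\<close>, and a remainder tending to 0. The cut-off is at
  \<open>s = M y / y\<close>. As \<open>M\<close> is bounded only from below, the factors
  \<open>(1 + s)\<^sup>2\<close> coming from a crude bound on \<open>I\<close> have to be absorbed
  by half of \<open>exp (- s)\<close>; the other half is at most \<open>(2 * y) powr (-7)\<close>,
  because \<open>s \<ge> 14 * ln (2 * y)\<close>, and beats the remaining powers of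
  \<open>y\<close>.\<close>

lemma laplace_zeta_norm2_asymp:
  assumes A: "(\<lambda>T. zeta_mean_square T - (T * ln T + A * T)) \<in> o(\<lambda>T. T)"
    and M: "eventually (\<lambda>y. 14 * y * ln (2 * y) \<le> M y) at_top"
  shows "((\<lambda>y. integral {0..M y} (\<lambda>t. zeta_norm2 t * exp (- t / y)) / y - ln y - A)
      \<longlongrightarrow> 1 - euler_mascheroni) at_top"
proof -
  define s where "s = (\<lambda>y. M y / y)"
  define r where "r = (\<lambda>t. zeta_mean_square t - (t * ln t + A * t))"
  define L where "L = (\<lambda>s. integral {0..s} (\<lambda>u::real. u * ln u / exp u))"
  define R where "R = (\<lambda>y. integral {0..s y} (\<lambda>u. r (y * u) / y / exp u))"
  have s_ge: "eventually (\<lambda>y. 1 \<le> y \<and> 14 * ln (2 * y) \<le> s y \<and> 0 \<le> s y) at_top"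
    using M eventually_ge_at_top[of 1]
  proof eventually_elim
    case (elim y)
    then have "14 * ln (2 * y) \<le> s y" by (simp add: s_def pos_le_divide_eq mult_ac)
    moreover have "0 \<le> ln (2 * y)" using elim by simp
    ultimately show ?case using elim by linarith
  qed
  have s_lim: "filterlim s at_top at_top"
  proof (rule filterlim_at_top_mono)
    show "filterlim (\<lambda>y::real. 14 * ln (2 * y)) at_top at_top" by real_asymp
    show "\<forall>\<^sub>F y in at_top. 14 * ln (2 * y) \<le> s y" using s_ge by eventually_elim auto
  qed
  have L_lim: "((\<lambda>y. L (s y)) \<longlongrightarrow> 1 - euler_mascheroni) at_top"
    unfolding L_def by (rule filterlim_compose[OF integral_ln_exp_limit s_lim])
  have L_int: "(\<lambda>u::real. u * ln u / exp u) integrable_on {0..x}" for x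
    by (rule set_borel_integral_eq_integral(1)[OF set_integrable_subset[OF set_integrable_ln_exp]]) auto
  have r_meas_int: "(\<lambda>u. r (y * u) / y / exp u) integrable_on {0..x}"
    and decomp: "integral {0..x} (\<lambda>u. zeta_mean_square (y * u) / exp u) / y
       = (ln y + A) * (1 - (x + 1) * exp (- x)) + L x + integral {0..x} (\<lambda>u. r (y * u) / y / exp u)"
    if y: "0 < y" and x: "0 \<le> x" for y x
  proof -
    have e: "r (y * u) / y / exp u = zeta_mean_square (y * u) / exp u * (1 / y)
        - ((ln y + A) * (u / exp u) + u * ln u / exp u)" if "u \<in> {0..x}" for u
    proof (cases "u = 0")
      case False
      then have "ln (y * u) = ln y + ln u" using that y by (simp add: ln_mult)
      then show ?thesis using y by (simp add: r_def field_simps)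
    qed (simp add: r_def zeta_mean_square_eq)
    have "((\<lambda>u. zeta_mean_square (y * u) / exp u * (1 / y) - ((ln y + A) * (u / exp u) + u * ln u / exp u))
        has_integral (integral {0..x} (\<lambda>u. zeta_mean_square (y * u) / exp u) * (1 / y)
          - ((ln y + A) * (1 - (x + 1) * exp (- x)) + L x))) {0..x}"
      unfolding L_def
      by (intro has_integral_diff has_integral_add has_integral_mult_left has_integral_mult_right
          integral_mult_exp_neg[OF x] integrable_integral L_int integral_laplace_by_parts(2) x y)
    then have "((\<lambda>u. r (y * u) / y / exp u)
        has_integral (integral {0..x} (\<lambda>u. zeta_mean_square (y * u) / exp u) * (1 / y)
          - ((ln y + A) * (1 - (x + 1) * exp (- x)) + L x))) {0..x}"
      by (rule has_integral_eq[rotated]) (use e in auto)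
    then show "(\<lambda>u. r (y * u) / y / exp u) integrable_on {0..x}"
      "integral {0..x} (\<lambda>u. zeta_mean_square (y * u) / exp u) / y
       = (ln y + A) * (1 - (x + 1) * exp (- x)) + L x + integral {0..x} (\<lambda>u. r (y * u) / y / exp u)"
      by (auto simp: integrable_on_def integral_unique)
  qed
  have R_lim: "(R \<longlongrightarrow> 0) at_top"
  proof (rule tendstoI)
    fix e :: real assume e: "0 < e"
    obtain C where C: "0 \<le> C" "\<And>t. 0 \<le> t \<Longrightarrow> \<bar>r t\<bar> \<le> e / 2 * t + C"
      using zeta_mean_square_remainder[OF A, of "e / 2"] e unfolding r_def by (auto simp: field_simps)
    have "eventually (\<lambda>y. C / y < e / 2) at_top"
    proof -
      have "((\<lambda>y. C / y) \<longlongrightarrow> 0) at_top" by (rule tendsto_divide_0[OF tendsto_const filterlim_at_top_imp_at_infinity[OF filterlim_ident]])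
      from order_tendstoD(2)[OF this, of "e / 2"] show ?thesis using e by simp
    qed
    then show "\<forall>\<^sub>F y in at_top. dist (R y) 0 < e"
      using s_ge
    proof eventually_elim
      case (elim y)
      then have y: "0 < y" "0 \<le> s y" by auto
      have exp_int: "((\<lambda>u. exp (- u)) has_integral 1 - exp (- s y)) {0..s y}"
      proof -
        have "((\<lambda>u. exp (- u)) has_integral (- exp (- s y)) - (- exp (- 0))) {0..s y}"
          by (rule has_integral_FTC_real[OF y(2)]) (auto intro!: derivative_eq_intros)
        then show ?thesis by simp
      qed
      have B: "((\<lambda>u. e / 2 * (u / exp u) + C / y * exp (- u)) has_integral
          e / 2 * (1 - (s y + 1) * exp (- s y)) + C / y * (1 - exp (- s y))) {0..s y}"
        by (intro has_integral_add has_integral_mult_right integral_mult_exp_neg exp_int y)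
      have "norm (R y) \<le> integral {0..s y} (\<lambda>u. e / 2 * (u / exp u) + C / y * exp (- u))"
        unfolding R_def
      proof (rule integral_norm_bound_integral[OF r_meas_int[OF y]])
        show "(\<lambda>u. e / 2 * (u / exp u) + C / y * exp (- u)) integrable_on {0..s y}" using B by (auto simp: integrable_on_def)
        fix u assume u: "u \<in> {0..s y}"
        have "\<bar>r (y * u)\<bar> \<le> e / 2 * (y * u) + C" using u y by (intro C) auto
        then have "\<bar>r (y * u)\<bar> / y / exp u \<le> (e / 2 * (y * u) + C) / y / exp u"
          using y by (intro divide_right_mono) auto
        also have "\<dots> = e / 2 * (u / exp u) + C / y * exp (- u)" using y by (simp add: exp_minus field_simps)
        finally show "norm (r (y * u) / y / exp u) \<le> e / 2 * (u / exp u) + C / y * exp (- u)"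
          using y by (simp add: abs_divide)
      qed
      also have "\<dots> = e / 2 * (1 - (s y + 1) * exp (- s y)) + C / y * (1 - exp (- s y))"
        by (rule integral_unique[OF B])
      also have "\<dots> \<le> e / 2 * 1 + C / y * 1"
        using e C y by (intro add_mono mult_left_mono) auto
      also have "\<dots> < e" using elim(1) by linarith
      finally show ?case by simp
    qed
  qed
  obtain C where C: "0 \<le> C" "\<And>t. 0 \<le> t \<Longrightarrow> \<bar>r t\<bar> \<le> 1 * t + C"
    using zeta_mean_square_remainder[OF A, of 1] unfolding r_def by (auto simp: field_simps)
  define K where "K = 6 + \<bar>A\<bar> + 1 + C"
  have I_le: "zeta_mean_square t \<le> K * (1 + t)\<^sup>2" if t: "0 \<le> t" for t
  proof -
    have "\<bar>t * ln t\<bar> \<le> 6 * (1 + t) powr (4/3)" using abs_ln_mult_le_powr[of t] t by simp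
    also have "\<dots> \<le> 6 * (1 + t) powr 2" using t by (intro mult_left_mono powr_mono) auto
    finally have 1: "\<bar>t * ln t\<bar> \<le> 6 * (1 + t)\<^sup>2" using t by (simp add: powr_numeral)
    have tt: "t \<le> (1 + t)\<^sup>2" "1 \<le> (1 + t)\<^sup>2" using t by (auto simp: power2_eq_square algebra_simps)
    have "A * t \<le> \<bar>A\<bar> * (1 + t)\<^sup>2" using t tt by (intro mult_mono) auto
    moreover have "C * 1 \<le> C * (1 + t)\<^sup>2" using C tt by (intro mult_left_mono) auto
    ultimately show ?thesis using 1 C(2)[OF t] tt unfolding r_def K_def by (simp add: algebra_simps)
  qed
  have K0: "0 \<le> K" using C by (simp add: K_def)
  have tail: "eventually (\<lambda>y. (1 + s y)\<^sup>2 * exp (- s y) \<le> 16 * (2 * y) powr (-7)) at_top"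
    using s_ge
  proof eventually_elim
    case (elim y)
    have "(1 + s y)\<^sup>2 * exp (- s y) \<le> 16 * exp (- s y / 2)" using elim by (intro sq_mult_exp_neg_le) auto
    also have "\<dots> \<le> 16 * exp (- 7 * ln (2 * y))" using elim by simp
    also have "exp (- 7 * ln (2 * y)) = (2 * y) powr (-7)" using elim by (simp add: powr_def)
    finally show ?case .
  qed
  have T1: "((\<lambda>y. zeta_mean_square (y * s y) * exp (- s y) / y) \<longlongrightarrow> 0) at_top"
  proof (rule Lim_null_comparison)
    have "((\<lambda>y::real. y * (16 * (2 * y) powr (-7))) \<longlongrightarrow> 0) at_top" by real_asymp
    then show "((\<lambda>y::real. K * (y * (16 * (2 * y) powr (-7)))) \<longlongrightarrow> 0) at_top" by (rule tendsto_mult_right_zero)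
    show "\<forall>\<^sub>F y in at_top. norm (zeta_mean_square (y * s y) * exp (- s y) / y) \<le> K * (y * (16 * (2 * y) powr (-7)))"
      using s_ge tail
    proof eventually_elim
      case (elim y)
      have "1 + y * s y \<le> y * (1 + s y)" using elim by (simp add: algebra_simps)
      then have "(1 + y * s y)\<^sup>2 \<le> (y * (1 + s y))\<^sup>2" using elim by (intro power_mono) auto
      then have "zeta_mean_square (y * s y) \<le> K * (y * (1 + s y))\<^sup>2"
        using I_le[of "y * s y"] K0 elim mult_left_mono[of "(1 + y * s y)\<^sup>2" "(y * (1 + s y))\<^sup>2" K]
        by (auto intro: order_trans)
      then have "zeta_mean_square (y * s y) * exp (- s y) / y \<le> K * (y * (1 + s y))\<^sup>2 * exp (- s y) / y"
        using elim by (intro divide_right_mono mult_right_mono) auto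
      also have "\<dots> = K * (y * ((1 + s y)\<^sup>2 * exp (- s y)))"
        using elim by (simp add: power_mult_distrib power2_eq_square)
      also have "\<dots> \<le> K * (y * (16 * (2 * y) powr (-7)))"
        using elim K0 by (intro mult_left_mono) auto
      finally show ?case using elim zeta_mean_square_nonneg[of "y * s y"] by simp
    qed
  qed
  have T2: "((\<lambda>y. (ln y + A) * ((s y + 1) * exp (- s y))) \<longlongrightarrow> 0) at_top"
  proof (rule Lim_null_comparison)
    have "((\<lambda>y::real. ln y * (16 * (2 * y) powr (-7))) \<longlongrightarrow> 0) at_top" "((\<lambda>y::real. 16 * (2 * y) powr (-7)) \<longlongrightarrow> 0) at_top"
      by real_asymp+
    then have "((\<lambda>y::real. ln y * (16 * (2 * y) powr (-7)) + \<bar>A\<bar> * (16 * (2 * y) powr (-7))) \<longlongrightarrow> 0 + \<bar>A\<bar> * 0) at_top"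
      by (intro tendsto_intros)
    then show "((\<lambda>y::real. (ln y + \<bar>A\<bar>) * (16 * (2 * y) powr (-7))) \<longlongrightarrow> 0) at_top" by (simp add: distrib_right)
    show "\<forall>\<^sub>F y in at_top. norm ((ln y + A) * ((s y + 1) * exp (- s y))) \<le> (ln y + \<bar>A\<bar>) * (16 * (2 * y) powr (-7))"
      using s_ge tail
    proof eventually_elim
      case (elim y)
      have "(s y + 1) * 1 \<le> (1 + s y) * (1 + s y)" using elim by (intro mult_mono) auto
      then have 0: "(s y + 1) * exp (- s y) \<le> (1 + s y)\<^sup>2 * exp (- s y)"
        by (intro mult_right_mono) (auto simp: power2_eq_square)
      then have 1: "\<bar>(s y + 1) * exp (- s y)\<bar> \<le> 16 * (2 * y) powr (-7)" 
        using order_trans[OF 0, of "16 * (2 * y) powr (-7)"] elim by (auto simp: abs_mult)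
      have 2: "\<bar>ln y + A\<bar> \<le> ln y + \<bar>A\<bar>" using elim ln_ge_zero[of y] by linarith
      show ?case unfolding real_norm_def abs_mult[of "ln y + A"] using 1 2 by (intro mult_mono) auto
    qed
  qed
  have "((\<lambda>y. zeta_mean_square (y * s y) * exp (- s y) / y + L (s y) + R y - (ln y + A) * ((s y + 1) * exp (- s y)))
      \<longlongrightarrow> 0 + (1 - euler_mascheroni) + 0 - 0) at_top"
    by (intro tendsto_intros T1 T2 L_lim R_lim)
  then have lim: "((\<lambda>y. zeta_mean_square (y * s y) * exp (- s y) / y + L (s y) + R y - (ln y + A) * ((s y + 1) * exp (- s y)))
      \<longlongrightarrow> 1 - euler_mascheroni) at_top" by simp
  show ?thesis
  proof (rule Lim_transform_eventually[OF lim])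
    show "\<forall>\<^sub>F y in at_top. zeta_mean_square (y * s y) * exp (- s y) / y + L (s y) + R y - (ln y + A) * ((s y + 1) * exp (- s y))
        = integral {0..M y} (\<lambda>t. zeta_norm2 t * exp (- t / y)) / y - ln y - A"
      using s_ge
    proof eventually_elim
      case (elim y)
      then have y: "0 < y" "0 \<le> s y" by auto
      have "M y = y * s y" using y by (simp add: s_def)
      then have "integral {0..M y} (\<lambda>t. zeta_norm2 t * exp (- t / y)) / y
          = zeta_mean_square (y * s y) * exp (- s y) / y
            + integral {0..s y} (\<lambda>u. zeta_mean_square (y * u) / exp u) / y"
        using integral_laplace_by_parts(1)[OF y] by (simp add: add_divide_distrib)
      then show ?case unfolding decomp[OF y] R_def by (simp add: algebra_simps)
    qed
  qed
qed

section \<open>Jacob's ladder\<close>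

text \<open>By the functional equation the mean slope of \<open>ln_Gamma\<close> on
  \<open>[z, z + 1]\<close> is \<open>ln z\<close>. As \<open>Digamma\<close> increases, the mean
  slope on \<open>[y, T]\<close> lies between those on \<open>[y - 1, y]\<close> and
  \<open>[T, T + 1]\<close>.\<close>

lemma ln_Gamma_diff_bounds:
  fixes y T :: real
  assumes "2 < y" "y \<le> T"
  shows "(T - y) * ln (y - 1) \<le> ln_Gamma T - ln_Gamma y" "ln_Gamma T - ln_Gamma y \<le> (T - y) * ln T"
proof -
  have step: "ln_Gamma (z + 1) - ln_Gamma z = ln z" if "0 < z" for z :: real
  proof -
    have "0 < Gamma z" using that by simp
    moreover have "z \<notin> \<int>\<^sub>\<le>\<^sub>0" using that by (auto elim: nonpos_Ints_cases)
    ultimately show ?thesis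
      using that Gamma_plus1[of z] by (simp add: ln_Gamma_real_pos ln_mult_pos)
  qed
  have slope: "\<exists>\<xi>. a < \<xi> \<and> \<xi> < b \<and> ln_Gamma b - ln_Gamma a = (b - a) * Digamma \<xi>" if "0 < a" "a < b" for a b :: real
    using MVT2[of a b ln_Gamma Digamma] has_field_derivative_ln_Gamma_real that by force
  show "(T - y) * ln (y - 1) \<le> ln_Gamma T - ln_Gamma y" "ln_Gamma T - ln_Gamma y \<le> (T - y) * ln T"
  proof -
    consider "T = y" | "y < T" using assms by linarith
    then have "(T - y) * ln (y - 1) \<le> ln_Gamma T - ln_Gamma y \<and> ln_Gamma T - ln_Gamma y \<le> (T - y) * ln T"
    proof cases
      case 2
      obtain x1 where x1: "y - 1 < x1" "x1 < y" "ln_Gamma y - ln_Gamma (y - 1) = (y - (y - 1)) * Digamma x1"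
        using slope[of "y - 1" y] assms by auto
      obtain x2 where x2: "y < x2" "x2 < T" "ln_Gamma T - ln_Gamma y = (T - y) * Digamma x2"
        using slope[of y T] assms 2 by auto
      obtain x3 where x3: "T < x3" "x3 < T + 1" "ln_Gamma (T + 1) - ln_Gamma T = (T + 1 - T) * Digamma x3"
        using slope[of T "T + 1"] assms by auto
      have "ln (y - 1) = Digamma x1" using step[of "y - 1"] x1 assms by simp
      also have "\<dots> \<le> Digamma x2" using x1 x2 assms by (intro Digamma_real_mono) auto
      finally have 1: "ln (y - 1) \<le> Digamma x2" .
      have "Digamma x2 \<le> Digamma x3" using x2 x3 assms by (intro Digamma_real_mono) auto
      also have "\<dots> = ln T" using step[of T] x3 assms by simp
      finally have 3: "Digamma x2 \<le> ln T" .
      show ?thesis unfolding x2(3) using 1 3 2 by (auto intro!: mult_left_mono)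
    qed simp
    then show "(T - y) * ln (y - 1) \<le> ln_Gamma T - ln_Gamma y" "ln_Gamma T - ln_Gamma y \<le> (T - y) * ln T" by auto
  qed
qed

text \<open>On average \<open>I\<close> grows with slope about \<open>ln y\<close> near
  \<open>y\<close>, so a step \<open>k * y / ln y\<close> adds about \<open>k * y\<close>. The
  points reached in this way form a scale on which a solution \<open>T\<close> of
  \<open>I T = F y\<close> can be located.\<close>

lemma zeta_mean_square_shift:
  assumes A: "(\<lambda>T. zeta_mean_square T - (T * ln T + A * T)) \<in> o(\<lambda>T. T)" and k: "0 < k"
  shows "((\<lambda>y. zeta_mean_square (y + k * y / ln y) / y - ln y - A) \<longlongrightarrow> k) at_top"
proof -
  define S where "S = (\<lambda>y::real. y + k * y / ln y)"
  have S_lim: "filterlim S at_top at_top" unfolding S_def using k by real_asymp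
  define r where "r = (\<lambda>T. zeta_mean_square T - (T * ln T + A * T))"
  have "(\<lambda>y. r (S y)) \<in> o(\<lambda>y. S y)"
    using landau_o.small.compose[OF A S_lim] by (simp add: r_def)
  also have "S \<in> O(\<lambda>y. y)" unfolding S_def using k by real_asymp
  finally have "((\<lambda>y. r (S y) / y) \<longlongrightarrow> 0) at_top" by (rule smalloD_tendsto)
  moreover have "((\<lambda>y. S y * ln (S y) / y - ln y) \<longlongrightarrow> k) at_top"
    unfolding S_def using k by real_asymp
  moreover have "((\<lambda>y. S y / y) \<longlongrightarrow> 1) at_top" unfolding S_def using k by real_asymp
  ultimately have lim: "((\<lambda>y. r (S y) / y + (S y * ln (S y) / y - ln y) + A * (S y / y) - A) \<longlongrightarrow> 0 + k + A * 1 - A) at_top"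
    by (intro tendsto_intros)
  have eq: "r (S y) / y + (S y * ln (S y) / y - ln y) + A * (S y / y) - A = zeta_mean_square (S y) / y - ln y - A" for y
    by (simp add: r_def diff_divide_distrib add_divide_distrib)
  show ?thesis using lim unfolding eq unfolding S_def by simp
qed

text \<open>For large \<open>y\<close>, \<open>F y\<close> exceeds \<open>I\<close> at
  \<open>y + k * y / ln y\<close> if \<open>k < c\<close> and stays below it if
  \<open>k > c\<close>. Monotonicity of \<open>I\<close> traps \<open>T y\<close> between such
  points, and the slope bounds for \<open>ln_Gamma\<close> turn \<open>T y - y\<close>, about
  \<open>c * y / ln y\<close>, into about \<open>c * y\<close>.\<close>

lemma ln_Gamma_ratio_limit:
  assumes A: "(\<lambda>T. zeta_mean_square T - (T * ln T + A * T)) \<in> o(\<lambda>T. T)"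
    and F: "((\<lambda>y. F y / y - ln y - A) \<longlongrightarrow> c) at_top" and c: "0 < c"
    and T: "eventually (\<lambda>y. zeta_mean_square (T y) = F y) at_top"
  shows "((\<lambda>y. (ln_Gamma (T y) - ln_Gamma y) / y) \<longlongrightarrow> c) at_top"
proof -
  define S where "S = (\<lambda>k y::real. y + k * y / ln y)"
  have up: "eventually (\<lambda>y. T y < S k y) at_top" if k: "c < k" for k
  proof -
    have k0: "0 < k" using k c by simp
    have "eventually (\<lambda>y. (F y / y - ln y - A) < (c + k) / 2) at_top"
      by (rule order_tendstoD[OF F]) (use k in auto)
    moreover have "eventually (\<lambda>y. (c + k) / 2 < zeta_mean_square (S k y) / y - ln y - A) at_top"
      unfolding S_def by (rule order_tendstoD[OF zeta_mean_square_shift[OF A k0]]) (use k in auto)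
    ultimately show ?thesis using T eventually_gt_at_top[of 0]
    proof eventually_elim
      case (elim y)
      have "F y / y < zeta_mean_square (S k y) / y" using elim by linarith
      then have "zeta_mean_square (T y) < zeta_mean_square (S k y)" using elim by (simp add: divide_less_cancel)
      then show ?case using zeta_mean_square_mono[of "S k y" "T y"] by linarith
    qed
  qed
  have low: "eventually (\<lambda>y. S k y < T y) at_top" if k: "0 < k" "k < c" for k
  proof -
    have "eventually (\<lambda>y. (c + k) / 2 < (F y / y - ln y - A)) at_top"
      by (rule order_tendstoD[OF F]) (use k in auto)
    moreover have "eventually (\<lambda>y. zeta_mean_square (S k y) / y - ln y - A < (c + k) / 2) at_top"
      unfolding S_def by (rule order_tendstoD[OF zeta_mean_square_shift[OF A k(1)]]) (use k in auto)
    ultimately show ?thesis using T eventually_gt_at_top[of 0]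
    proof eventually_elim
      case (elim y)
      have "zeta_mean_square (S k y) / y < F y / y" using elim by linarith
      then have "zeta_mean_square (S k y) < zeta_mean_square (T y)" using elim by (simp add: divide_less_cancel)
      then show ?case using zeta_mean_square_mono[of "T y" "S k y"] by linarith
    qed
  qed
  have "eventually (\<lambda>y. S (c / 2) y < T y) at_top" by (rule low) (use c in auto)
  moreover have "eventually (\<lambda>y. y \<le> S (c / 2) y) at_top" unfolding S_def using c by real_asymp
  ultimately have Ty: "eventually (\<lambda>y. y \<le> T y) at_top" by eventually_elim simp
  show ?thesis
  proof (rule order_tendstoI)
    fix a assume a: "a < c"
    \<comment> \<open>The maximum with \<open>c / 2\<close> keeps \<open>k\<close> positive, also
      when \<open>a\<close> is negative.\<close>
    define k where "k = max ((a + c) / 2) (c / 2)"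
    have k: "0 < k" "k < c" "a < k" using a c by (auto simp: k_def max_def)
    have "((\<lambda>y::real. (k * y / ln y) * ln (y - 1) / y) \<longlongrightarrow> k) at_top" using k by real_asymp
    then have "eventually (\<lambda>y. a < (k * y / ln y) * ln (y - 1) / y) at_top"
      by (rule order_tendstoD) (use k in auto)
    then show "\<forall>\<^sub>F y in at_top. a < (ln_Gamma (T y) - ln_Gamma y) / y"
      using low[OF k(1,2)] Ty eventually_gt_at_top[of 2]
    proof eventually_elim
      case (elim y)
      have "(k * y / ln y) * ln (y - 1) \<le> (T y - y) * ln (y - 1)"
        using elim by (intro mult_right_mono) (auto simp: S_def)
      also have "\<dots> \<le> ln_Gamma (T y) - ln_Gamma y" by (rule ln_Gamma_diff_bounds) (use elim in auto)
      finally have "(k * y / ln y) * ln (y - 1) / y \<le> (ln_Gamma (T y) - ln_Gamma y) / y"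
        using elim by (intro divide_right_mono) auto
      then show ?case using elim by linarith
    qed
  next
    fix a assume a: "c < a"
    define k where "k = (a + c) / 2"
    have k: "0 < k" "c < k" "k < a" using a c by (auto simp: k_def)
    have "((\<lambda>y::real. (k * y / ln y) * ln (y + k * y / ln y) / y) \<longlongrightarrow> k) at_top" using k by real_asymp
    then have "eventually (\<lambda>y. (k * y / ln y) * ln (S k y) / y < a) at_top"
      unfolding S_def by (rule order_tendstoD) (use k in auto)
    then show "\<forall>\<^sub>F y in at_top. (ln_Gamma (T y) - ln_Gamma y) / y < a"
      using up[OF k(2)] Ty eventually_gt_at_top[of 2]
    proof eventually_elim
      case (elim y)
      have "ln_Gamma (T y) - ln_Gamma y \<le> (T y - y) * ln (T y)" by (rule ln_Gamma_diff_bounds) (use elim in auto)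
      also have "\<dots> \<le> (k * y / ln y) * ln (S k y)"
        using elim k by (intro mult_mono) (auto simp: S_def)
      finally have "(ln_Gamma (T y) - ln_Gamma y) / y \<le> (k * y / ln y) * ln (S k y) / y"
        using elim by (intro divide_right_mono) auto
      then show ?case using elim by linarith
    qed
  qed
qed

section \<open>The ladder equation and its inverse\<close>

definition ladder_laplace :: "(real \<Rightarrow> real) \<Rightarrow> real \<Rightarrow> real" where
  "ladder_laplace \<mu> X = integral {0..\<mu> X} (\<lambda>t. zeta_norm2 t * exp (- 2 * t / X))"

lemma ladder_solution_eq:
  "ladder_solution \<mu> y\<^sub>0 T X \<longleftrightarrow> X \<ge> y\<^sub>0 \<and> ladder_laplace \<mu> X = zeta_mean_square T"
  by (simp add: ladder_solution_def ladder_laplace_def zeta_norm2_def)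

text \<open>Integrand and range of integration both grow with \<open>X\<close>. If the growth of the
  integrand on \<open>[0, m]\<close> contributed nothing, \<open>Z\<close> would vanish on
  \<open>(0, m]\<close>, where the exponential factors differ, contrary to the positive value at
  \<open>X\<close>. Positivity of the integral thus takes the place of information on the zeros of
  zeta.\<close>

lemma ladder_laplace_strict_mono:
  assumes "0 < X" "X < X'" "\<mu> X \<le> \<mu> X'" "0 < ladder_laplace \<mu> X"
  shows "ladder_laplace \<mu> X < ladder_laplace \<mu> X'"
proof -
  define m where "m = \<mu> X"
  define h where "h = (\<lambda>X t. zeta_norm2 t * exp (- 2 * t / X))"
  have cont: "continuous_on S (h X)" if "X > 0" for S X
    unfolding h_def using that by (intro continuous_intros continuous_on_zeta_norm2) auto
  have int: "h X integrable_on {a..b}" if "X > 0" for a b X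
    by (intro integrable_continuous_interval cont that)
  have X': "0 < X'" using assms by simp
  have laplace: "ladder_laplace \<mu> X = integral {0..\<mu> X} (h X)" for X
    by (simp add: ladder_laplace_def h_def)
  have m: "0 < m"
  proof (rule ccontr)
    assume "\<not> 0 < m"
    then have "{0..\<mu> X} = {} \<or> {0..\<mu> X} = {0}" unfolding m_def by auto
    then have "ladder_laplace \<mu> X = 0" unfolding ladder_laplace_def by auto
    then show False using assms by simp
  qed
  have le: "h X t \<le> h X' t" if "0 \<le> t" for t
  proof -
    have "2 * t / X' \<le> 2 * t / X" using that assms by (intro divide_left_mono) auto
    then show ?thesis unfolding h_def using zeta_norm2_nonneg by (intro mult_left_mono) auto
  qed
  have 1: "integral {0..m} (h X') \<le> ladder_laplace \<mu> X'"
    unfolding laplace using assms int[OF X'] zeta_norm2_nonneg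
    by (intro integral_subset_le) (auto simp: m_def h_def)
  have 2: "integral {0..m} (h X) < integral {0..m} (h X')"
  proof (rule ccontr)
    assume "\<not> integral {0..m} (h X) < integral {0..m} (h X')"
    moreover have "integral {0..m} (h X) \<le> integral {0..m} (h X')"
      using le int[OF X'] int[OF assms(1)] by (intro integral_le) auto
    ultimately have "integral {0..m} (\<lambda>t. h X' t - h X t) = 0"
      using int[OF X'] int[OF assms(1)] by (simp add: integral_diff)
    moreover have "continuous_on {0..m} (\<lambda>t. h X' t - h X t)"
      by (intro continuous_on_diff cont X' assms(1))
    ultimately have z: "h X' t - h X t = 0" if "t \<in> {0..m}" for t
      using integral_eq_0_iff[of 0 m "\<lambda>t. h X' t - h X t"] le m that by auto
    \<comment> \<open>At \<open>t = 0\<close> both exponentials are 1, so this point is left out and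
      later discarded as negligible.\<close>
    have zero: "h X t = 0" if "t \<in> {0..m} - {0}" for t
    proof -
      have "2 * t / X' < 2 * t / X" using that assms by (intro divide_strict_left_mono) auto
      then have "exp (- 2 * t / X) < exp (- 2 * t / X')" by simp
      moreover have "zeta_norm2 t * (exp (- 2 * t / X') - exp (- 2 * t / X)) = 0"
        using z[of t] that by (simp add: h_def right_diff_distrib)
      ultimately show ?thesis by (auto simp: h_def)
    qed
    have "((\<lambda>t. 0) has_integral 0) {0..m}" by simp
    then have "(h X has_integral 0) {0..m}"
      by (rule has_integral_spike_finite[of "{0}", rotated 2]) (use zero in auto)
    then have "ladder_laplace \<mu> X = 0"
      unfolding laplace m_def[symmetric] by (rule integral_unique)
    then show False using assms by simp
  qed
  show ?thesis
    using 1 2 unfolding laplace[of X] m_def[symmetric] by linarith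
qed

text \<open>By strict monotonicity \<open>2 * y\<close> is the only solution \<open>X\<close> for
  every \<open>T\<close> at which \<open>I\<close> takes the value on the right, and the
  intermediate value theorem provides such a \<open>T\<close>. So \<open>y\<close> is a value of the
  ladder on \<open>ladder_domain\<close>, and whichever preimage \<open>inv_into\<close> selects
  satisfies the equation.\<close>

lemma zeta_mean_square_ladder_inverse:
  assumes "0 < y\<^sub>0" "mono_on {y\<^sub>0..} \<mu>" "y\<^sub>0 \<le> 2 * y" "0 < ladder_laplace \<mu> (2 * y)"
    and unb: "filterlim zeta_mean_square at_top at_top"
  shows "zeta_mean_square (ladder_inverse \<mu> y\<^sub>0 y) = ladder_laplace \<mu> (2 * y)"
proof -
  define V where "V = ladder_laplace \<mu> (2 * y)"
  have uniq: "X = 2 * y" if "y\<^sub>0 \<le> X" "ladder_laplace \<mu> X = V" for X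
  proof (rule ccontr)
    assume "X \<noteq> 2 * y"
    then consider "X < 2 * y" | "2 * y < X" by linarith
    then show False
    proof cases
      case 1
      have "\<mu> X \<le> \<mu> (2 * y)" using assms that 1 by (intro mono_onD[OF assms(2)]) auto
      then show False
        using ladder_laplace_strict_mono[of X "2 * y" \<mu>] 1 that assms by (simp add: V_def)
    next
      case 2
      have "\<mu> (2 * y) \<le> \<mu> X" using assms that 2 by (intro mono_onD[OF assms(2)]) auto
      then show False
        using ladder_laplace_strict_mono[of "2 * y" X \<mu>] 2 that assms by (simp add: V_def)
    qed
  qed
  have sol: "ladder_solution \<mu> y\<^sub>0 T X \<longleftrightarrow> X = 2 * y" if "zeta_mean_square T = V" for T X
    using uniq[of X] assms that by (auto simp: ladder_solution_eq V_def)
  obtain N where N: "0 \<le> N" "V \<le> zeta_mean_square N"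
  proof -
    have "eventually (\<lambda>T. V \<le> zeta_mean_square T \<and> 0 \<le> T) at_top"
      using unb[unfolded filterlim_at_top, rule_format, of V] eventually_ge_at_top[of 0] by eventually_elim auto
    then show thesis using that by (auto simp: eventually_at_top_linorder)
  qed
  have "continuous_on {0..N} zeta_mean_square"
    unfolding zeta_mean_square_eq[abs_def]
    by (intro indefinite_integral_continuous_1 integrable_continuous_interval continuous_on_zeta_norm2)
  then obtain T where T: "0 \<le> T" "zeta_mean_square T = V"
    using IVT'[of zeta_mean_square 0 V N] N assms(4) by (auto simp: zeta_mean_square_eq V_def)
  have "\<exists>!X. ladder_solution \<mu> y\<^sub>0 T X" using sol[OF T(2)] by auto
  then have "T \<in> ladder_domain \<mu> y\<^sub>0" using T by (simp add: ladder_domain_def)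
  moreover have "jacob_ladder \<mu> y\<^sub>0 T = y"
  proof -
    have "jacob_phi \<mu> y\<^sub>0 T = 2 * y"
      unfolding jacob_phi_def by (rule the_equality) (auto simp: sol[OF T(2)])
    then show ?thesis by (simp add: jacob_ladder_def)
  qed
  ultimately have img: "y \<in> jacob_ladder \<mu> y\<^sub>0 ` ladder_domain \<mu> y\<^sub>0" by force
  define T' where "T' = ladder_inverse \<mu> y\<^sub>0 y"
  have T': "T' \<in> ladder_domain \<mu> y\<^sub>0" "jacob_ladder \<mu> y\<^sub>0 T' = y"
    using inv_into_into[OF img] f_inv_into_f[OF img] by (auto simp: T'_def ladder_inverse_def)
  then have "ladder_solution \<mu> y\<^sub>0 T' (jacob_phi \<mu> y\<^sub>0 T')"
    unfolding jacob_phi_def ladder_domain_def by (auto intro: theI')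
  moreover have "jacob_phi \<mu> y\<^sub>0 T' = 2 * y" using T'(2) by (simp add: jacob_ladder_def)
  ultimately show ?thesis by (simp add: ladder_solution_eq T'_def)
qed

theorem lemma3:
  fixes \<mu> :: "real \<Rightarrow> real" and y\<^sub>0 x :: real
  assumes "y\<^sub>0 > 0"
    and "smooth_on_halfline \<mu> y\<^sub>0"
    and "mono_on {y\<^sub>0..} \<mu>"
    and "\<not> bdd_above (\<mu> ` {y\<^sub>0..})"
    and "\<And>y. y \<ge> y\<^sub>0 \<Longrightarrow> \<mu> y \<ge> 7 * y * ln y"
    and "x > 0"
  shows "((\<lambda>\<tau>. ln ((Gamma (ladder_inverse \<mu> y\<^sub>0 (x / (1 - euler_mascheroni) * \<tau>))
                     / Gamma (x / (1 - euler_mascheroni) * \<tau>)) powr (1 / \<tau>)))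
           \<longlongrightarrow> x) at_top"
proof -
  define c where "c = 1 - (euler_mascheroni :: real)"
  have c: "0 < c" using euler_mascheroni_less_13_over_22 by (simp add: c_def)
  obtain A where A: "(\<lambda>T. zeta_mean_square T - (T * ln T + A * T)) \<in> o(\<lambda>T. T)"
    using zeta_mean_square_asymp by blast
  \<comment> \<open>If the ladder takes the value \<open>y\<close>, then \<open>X = 2 * y\<close>:
    the weight \<open>exp (- 2 * t / X)\<close> becomes \<open>exp (- t / y)\<close>, and the lower
    bound on the upper limit becomes \<open>14 * y * ln (2 * y)\<close>.\<close>
  define F where "F = (\<lambda>y. ladder_laplace \<mu> (2 * y))"
  have "((\<lambda>y. integral {0..\<mu> (2 * y)} (\<lambda>t. zeta_norm2 t * exp (- t / y)) / y - ln y - A) \<longlongrightarrow> c) at_top"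
    unfolding c_def
  proof (rule laplace_zeta_norm2_asymp[OF A])
    show "\<forall>\<^sub>F y in at_top. 14 * y * ln (2 * y) \<le> \<mu> (2 * y)"
      using eventually_ge_at_top[of y\<^sub>0]
    proof eventually_elim
      case (elim y)
      then show ?case using assms(5)[of "2 * y"] assms(1) by simp
    qed
  qed
  then have F: "((\<lambda>y. F y / y - ln y - A) \<longlongrightarrow> c) at_top"
    by (simp add: F_def ladder_laplace_def)
  have pos: "eventually (\<lambda>y. 0 < F y) at_top"
  proof -
    have "eventually (\<lambda>y. 0 < F y / y - ln y - A) at_top" by (rule order_tendstoD(1)[OF F c])
    moreover have "eventually (\<lambda>y. 0 \<le> ln y + A) at_top" by real_asymp
    ultimately show ?thesis using eventually_gt_at_top[of 0]
    proof eventually_elim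
      case (elim y)
      then have "0 < F y / y" by linarith
      then show ?case using elim by (simp add: zero_less_divide_iff)
    qed
  qed
  have unb: "filterlim zeta_mean_square at_top at_top"
  proof (rule filterlim_at_top_mono)
    show "filterlim (\<lambda>T::real. T * (ln T + A - 1)) at_top at_top" by real_asymp
    show "\<forall>\<^sub>F T in at_top. T * (ln T + A - 1) \<le> zeta_mean_square T"
      using landau_o.smallD[OF A zero_less_one] eventually_ge_at_top[of 0]
    proof eventually_elim
      case (elim T)
      then have "T * ln T + A * T - T \<le> zeta_mean_square T" by (simp add: abs_le_iff)
      then show ?case by (simp add: algebra_simps)
    qed
  qed
  define D where "D = (\<lambda>y. (ln_Gamma (ladder_inverse \<mu> y\<^sub>0 y) - ln_Gamma y) / y)"
  have inv: "eventually (\<lambda>y. zeta_mean_square (ladder_inverse \<mu> y\<^sub>0 y) = F y) at_top"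
    using pos eventually_ge_at_top[of y\<^sub>0]
  proof eventually_elim
    case (elim y)
    then show ?case
      unfolding F_def using assms by (intro zeta_mean_square_ladder_inverse unb) auto
  qed
  have D: "(D \<longlongrightarrow> c) at_top"
    unfolding D_def by (rule ln_Gamma_ratio_limit[OF A F c inv])
  \<comment> \<open>At a nonpositive argument \<open>I\<close> is an integral over an empty or
    one-point interval, hence 0, contrary to \<open>0 < F y\<close>. Positivity allows
    \<open>ln (Gamma T)\<close> to be read as \<open>ln_Gamma T\<close>.\<close>
  have inv_pos: "eventually (\<lambda>y. 0 < ladder_inverse \<mu> y\<^sub>0 y) at_top"
    using inv pos
  proof eventually_elim
    case (elim y)
    show ?case
    proof (rule ccontr)
      assume "\<not> 0 < ladder_inverse \<mu> y\<^sub>0 y"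
      then have "zeta_mean_square (ladder_inverse \<mu> y\<^sub>0 y) \<le> zeta_mean_square 0"
        by (intro zeta_mean_square_mono) simp
      then show False using elim by (simp add: zeta_mean_square_eq)
    qed
  qed
  have lim: "filterlim (\<lambda>\<tau>. x / c * \<tau>) at_top at_top"
    using assms(6) c by (intro filterlim_tendsto_pos_mult_at_top[OF tendsto_const]) (auto intro: filterlim_ident)
  \<comment> \<open>With \<open>y = x / c * \<tau>\<close>, \<open>1 / \<tau>\<close> equals
    \<open>(x / c) / y\<close>, so the expression in question is \<open>x / c\<close> times
    \<open>D y\<close>, and \<open>D\<close> tends to \<open>c\<close>.\<close>
  have "((\<lambda>\<tau>. x / c * D (x / c * \<tau>)) \<longlongrightarrow> x / c * c) at_top"
    by (intro tendsto_intros filterlim_compose[OF D lim])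
  then have main: "((\<lambda>\<tau>. x / c * D (x / c * \<tau>)) \<longlongrightarrow> x) at_top" using c by simp
  show ?thesis
    unfolding c_def[symmetric]
  proof (rule Lim_transform_eventually[OF main])
    show "\<forall>\<^sub>F \<tau> in at_top. x / c * D (x / c * \<tau>)
        = ln ((Gamma (ladder_inverse \<mu> y\<^sub>0 (x / c * \<tau>)) / Gamma (x / c * \<tau>)) powr (1 / \<tau>))"
      using eventually_gt_at_top[of 0] eventually_compose_filterlim[OF inv_pos lim]
    proof eventually_elim
      case (elim \<tau>)
      define y where "y = x / c * \<tau>"
      have y: "0 < y" "x / c / y = 1 / \<tau>" using elim assms(6) c by (auto simp: y_def)
      have "0 < ladder_inverse \<mu> y\<^sub>0 y" using elim by (simp add: y_def)
      then have "Gamma (ladder_inverse \<mu> y\<^sub>0 y) \<noteq> 0" "Gamma y \<noteq> 0"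
        using y Gamma_real_pos less_imp_neq by metis+
      with \<open>0 < ladder_inverse \<mu> y\<^sub>0 y\<close> have "ln ((Gamma (ladder_inverse \<mu> y\<^sub>0 y) / Gamma y) powr (1 / \<tau>))
          = 1 / \<tau> * (ln_Gamma (ladder_inverse \<mu> y\<^sub>0 y) - ln_Gamma y)"
        using y by (simp add: ln_powr ln_div ln_Gamma_real_pos)
      also have "\<dots> = x / c * D y" unfolding D_def y(2)[symmetric] by simp
      finally show ?case by (simp add: y_def)
    qed
  qed
qed

end
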